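(* Let $\mathbb{P}$ be a forcing notion and let $\lambda,\kappa,\mu$ be infinite cardinals and $\mathcal{D}$ a filter on $\kappa$ such that $\mathbb{P}$ has a $(\lambda,\kappa,\mu,\mathcal{D})$-filtration. Assume moreover that $\kappa$ is regular. Then $\mathbb{P}$ forces that every uniform ultrafilter on $\kappa$ that extends $\mathcal{D}$ is generated by a set of size at most $\mu$. In particular, $\mathbb{P}$ forces that $\mathfrak{u}(\kappa)\le\mu$.
   Context: A forcing notion $(\mathbb{P},\le_{\mathbb{P}},\mathbb{1}_{\mathbb{P}})$ is a complete suborder of $(\mathbb{Q},\le_{\mathbb{Q}},\mathbb{1}_{\mathbb{Q}})$, written $\mathbb{P}\subseteq_{\mathrm{c}}\mathbb{Q}$, if: $\mathbb{1}_{\mathbb{P}}=\mathbb{1}_{\mathbb{Q}}$; $\mathbb{P}\subseteq\mathbb{Q}$; $\le_{\mathbb{P}}=\le_{\mathbb{Q}}\cap(\mathbb{P}\times\mathbb{P})$; for $p,p'\in\mathbb{P}$, $p,p'$ are incompatible in $\mathbb{P}$ iff incompatible in $\mathbb{Q}$; and every maximal antichain of $\mathbb{P}$ is a maximal antichain of $\mathbb{Q}$. A filter (or ultrafilter) $\mathcal{F}$ on a cardinal $\kappa$ is uniform if every member has size $\kappa$. For infinite cardinals $\nu,\kappa$, a filter $\mathcal{F}$ on $\kappa$ is $\nu$-indecomposable if whenever $\langle Y_\xi:\xi<\nu\rangle$ is a partition of $\kappa$, there is $T\subseteq\nu$ with $|T|<\nu$ and $\bigcup_{\xi\in T}Y_\xi\in\mathcal{F}$.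 A forcing notion $\mathbb{P}$ has a $(\lambda,\kappa,\mu,\mathcal{D})$-filtration if there is a sequence $\langle\mathbb{P}_\alpha:\alpha<\mu\rangle$ such that: (1) $\lambda,\kappa,\mu$ are infinite cardinals with $\lambda<\mathrm{cf}(\mu)<\kappa<\mu$; (2) $\mu$ is a strong limit cardinal and $\lambda^{<\lambda}=\lambda$; (3) $\mathcal{D}$ is a uniform $\mathrm{cf}(\mu)$-indecomposable filter on $\kappa$; (4) $\mathbb{P}$ is $\lambda^+$-c.c. and every $p\in\mathbb{P}$ lies in some $\mathbb{P}_\alpha$, $\alpha<\mu$; (5) for each $\alpha<\mu$, $\mathbb{P}_\alpha\subseteq_{\mathrm{c}}\mathbb{P}$ and $\mathbb{P}_\xi\subseteq\mathbb{P}_\alpha$ for all $\xi<\alpha$; (6) $|\mathbb{P}_\alpha|<\mu$ for each $\alpha<\mu$. A set $\mathcal{X}\subseteq\mathcal{U}$ generates an ultrafilter $\mathcal{U}$ on $\kappa$ if $\mathcal{U}=\{A\subseteq\kappa:\exists B\in\mathcal{X}\,(B\subseteq A)\}$. For regular $\kappa\ge\omega$, $\mathfrak{u}(\kappa)$ is the least cardinality of a family generating some uniform ultrafilter on $\kappa$. *)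

theory Defs
  imports Main "HOL-Library.Equipollence" "HOL-Library.FuncSet" "HOL-Library.Disjoint_Sets"
begin

text \<open>
  The ground universe \<open>V\<close> is a type whose elements satisfy ZFC. Separation and replacement are
  stated for arbitrary HOL predicates and functions; the axiom of choice for \<open>V\<close> then follows
  from choice in HOL. Hence every HOL function on a set of \<open>V\<close> (with values in \<open>V\<close>) is
  represented by an element of \<open>V\<close>, and cardinalities of sets of \<open>V\<close> may be compared by
  \<open>\<approx>\<close>, \<open>\<lesssim>\<close> and \<open>\<prec>\<close>.
\<close>

class zfc_universe =
  fixes elts :: "'a \<Rightarrow> 'a set"
  assumes extensionality: "elts x = elts y \<Longrightarrow> x = y"
    and foundation: "wf {(x, y). x \<in> elts y}"
    and pairing: "\<exists>z. elts z = {x, y}"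
    and union: "\<exists>z. elts z = \<Union>(elts ` elts x)"
    and powerset: "\<exists>z. elts z = {y. elts y \<subseteq> elts x}"
    and infinity: "\<exists>z. (\<exists>e\<in>elts z. elts e = {}) \<and>
                       (\<forall>x\<in>elts z. \<exists>y\<in>elts z. elts y = insert x (elts x))"
    and separation: "\<exists>z. elts z = {y \<in> elts x. Q y}"
    and replacement: "\<exists>z. elts z = F ` elts x"

text \<open>Meaningful only if \<open>X\<close> is the set of elements of some member of the universe.\<close>

definition vset :: "'a::zfc_universe set \<Rightarrow> 'a" where
  "vset X = (THE z. elts z = X)"

definition vpair :: "'a::zfc_universe \<Rightarrow> 'a \<Rightarrow> 'a" where
  "vpair x y = vset {vset {x, x}, vset {x, y}}"

lemma elts_vset: "elts z = X \<Longrightarrow> elts (vset X) = X"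
  unfolding vset_def by (rule theI[of "\<lambda>z. elts z = X"]) (auto intro: extensionality)

lemma elts_vset_pair [simp]: "elts (vset {x, y}) = {x, y}"
  using pairing[of x y] elts_vset by blast

lemma fst_vpair_below: "vpair x y \<in> elts z \<Longrightarrow> (x, z) \<in> {(x, y). x \<in> elts y}\<^sup>+"
proof -
  assume z: "vpair x y \<in> elts z"
  have "x \<in> elts (vset {x, x})" "vset {x, x} \<in> elts (vpair x y)"
    unfolding vpair_def by (simp_all only: elts_vset_pair insert_iff simp_thms)
  then show ?thesis
    using z by (meson CollectI case_prodI trancl.r_into_trancl trancl_into_trancl)
qed


section \<open>Ordinals and cardinals\<close>

definition Transset :: "'a::zfc_universe \<Rightarrow> bool" where
  "Transset x \<longleftrightarrow> (\<forall>y\<in>elts x. elts y \<subseteq> elts x)"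

text \<open>Von Neumann ordinals, ordered by membership.\<close>

definition Ord :: "'a::zfc_universe \<Rightarrow> bool" where
  "Ord x \<longleftrightarrow> Transset x \<and> (\<forall>y\<in>elts x. Transset y)"

definition ord_least :: "('a::zfc_universe \<Rightarrow> bool) \<Rightarrow> 'a" where
  "ord_least Q = (THE \<alpha>. Ord \<alpha> \<and> Q \<alpha> \<and> (\<forall>\<beta>\<in>elts \<alpha>. \<not> Q \<beta>))"

definition Card :: "'a::zfc_universe \<Rightarrow> bool" where
  "Card \<kappa> \<longleftrightarrow> Ord \<kappa> \<and> (\<forall>\<alpha>\<in>elts \<kappa>. \<not> elts \<alpha> \<approx> elts \<kappa>)"

definition InfCard :: "'a::zfc_universe \<Rightarrow> bool" where
  "InfCard \<kappa> \<longleftrightarrow> Card \<kappa> \<and> infinite (elts \<kappa>)"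

definition card_succ :: "'a::zfc_universe \<Rightarrow> 'a" where
  "card_succ \<nu> = ord_least (\<lambda>\<kappa>. Card \<kappa> \<and> \<nu> \<in> elts \<kappa>)"

definition cf :: "'a::zfc_universe \<Rightarrow> 'a" where
  "cf \<mu> = ord_least (\<lambda>\<delta>. \<exists>f \<in> elts \<delta> \<rightarrow> elts \<mu>.
             \<forall>\<alpha>\<in>elts \<mu>. \<exists>\<xi>\<in>elts \<delta>. \<alpha> \<in> elts (f \<xi>) \<or> \<alpha> = f \<xi>)"

definition regular :: "'a::zfc_universe \<Rightarrow> bool" where
  "regular \<kappa> \<longleftrightarrow> InfCard \<kappa> \<and> cf \<kappa> = \<kappa>"

definition strong_limit :: "'a::zfc_universe \<Rightarrow> bool" where
  "strong_limit \<mu> \<longleftrightarrow> InfCard \<mu> \<and> (\<forall>\<nu>\<in>elts \<mu>. Card \<nu> \<longrightarrow> Pow (elts \<nu>) \<prec> elts \<mu>)"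

text \<open>\<open>\<lambda>\<^bsup><\<lambda>\<^esup> = \<lambda>\<close>, where \<open>\<lambda>\<^bsup><\<lambda>\<^esup>\<close> is the number of functions from some \<open>\<alpha> < \<lambda>\<close> to \<open>\<lambda>\<close>.\<close>

definition weak_power_eq :: "'a::zfc_universe \<Rightarrow> bool" where
  "weak_power_eq l \<longleftrightarrow> (SIGMA \<alpha>:elts l. elts \<alpha> \<rightarrow>\<^sub>E elts l) \<approx> elts l"


section \<open>Filters in the ground universe\<close>

definition filter_on :: "'a::zfc_universe \<Rightarrow> 'a \<Rightarrow> bool" where
  "filter_on \<kappa> D \<longleftrightarrow>
     (\<forall>A\<in>elts D. elts A \<subseteq> elts \<kappa>) \<and> \<kappa> \<in> elts D \<and> (\<forall>A\<in>elts D. elts A \<noteq> {}) \<and>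
     (\<forall>A\<in>elts D. \<forall>B\<in>elts D. \<exists>C\<in>elts D. elts C = elts A \<inter> elts B) \<and>
     (\<forall>A\<in>elts D. \<forall>B. elts A \<subseteq> elts B \<and> elts B \<subseteq> elts \<kappa> \<longrightarrow> B \<in> elts D)"

definition uniform :: "'a::zfc_universe \<Rightarrow> 'a \<Rightarrow> bool" where
  "uniform \<kappa> D \<longleftrightarrow> (\<forall>A\<in>elts D. elts A \<approx> elts \<kappa>)"

text \<open>The blocks of an indexed partition may be empty; by reindexing the nonempty ones this does
  not affect indecomposability.\<close>

definition indecomposable :: "'a::zfc_universe \<Rightarrow> 'a \<Rightarrow> 'a \<Rightarrow> bool" where
  "indecomposable \<nu> \<kappa> D \<longleftrightarrow>
     (\<forall>Y :: 'a \<Rightarrow> 'a set.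
        disjoint_family_on Y (elts \<nu>) \<and> (\<Union>\<xi>\<in>elts \<nu>. Y \<xi>) = elts \<kappa> \<longrightarrow>
        (\<exists>T \<subseteq> elts \<nu>. T \<prec> elts \<nu> \<and> (\<exists>B\<in>elts D. elts B = (\<Union>\<xi>\<in>T. Y \<xi>))))"


section \<open>Forcing notions\<close>

definition forcing_notion :: "'a::zfc_universe \<Rightarrow> ('a \<times> 'a) set \<Rightarrow> 'a \<Rightarrow> bool" where
  "forcing_notion P le one \<longleftrightarrow>
     preorder_on (elts P) le \<and> one \<in> elts P \<and> (\<forall>p\<in>elts P. (p, one) \<in> le)"

definition incompatible :: "'a::zfc_universe \<Rightarrow> ('a \<times> 'a) set \<Rightarrow> 'a \<Rightarrow> 'a \<Rightarrow> bool" where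
  "incompatible P le p q \<longleftrightarrow> \<not> (\<exists>r\<in>elts P. (r, p) \<in> le \<and> (r, q) \<in> le)"

definition antichain :: "'a::zfc_universe \<Rightarrow> ('a \<times> 'a) set \<Rightarrow> 'a set \<Rightarrow> bool" where
  "antichain P le A \<longleftrightarrow>
     A \<subseteq> elts P \<and> (\<forall>p\<in>A. \<forall>q\<in>A. p \<noteq> q \<longrightarrow> incompatible P le p q)"

definition maximal_antichain :: "'a::zfc_universe \<Rightarrow> ('a \<times> 'a) set \<Rightarrow> 'a set \<Rightarrow> bool" where
  "maximal_antichain P le A \<longleftrightarrow>
     antichain P le A \<and> (\<forall>B. antichain P le B \<and> A \<subseteq> B \<longrightarrow> B = A)"

definition chain_condition :: "'a::zfc_universe \<Rightarrow> 'a \<Rightarrow> ('a \<times> 'a) set \<Rightarrow> bool" where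
  "chain_condition \<nu> P le \<longleftrightarrow> (\<forall>A. antichain P le A \<longrightarrow> A \<prec> elts \<nu>)"

definition complete_suborder ::
  "'a::zfc_universe \<Rightarrow> ('a \<times> 'a) set \<Rightarrow> 'a \<Rightarrow> 'a \<Rightarrow> ('a \<times> 'a) set \<Rightarrow> 'a \<Rightarrow> bool" where
  "complete_suborder P leP oneP Q leQ oneQ \<longleftrightarrow>
     forcing_notion P leP oneP \<and> forcing_notion Q leQ oneQ \<and>
     oneP = oneQ \<and> elts P \<subseteq> elts Q \<and> leP = leQ \<inter> (elts P \<times> elts P) \<and>
     (\<forall>p\<in>elts P. \<forall>p'\<in>elts P. incompatible P leP p p' \<longleftrightarrow> incompatible Q leQ p p') \<and>
     (\<forall>A. maximal_antichain P leP A \<longrightarrow> maximal_antichain Q leQ A)"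

definition has_filtration ::
  "'a::zfc_universe \<Rightarrow> 'a \<Rightarrow> 'a \<Rightarrow> 'a \<Rightarrow> 'a \<Rightarrow> ('a \<times> 'a) set \<Rightarrow> 'a \<Rightarrow> bool" where
  "has_filtration l \<kappa> \<mu> D P le one \<longleftrightarrow>
     (\<exists>(Ps :: 'a \<Rightarrow> 'a) (les :: 'a \<Rightarrow> ('a \<times> 'a) set) (ones :: 'a \<Rightarrow> 'a).
        InfCard l \<and> InfCard \<kappa> \<and> InfCard \<mu> \<and>
        l \<in> elts (cf \<mu>) \<and> cf \<mu> \<in> elts \<kappa> \<and> \<kappa> \<in> elts \<mu> \<and>
        strong_limit \<mu> \<and> weak_power_eq l \<and>
        filter_on \<kappa> D \<and> uniform \<kappa> D \<and> indecomposable (cf \<mu>) \<kappa> D \<and>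
        chain_condition (card_succ l) P le \<and>
        (\<forall>p\<in>elts P. \<exists>\<alpha>\<in>elts \<mu>. p \<in> elts (Ps \<alpha>)) \<and>
        (\<forall>\<alpha>\<in>elts \<mu>. complete_suborder (Ps \<alpha>) (les \<alpha>) (ones \<alpha>) P le one \<and>
                     (\<forall>\<xi>\<in>elts \<alpha>. elts (Ps \<xi>) \<subseteq> elts (Ps \<alpha>))) \<and>
        (\<forall>\<alpha>\<in>elts \<mu>. elts (Ps \<alpha>) \<prec> elts \<mu>))"


section \<open>The forcing relation\<close>

text \<open>
  A \<open>P\<close>-name is a set of pairs \<open>(\<sigma>, p)\<close> with \<open>\<sigma>\<close> a \<open>P\<close>-name and \<open>p \<in> P\<close>.
\<close>

inductive is_name :: "'a::zfc_universe \<Rightarrow> 'a \<Rightarrow> bool" for P where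
  "(\<forall>z\<in>elts x. \<exists>\<sigma> p. z = vpair \<sigma> p \<and> p \<in> elts P \<and> is_name P \<sigma>) \<Longrightarrow> is_name P x"

function check_name :: "'a::zfc_universe \<Rightarrow> 'a \<Rightarrow> 'a" where
  "check_name one x = vset ((\<lambda>y. vpair (check_name one y) one) ` elts x)"
  by pat_completeness auto
termination
  by (relation "inv_image {(x, y). x \<in> elts y} snd") (auto simp: foundation intro: wf_inv_image)

declare check_name.simps [simp del]

text \<open>
  \<open>p\<close> forces \<open>a = b\<close> iff for all \<open>(\<sigma>, s) \<in> a\<close> it is dense below \<open>p\<close> that
  \<open>q \<le> s\<close> implies that \<open>q \<le> t\<close> and \<open>q\<close> forces \<open>\<sigma> = \<tau>\<close> for some \<open>(\<tau>, t) \<in> b\<close>, and symmetrically.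
\<close>

context
  notes conj_cong [fundef_cong]
begin

function force_eq :: "('a::zfc_universe \<times> 'a) set \<Rightarrow> 'a \<Rightarrow> 'a \<Rightarrow> 'a \<Rightarrow> bool" where
  "force_eq le p a b \<longleftrightarrow>
     (\<forall>\<sigma> s. vpair \<sigma> s \<in> elts a \<longrightarrow>
        (\<forall>r. (r, p) \<in> le \<longrightarrow> (\<exists>q. (q, r) \<in> le \<and>
           ((q, s) \<in> le \<longrightarrow>
              (\<exists>\<tau> t. vpair \<tau> t \<in> elts b \<and> (q, t) \<in> le \<and> force_eq le q \<sigma> \<tau>))))) \<and>
     (\<forall>\<tau> t. vpair \<tau> t \<in> elts b \<longrightarrow>
        (\<forall>r. (r, p) \<in> le \<longrightarrow> (\<exists>q. (q, r) \<in> le \<and>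
           ((q, t) \<in> le \<longrightarrow>
              (\<exists>\<sigma> s. vpair \<sigma> s \<in> elts a \<and> (q, s) \<in> le \<and> force_eq le q \<sigma> \<tau>)))))"
  by pat_completeness auto
termination
  by (relation "inv_image ({(x, y). x \<in> elts y}\<^sup>+) (\<lambda>(le, p, a, b). a)")
     (auto simp: foundation fst_vpair_below intro!: wf_inv_image wf_trancl)

end

declare force_eq.simps [simp del]

definition force_mem :: "('a::zfc_universe \<times> 'a) set \<Rightarrow> 'a \<Rightarrow> 'a \<Rightarrow> 'a \<Rightarrow> bool" where
  "force_mem le p a b \<longleftrightarrow>
     (\<forall>r. (r, p) \<in> le \<longrightarrow> (\<exists>q. (q, r) \<in> le \<and>
        (\<exists>\<tau> t. vpair \<tau> t \<in> elts b \<and> (q, t) \<in> le \<and> force_eq le q a \<tau>)))"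

text \<open>
  Formulas of the forcing language: the language of set theory with names as constants. Binding
  is represented by HOL abstraction; only the concrete first-order formulas below are used.
\<close>

datatype 'a fm =
    Mem 'a 'a  (infix "\<^bold>\<in>" 55)
  | Equal 'a 'a  (infix "\<^bold>=" 55)
  | Neg "'a fm"  ("\<^bold>\<not> _" [54] 54)
  | Conj "'a fm" "'a fm"  (infixr "\<^bold>\<and>" 50)
  | Forall "'a \<Rightarrow> 'a fm"  (binder "\<^bold>\<forall>" 10)

primrec forces :: "'a::zfc_universe \<Rightarrow> ('a \<times> 'a) set \<Rightarrow> 'a \<Rightarrow> 'a fm \<Rightarrow> bool" where
  "forces P le p (a \<^bold>\<in> b) \<longleftrightarrow> force_mem le p a b"
| "forces P le p (a \<^bold>= b) \<longleftrightarrow> force_eq le p a b"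
| "forces P le p (\<^bold>\<not> \<phi>) \<longleftrightarrow> (\<forall>q. (q, p) \<in> le \<longrightarrow> \<not> forces P le q \<phi>)"
| "forces P le p (\<phi> \<^bold>\<and> \<psi>) \<longleftrightarrow> forces P le p \<phi> \<and> forces P le p \<psi>"
| "forces P le p (Forall \<phi>) \<longleftrightarrow> (\<forall>\<tau>. is_name P \<tau> \<longrightarrow> forces P le p (\<phi> \<tau>))"

definition Disj :: "'a fm \<Rightarrow> 'a fm \<Rightarrow> 'a fm"  (infixr "\<^bold>\<or>" 45) where
  "(\<phi> \<^bold>\<or> \<psi>) = \<^bold>\<not> (\<^bold>\<not> \<phi> \<^bold>\<and> \<^bold>\<not> \<psi>)"

definition Imp :: "'a fm \<Rightarrow> 'a fm \<Rightarrow> 'a fm"  (infixr "\<^bold>\<longrightarrow>" 40) where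
  "(\<phi> \<^bold>\<longrightarrow> \<psi>) = \<^bold>\<not> (\<phi> \<^bold>\<and> \<^bold>\<not> \<psi>)"

definition Iff :: "'a fm \<Rightarrow> 'a fm \<Rightarrow> 'a fm"  (infix "\<^bold>\<longleftrightarrow>" 38) where
  "(\<phi> \<^bold>\<longleftrightarrow> \<psi>) = ((\<phi> \<^bold>\<longrightarrow> \<psi>) \<^bold>\<and> (\<psi> \<^bold>\<longrightarrow> \<phi>))"

definition Exists :: "('a \<Rightarrow> 'a fm) \<Rightarrow> 'a fm"  (binder "\<^bold>\<exists>" 10) where
  "Exists \<phi> = \<^bold>\<not> (\<^bold>\<forall>x. \<^bold>\<not> \<phi> x)"


section \<open>Set-theoretic notions as formulas\<close>

definition sub_fm :: "'a \<Rightarrow> 'a \<Rightarrow> 'a fm"  (infix "\<^bold>\<subseteq>" 55) where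
  "x \<^bold>\<subseteq> y = (\<^bold>\<forall>z. z \<^bold>\<in> x \<^bold>\<longrightarrow> z \<^bold>\<in> y)"

definition empty_fm :: "'a \<Rightarrow> 'a fm" where
  "empty_fm x = (\<^bold>\<forall>z. \<^bold>\<not> (z \<^bold>\<in> x))"

text \<open>\<open>z = x \<inter> y\<close>, \<open>z = x - y\<close>, \<open>z = {x, y}\<close> and \<open>z = (x, y)\<close>.\<close>

definition inter_fm :: "'a \<Rightarrow> 'a \<Rightarrow> 'a \<Rightarrow> 'a fm" where
  "inter_fm z x y = (\<^bold>\<forall>w. w \<^bold>\<in> z \<^bold>\<longleftrightarrow> w \<^bold>\<in> x \<^bold>\<and> w \<^bold>\<in> y)"

definition diff_fm :: "'a \<Rightarrow> 'a \<Rightarrow> 'a \<Rightarrow> 'a fm" where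
  "diff_fm z x y = (\<^bold>\<forall>w. w \<^bold>\<in> z \<^bold>\<longleftrightarrow> w \<^bold>\<in> x \<^bold>\<and> \<^bold>\<not> (w \<^bold>\<in> y))"

definition upair_fm :: "'a \<Rightarrow> 'a \<Rightarrow> 'a \<Rightarrow> 'a fm" where
  "upair_fm z x y = (\<^bold>\<forall>w. w \<^bold>\<in> z \<^bold>\<longleftrightarrow> w \<^bold>= x \<^bold>\<or> w \<^bold>= y)"

definition pair_fm :: "'a \<Rightarrow> 'a \<Rightarrow> 'a \<Rightarrow> 'a fm" where
  "pair_fm z x y = (\<^bold>\<exists>u. \<^bold>\<exists>v. upair_fm u x x \<^bold>\<and> upair_fm v x y \<^bold>\<and> upair_fm z u v)"

definition app_fm :: "'a \<Rightarrow> 'a \<Rightarrow> 'a \<Rightarrow> 'a fm" where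
  "app_fm f x y = (\<^bold>\<exists>z. pair_fm z x y \<^bold>\<and> z \<^bold>\<in> f)"

definition function_fm :: "'a \<Rightarrow> 'a \<Rightarrow> 'a \<Rightarrow> 'a fm" where
  "function_fm f a b =
     ((\<^bold>\<forall>z. z \<^bold>\<in> f \<^bold>\<longrightarrow> (\<^bold>\<exists>x. \<^bold>\<exists>y. x \<^bold>\<in> a \<^bold>\<and> y \<^bold>\<in> b \<^bold>\<and> pair_fm z x y)) \<^bold>\<and>
      (\<^bold>\<forall>x. x \<^bold>\<in> a \<^bold>\<longrightarrow> (\<^bold>\<exists>y. app_fm f x y)) \<^bold>\<and>
      (\<^bold>\<forall>x. \<^bold>\<forall>y. \<^bold>\<forall>y'. app_fm f x y \<^bold>\<and> app_fm f x y' \<^bold>\<longrightarrow> y \<^bold>= y'))"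

definition injection_fm :: "'a \<Rightarrow> 'a \<Rightarrow> 'a \<Rightarrow> 'a fm" where
  "injection_fm f a b =
     (function_fm f a b \<^bold>\<and>
      (\<^bold>\<forall>x. \<^bold>\<forall>x'. \<^bold>\<forall>y. app_fm f x y \<^bold>\<and> app_fm f x' y \<^bold>\<longrightarrow> x \<^bold>= x'))"

definition bijection_fm :: "'a \<Rightarrow> 'a \<Rightarrow> 'a \<Rightarrow> 'a fm" where
  "bijection_fm f a b =
     (injection_fm f a b \<^bold>\<and> (\<^bold>\<forall>y. y \<^bold>\<in> b \<^bold>\<longrightarrow> (\<^bold>\<exists>x. app_fm f x y)))"

definition lepoll_fm :: "'a \<Rightarrow> 'a \<Rightarrow> 'a fm" where
  "lepoll_fm a b = (\<^bold>\<exists>f. injection_fm f a b)"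

definition eqpoll_fm :: "'a \<Rightarrow> 'a \<Rightarrow> 'a fm" where
  "eqpoll_fm a b = (\<^bold>\<exists>f. bijection_fm f a b)"

definition transset_fm :: "'a \<Rightarrow> 'a fm" where
  "transset_fm x = (\<^bold>\<forall>y. y \<^bold>\<in> x \<^bold>\<longrightarrow> y \<^bold>\<subseteq> x)"

definition ord_fm :: "'a \<Rightarrow> 'a fm" where
  "ord_fm x = (transset_fm x \<^bold>\<and> (\<^bold>\<forall>y. y \<^bold>\<in> x \<^bold>\<longrightarrow> transset_fm y))"

definition card_fm :: "'a \<Rightarrow> 'a fm" where
  "card_fm \<nu> = (ord_fm \<nu> \<^bold>\<and> (\<^bold>\<forall>\<alpha>. \<alpha> \<^bold>\<in> \<nu> \<^bold>\<longrightarrow> \<^bold>\<not> eqpoll_fm \<alpha> \<nu>))"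

definition ord_le_fm :: "'a \<Rightarrow> 'a \<Rightarrow> 'a fm" where
  "ord_le_fm \<alpha> \<beta> = (\<alpha> \<^bold>\<in> \<beta> \<^bold>\<or> \<alpha> \<^bold>= \<beta>)"

definition filter_fm :: "'a \<Rightarrow> 'a \<Rightarrow> 'a fm" where
  "filter_fm \<kappa> U =
     ((\<^bold>\<forall>A. A \<^bold>\<in> U \<^bold>\<longrightarrow> A \<^bold>\<subseteq> \<kappa>) \<^bold>\<and> \<kappa> \<^bold>\<in> U \<^bold>\<and> (\<^bold>\<forall>A. A \<^bold>\<in> U \<^bold>\<longrightarrow> \<^bold>\<not> empty_fm A) \<^bold>\<and>
      (\<^bold>\<forall>A. \<^bold>\<forall>B. \<^bold>\<forall>C. A \<^bold>\<in> U \<^bold>\<and> B \<^bold>\<in> U \<^bold>\<and> inter_fm C A B \<^bold>\<longrightarrow> C \<^bold>\<in> U) \<^bold>\<and>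
      (\<^bold>\<forall>A. \<^bold>\<forall>B. A \<^bold>\<in> U \<^bold>\<and> A \<^bold>\<subseteq> B \<^bold>\<and> B \<^bold>\<subseteq> \<kappa> \<^bold>\<longrightarrow> B \<^bold>\<in> U))"

definition ultrafilter_fm :: "'a \<Rightarrow> 'a \<Rightarrow> 'a fm" where
  "ultrafilter_fm \<kappa> U =
     (filter_fm \<kappa> U \<^bold>\<and>
      (\<^bold>\<forall>A. \<^bold>\<forall>B. A \<^bold>\<subseteq> \<kappa> \<^bold>\<and> diff_fm B \<kappa> A \<^bold>\<longrightarrow> A \<^bold>\<in> U \<^bold>\<or> B \<^bold>\<in> U))"

definition uniform_ultrafilter_fm :: "'a \<Rightarrow> 'a \<Rightarrow> 'a fm" where
  "uniform_ultrafilter_fm \<kappa> U =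
     (ultrafilter_fm \<kappa> U \<^bold>\<and> (\<^bold>\<forall>A. A \<^bold>\<in> U \<^bold>\<longrightarrow> eqpoll_fm A \<kappa>))"

definition generates_fm :: "'a \<Rightarrow> 'a \<Rightarrow> 'a \<Rightarrow> 'a fm" where
  "generates_fm \<kappa> X U =
     (X \<^bold>\<subseteq> U \<^bold>\<and> (\<^bold>\<forall>A. A \<^bold>\<in> U \<^bold>\<longleftrightarrow> A \<^bold>\<subseteq> \<kappa> \<^bold>\<and> (\<^bold>\<exists>B. B \<^bold>\<in> X \<^bold>\<and> B \<^bold>\<subseteq> A)))"

text \<open>\<open>\<nu>\<close> is the cardinality of a family generating some uniform ultrafilter on \<open>\<kappa>\<close>.\<close>

definition generating_card_fm :: "'a \<Rightarrow> 'a \<Rightarrow> 'a fm" where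
  "generating_card_fm \<kappa> \<nu> =
     (card_fm \<nu> \<^bold>\<and>
      (\<^bold>\<exists>U. \<^bold>\<exists>X. uniform_ultrafilter_fm \<kappa> U \<^bold>\<and> generates_fm \<kappa> X U \<^bold>\<and> eqpoll_fm X \<nu>))"

text \<open>\<open>\<nu> = \<uu>(\<kappa>)\<close>.\<close>

definition ultrafilter_number_fm :: "'a \<Rightarrow> 'a \<Rightarrow> 'a fm" where
  "ultrafilter_number_fm \<kappa> \<nu> =
     (generating_card_fm \<kappa> \<nu> \<^bold>\<and>
      (\<^bold>\<forall>\<nu>'. generating_card_fm \<kappa> \<nu>' \<^bold>\<longrightarrow> ord_le_fm \<nu> \<nu>'))"

end

theory Submission imports Defs begin

text \<open>
  Let \<open>A\<close> be a name for a subset of \<open>\<kappa>\<close>. For each \<open>i < \<kappa>\<close> an antichain deciding \<open>i \<in> A\<close> has size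
  less than \<open>cf \<mu>\<close> and so lies in some stage of the filtration. Sorting the \<open>i < \<kappa>\<close> by these stages
  along a cofinal sequence of length \<open>cf \<mu>\<close>, indecomposability yields \<open>B \<in> D\<close> for which one stage
  \<open>\<beta>\<close> serves all \<open>i \<in> B\<close>. Hence \<open>A \<inter> B\<close> has a nice name over stage \<open>\<beta>\<close>; since \<open>\<mu>\<close> is a strong limit there
  are at most \<open>\<mu>\<close> such names, and their values generate every ultrafilter that extends \<open>D\<close>.

  A uniform ultrafilter extending \<open>D\<close> is obtained from Zorn's lemma in the ground model, applied to
  names of filters. Its members are unbounded in \<open>\<kappa>\<close>, hence of size \<open>\<kappa>\<close>, because the chain
  condition keeps \<open>\<kappa>\<close> regular.
\<close>

section \<open>Small sets\<close>

text \<open>No generic filter is used: \<open>forces\<close> is a recursively defined relation over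
  the ground model. Whatever the extension would supply (a pair, a bijection, an order type, an
  ultrafilter) has to be exhibited as an explicit name, and existence is established only on dense
  sets of conditions.

  The cardinal \<open>cf \<mu>\<close> is used twice. An antichain has at most
  \<open>l < cf \<mu>\<close> members, so the stages of its members are bounded below \<mu>; and the
  index set given by indecomposability has fewer than \<open>cf \<mu>\<close> members, so these
  bounds are bounded once more. \<open>A \<inter> B\<close> may replace A because B, being in D,
  lies in the ultrafilter, so that \<open>A \<inter> B\<close> is a member of it below A.

  Counting names bounds u(\<kappa>) only after the generating family has a cardinality in the
  extension. Different names may have the same value, so each member is represented by its name of
  least index, and the set of indices in use is collapsed to an ordinal. Below some condition this
  is an ordinal of the ground model, at most \<mu>.\<close>

definition small :: "'a::zfc_universe set \<Rightarrow> bool" where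
  "small X \<longleftrightarrow> (\<exists>z. elts z = X)"

lemma elts_vset_small [simp]: "small X \<Longrightarrow> elts (vset X) = X"
  unfolding small_def using elts_vset by blast

lemma small_elts [simp, intro]: "small (elts x)"
  unfolding small_def by blast

lemma small_subset: "small X \<Longrightarrow> Y \<subseteq> X \<Longrightarrow> small Y"
proof -
  assume "small X" "Y \<subseteq> X"
  then obtain x where "elts x = X" unfolding small_def by blast
  with separation[of x "\<lambda>y. y \<in> Y"] \<open>Y \<subseteq> X\<close> show ?thesis
    unfolding small_def by (metis Collect_mem_eq Int_absorb1 Int_def)
qed

lemma small_image [intro]:
  fixes f :: "'a::zfc_universe \<Rightarrow> 'a"
  assumes "small X"
  shows "small (f ` X)"
proof -
  obtain x where "X = elts x" using assms unfolding small_def by blast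
  then show ?thesis unfolding small_def using replacement[of f x] by simp
qed

lemma small_UN:
  fixes B :: "'a::zfc_universe \<Rightarrow> 'a set"
  assumes "small X" "\<And>x. x \<in> X \<Longrightarrow> small (B x)"
  shows "small (\<Union>x\<in>X. B x)"
proof -
  obtain z where z: "elts z = (\<lambda>x. vset (B x)) ` X"
    using small_image[OF assms(1)] unfolding small_def by blast
  obtain u where u: "elts u = \<Union>(elts ` elts z)"
    using union by blast
  have "elts u = (\<Union>x\<in>X. B x)"
    unfolding u z using assms(2) by auto
  then show ?thesis unfolding small_def by blast
qed

lemma small_pairs:
  fixes f :: "'a::zfc_universe \<Rightarrow> 'a \<Rightarrow> 'a"
  assumes "small X" "small Y"
  shows "small {f x y | x y. x \<in> X \<and> y \<in> Y}"
proof -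
  have "{f x y | x y. x \<in> X \<and> y \<in> Y} = (\<Union>x\<in>X. f x ` Y)" by auto
  then show ?thesis using assms by (auto intro!: small_UN)
qed

lemma small_triples:
  fixes f :: "'a::zfc_universe \<Rightarrow> 'a \<Rightarrow> 'a \<Rightarrow> 'a"
  assumes "small X" "small Y" "small Z"
  shows "small {f x y z | x y z. x \<in> X \<and> y \<in> Y \<and> z \<in> Z}"
proof -
  have "{f x y z | x y z. x \<in> X \<and> y \<in> Y \<and> z \<in> Z} = (\<Union>x\<in>X. {f x y z | y z. y \<in> Y \<and> z \<in> Z})"
    by auto
  then show ?thesis using assms by (auto intro!: small_UN small_pairs)
qed

lemma small_Pow: "small X \<Longrightarrow> small {y. elts y \<subseteq> X}"
  unfolding small_def using powerset by blast

lemma small_lepoll: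
  fixes X Y :: "'a::zfc_universe set"
  assumes "X \<lesssim> Y" "small Y" shows "small X"
  using assms small_image small_subset unfolding lepoll_iff by blast

lemma vpair_inject [simp]: "vpair a b = vpair c d \<longleftrightarrow> a = c \<and> b = d"
proof
  assume "vpair a b = vpair c d"
  then have "elts (vpair a b) = elts (vpair c d)" by simp
  then have *: "{vset {a, a}, vset {a, b}} = {vset {c, c}, vset {c, d}}"
    by (simp add: vpair_def)
  have inj: "vset {x, y} = vset {u, v} \<Longrightarrow> {x, y} = {u, v}" for x y u v :: 'a
    by (metis elts_vset_pair)
  have "vset {a, a} = vset {c, c} \<and> vset {a, b} = vset {c, d} \<or>
      vset {a, a} = vset {c, d} \<and> vset {a, b} = vset {c, c}"
    using * unfolding doubleton_eq_iff .
  then have "{a, a} = {c, c} \<and> {a, b} = {c, d} \<or> {a, a} = {c, d} \<and> {a, b} = {c, c}"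
    using inj by blast
  then show "a = c \<and> b = d"
    unfolding doubleton_eq_iff by blast
qed auto

section \<open>Ordinals\<close>

lemma elts_induct [case_names step]:
  assumes "\<And>x. (\<And>y. y \<in> elts x \<Longrightarrow> Q y) \<Longrightarrow> Q x"
  shows "Q (x :: 'a::zfc_universe)"
  using foundation by (rule wf_induct_rule[of _ Q]) (use assms in blast)

lemma elts_irrefl [simp]: "x \<notin> elts (x :: 'a::zfc_universe)"
  by (rule elts_induct[of "\<lambda>x. x \<notin> elts x"]) blast

lemma elts_asym: "x \<in> elts y \<Longrightarrow> y \<notin> elts (x :: 'a::zfc_universe)"
  by (induction x arbitrary: y rule: elts_induct) blast

lemma Ord_elts: "Ord x \<Longrightarrow> y \<in> elts x \<Longrightarrow> Ord y"
  unfolding Ord_def Transset_def by blast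

lemma Ord_trans: "Ord x \<Longrightarrow> y \<in> elts x \<Longrightarrow> z \<in> elts y \<Longrightarrow> z \<in> elts x"
  unfolding Ord_def Transset_def by blast

lemma OrdI: "(\<And>y z. y \<in> elts x \<Longrightarrow> z \<in> elts y \<Longrightarrow> z \<in> elts x) \<Longrightarrow>
    (\<And>y. y \<in> elts x \<Longrightarrow> Ord y) \<Longrightarrow> Ord x"
  unfolding Ord_def Transset_def by blast

lemma Ord_linear:
  assumes "Ord x" "Ord y"
  shows "x \<in> elts y \<or> x = y \<or> y \<in> elts x"
  using assms
proof (induction x arbitrary: y rule: elts_induct)
  case (step x)
  note IHx = step.IH and ox = step.prems(1)
  show ?case using step.prems(2)
  proof (induction y rule: elts_induct)
    case (step y)
    show ?case
    proof (rule ccontr)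
      assume c: "\<not> (x \<in> elts y \<or> x = y \<or> y \<in> elts x)"
      have "elts x \<subseteq> elts y"
      proof
        fix z assume z: "z \<in> elts x"
        then have "z \<in> elts y \<or> z = y \<or> y \<in> elts z"
          using IHx ox step.prems Ord_elts by blast
        then show "z \<in> elts y" using c z ox Ord_trans by blast
      qed
      moreover have "elts y \<subseteq> elts x"
      proof
        fix z assume z: "z \<in> elts y"
        then have "x \<in> elts z \<or> x = z \<or> z \<in> elts x"
          using step Ord_elts by blast
        then show "z \<in> elts x" using c z step.prems Ord_trans by blast
      qed
      ultimately show False using c extensionality by blast
    qed
  qed
qed

lemma Ord_subset_iff:
  assumes "Ord x" "Ord y"
  shows "elts x \<subseteq> elts y \<longleftrightarrow> x \<in> elts y \<or> x = y"
  using Ord_linear[OF assms] Ord_trans[OF assms(2)] by auto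

lemma Ord_not_in:
  assumes "Ord x" "Ord y" "x \<notin> elts y"
  shows "elts y \<subseteq> elts x"
  using Ord_linear[OF assms(1,2)] assms Ord_subset_iff by blast

lemma Ord_least_exists:
  assumes "Ord \<alpha>" "Q \<alpha>"
  obtains \<beta> where "Ord \<beta>" "Q \<beta>" "\<And>\<gamma>. \<gamma> \<in> elts \<beta> \<Longrightarrow> \<not> Q \<gamma>"
proof -
  have "\<exists>\<beta>. Ord \<beta> \<and> Q \<beta> \<and> (\<forall>\<gamma>\<in>elts \<beta>. \<not> Q \<gamma>)"
    using assms
  proof (induction \<alpha> rule: elts_induct)
    case (step \<alpha>)
    then show ?case using Ord_elts by blast
  qed
  then show ?thesis using that by blast
qed

lemma ord_least:
  assumes "Ord \<alpha>" "Q \<alpha>"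
  shows "Ord (ord_least Q)" "Q (ord_least Q)" "\<And>\<beta>. \<beta> \<in> elts (ord_least Q) \<Longrightarrow> \<not> Q \<beta>"
proof -
  obtain \<beta> where \<beta>: "Ord \<beta>" "Q \<beta>" "\<And>\<gamma>. \<gamma> \<in> elts \<beta> \<Longrightarrow> \<not> Q \<gamma>"
    using Ord_least_exists assms by blast
  have "ord_least Q = \<beta>"
    unfolding ord_least_def
    by (rule the_equality) (use \<beta> Ord_linear in blast)+
  then show "Ord (ord_least Q)" "Q (ord_least Q)" "\<And>\<gamma>. \<gamma> \<in> elts (ord_least Q) \<Longrightarrow> \<not> Q \<gamma>"
    using \<beta> by auto
qed

text \<open>Burali-Forti: a set of all ordinals would be an ordinal and so a member of
  itself.\<close>

lemma not_small_Ord: "\<not> small {x :: 'a::zfc_universe. Ord x}"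
proof
  assume s: "small {x :: 'a. Ord x}"
  have "Ord (vset {x :: 'a. Ord x})"
    by (rule OrdI) (use s Ord_elts in auto)
  then have "vset {x :: 'a. Ord x} \<in> elts (vset {x. Ord x})"
    using s by simp
  then show False by simp
qed

text \<open>Mostowski collapse of a well-order of \<open>X\<close> taken from HOL: \<open>G\<close>
  sends each point to the set of the values at its predecessors, and the range of \<open>G\<close>
  is the ordinal.\<close>

lemma small_eqpoll_Ord:
  fixes X :: "'a::zfc_universe set"
  assumes "small X"
  obtains \<alpha> :: 'a where "Ord \<alpha>" "X \<approx> elts \<alpha>"
proof -
  obtain r where r: "well_order_on X r" using well_order_on by blast
  define R where "R = r - Id"
  have wf: "wf R" using r unfolding well_order_on_def R_def by blast
  have tot: "x \<in> X \<Longrightarrow> y \<in> X \<Longrightarrow> x \<noteq> y \<Longrightarrow> (x, y) \<in> R \<or> (y, x) \<in> R" for x y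
    using r unfolding well_order_on_def linear_order_on_def total_on_def R_def by auto
  have RX: "(x, y) \<in> R \<Longrightarrow> x \<in> X \<and> y \<in> X" for x y
    using r unfolding well_order_on_def linear_order_on_def partial_order_on_def preorder_on_def R_def
    by auto
  have tr: "trans R"
    using r unfolding well_order_on_def linear_order_on_def partial_order_on_def preorder_on_def R_def
    by (simp add: trans_diff_Id)
  define G :: "'a \<Rightarrow> 'a" where "G = wfrec R (\<lambda>g x. vset (g ` {y. (y, x) \<in> R}))"
  have G: "G x = vset (G ` {y. (y, x) \<in> R})" for x
    unfolding G_def by (subst wfrec[OF wf]) (simp add: cut_def)
  have sm: "small (G ` {y. (y, x) \<in> R})" for x
    by (rule small_image, rule small_subset[OF assms]) (use RX in blast)
  have eG: "elts (G x) = G ` {y. (y, x) \<in> R}" for x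
    using arg_cong[OF G[of x], of elts] elts_vset_small[OF sm[of x]] by (rule trans)
  have ordG: "Ord (G x)" for x
  proof (induction x rule: wf_induct_rule[OF wf])
    case (1 x)
    show ?case
    proof (rule OrdI)
      fix y z assume "y \<in> elts (G x)" "z \<in> elts y"
      from \<open>y \<in> elts (G x)\<close> obtain y' where y': "(y', x) \<in> R" "y = G y'" unfolding eG by blast
      have "z \<in> elts (G y')" using \<open>z \<in> elts y\<close> y' by simp
      then obtain z' where z': "(z', y') \<in> R" "z = G z'" unfolding eG by blast
      have "(z', x) \<in> R" using tr y' z' by (blast dest: transD)
      then show "z \<in> elts (G x)" unfolding eG using z' by blast
    next
      fix y assume "y \<in> elts (G x)"
      then show "Ord y" unfolding eG using 1 by blast
    qed
  qed
  have inj: "inj_on G X"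
  proof (rule inj_onI, rule ccontr)
    fix x y assume "x \<in> X" "y \<in> X" "G x = G y" "x \<noteq> y"
    then have "G x \<in> elts (G y) \<or> G y \<in> elts (G x)" using tot eG by blast
    then show False using \<open>G x = G y\<close> by simp
  qed
  define \<alpha> where "\<alpha> = vset (G ` X)"
  have e\<alpha>: "elts \<alpha> = G ` X" unfolding \<alpha>_def using assms by (simp add: small_image)
  have "Ord \<alpha>"
  proof (rule OrdI)
    fix y z assume "y \<in> elts \<alpha>" "z \<in> elts y"
    then obtain y' where "z \<in> elts (G y')" unfolding e\<alpha> by blast
    then obtain z' where "(z', y') \<in> R" "z = G z'" unfolding eG by blast
    then show "z \<in> elts \<alpha>" unfolding e\<alpha> using RX by blast
  next
    fix y assume "y \<in> elts \<alpha>"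
    then show "Ord y" unfolding e\<alpha> using ordG by blast
  qed
  moreover have "X \<approx> elts \<alpha>"
    using inj e\<alpha> by (metis eqpoll_sym inj_on_image_eqpoll_self)
  ultimately show ?thesis using that by blast
qed

lemma small_eqpoll_Card:
  fixes X :: "'a::zfc_universe set"
  assumes "small X"
  obtains \<alpha> :: 'a where "Card \<alpha>" "X \<approx> elts \<alpha>"
proof -
  obtain \<alpha> :: 'a where \<alpha>: "Ord \<alpha>" "X \<approx> elts \<alpha>" using small_eqpoll_Ord assms by blast
  then obtain \<beta> :: 'a where \<beta>: "Ord \<beta>" "X \<approx> elts \<beta>" "\<And>\<gamma>. \<gamma> \<in> elts \<beta> \<Longrightarrow> \<not> X \<approx> elts \<gamma>"
    using Ord_least_exists[of \<alpha> "\<lambda>\<alpha>. X \<approx> elts \<alpha>"] by blast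
  then have "Card \<beta>"
    unfolding Card_def using eqpoll_trans eqpoll_sym by blast
  then show ?thesis using that \<beta> by blast
qed

section \<open>Cofinality and cardinality bounds\<close>

lemma Card_lesspoll:
  assumes "Card \<kappa>" "\<alpha> \<in> elts \<kappa>"
  shows "elts \<alpha> \<prec> elts \<kappa>"
proof -
  have "elts \<alpha> \<subseteq> elts \<kappa>" using assms Ord_trans unfolding Card_def by blast
  then show ?thesis
    using assms subset_imp_lepoll unfolding Card_def lesspoll_def by blast
qed

lemma lesspoll_imp_not_lepoll: "X \<prec> Y \<Longrightarrow> \<not> Y \<lesssim> X"
  using lesspoll_trans2[of X Y X] by auto

lemma Card_imp_Ord: "Card \<kappa> \<Longrightarrow> Ord \<kappa>"
  by (simp add: Card_def)

lemma InfCard_imp_Ord: "InfCard \<kappa> \<Longrightarrow> Ord \<kappa>"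
  by (simp add: Card_def InfCard_def)

lemma Ord_not_in_lepoll: "Ord x \<Longrightarrow> Ord y \<Longrightarrow> x \<notin> elts y \<Longrightarrow> elts y \<lesssim> elts x"
  by (rule subset_imp_lepoll) (rule Ord_not_in)

lemma lesspoll_imp_eqpoll_elt:
  fixes X :: "'b set" and \<kappa> :: "'a::zfc_universe"
  assumes "X \<prec> elts \<kappa>" "Ord \<kappa>"
  obtains \<alpha> where "Card \<alpha>" "\<alpha> \<in> elts \<kappa>" "X \<approx> elts \<alpha>"
proof -
  obtain f where f: "inj_on f X" "f ` X \<subseteq> elts \<kappa>"
    using assms(1) unfolding lesspoll_def lepoll_def by blast
  have "small (f ` X)" using f small_subset by blast
  then obtain \<alpha> :: 'a where \<alpha>: "Card \<alpha>" "f ` X \<approx> elts \<alpha>" using small_eqpoll_Card by blast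
  then have \<alpha>: "Card \<alpha>" "X \<approx> elts \<alpha>" using f(1) by simp_all
  have "\<alpha> \<in> elts \<kappa>"
  proof (rule ccontr)
    assume "\<alpha> \<notin> elts \<kappa>"
    then have "elts \<kappa> \<lesssim> elts \<alpha>"
      using Ord_not_in_lepoll Card_imp_Ord[OF \<alpha>(1)] assms(2) by blast
    then have "elts \<kappa> \<lesssim> X" using eqpoll_sym[OF \<alpha>(2)] by (rule lepoll_trans2)
    then show False using lesspoll_imp_not_lepoll[OF assms(1)] by simp
  qed
  then show ?thesis using that \<alpha> by blast
qed

definition cofinal_map :: "'a::zfc_universe \<Rightarrow> 'a \<Rightarrow> ('a \<Rightarrow> 'a) \<Rightarrow> bool" where
  "cofinal_map \<mu> \<delta> f \<longleftrightarrow> f \<in> elts \<delta> \<rightarrow> elts \<mu> \<and>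
     (\<forall>\<alpha>\<in>elts \<mu>. \<exists>\<xi>\<in>elts \<delta>. \<alpha> \<in> elts (f \<xi>) \<or> \<alpha> = f \<xi>)"

lemma cf_cofinal_map:
  assumes "Ord \<mu>"
  shows "Ord (cf \<mu>)" "\<exists>f. cofinal_map \<mu> (cf \<mu>) f"
    "\<And>\<delta> f. \<delta> \<in> elts (cf \<mu>) \<Longrightarrow> \<not> cofinal_map \<mu> \<delta> f"
proof -
  define Q where "Q = (\<lambda>\<delta>. \<exists>f. cofinal_map \<mu> \<delta> f)"
  have cf: "cf \<mu> = ord_least Q"
    unfolding cf_def Q_def cofinal_map_def by (rule arg_cong[of _ _ ord_least]) blast
  have "Q \<mu>" unfolding Q_def cofinal_map_def by (rule exI[of _ "\<lambda>x. x"]) auto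
  note * = ord_least[of \<mu> Q, OF assms this]
  show "Ord (cf \<mu>)" "\<exists>f. cofinal_map \<mu> (cf \<mu>) f"
    "\<And>\<delta> f. \<delta> \<in> elts (cf \<mu>) \<Longrightarrow> \<not> cofinal_map \<mu> \<delta> f"
    using * unfolding cf Q_def by blast+
qed

text \<open>Otherwise \<open>g\<close>, read along a bijection of \<open>X\<close> with some
  \<delta> below \<open>cf \<mu>\<close>, would be a cofinal map from \<delta>, against the
  minimality of \<open>cf \<mu>\<close>. The bound is strict because cofinality is defined with
  \<le>.\<close>

lemma bounded_below_cf:
  assumes "Ord \<mu>" "X \<prec> elts (cf \<mu>)" "\<And>x. x \<in> X \<Longrightarrow> g x \<in> elts \<mu>"
  obtains \<beta> where "\<beta> \<in> elts \<mu>" "\<And>x. x \<in> X \<Longrightarrow> g x \<in> elts \<beta>"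
proof -
  obtain \<delta> where \<delta>: "\<delta> \<in> elts (cf \<mu>)" "X \<approx> elts \<delta>"
    using lesspoll_imp_eqpoll_elt assms(2) cf_cofinal_map(1)[OF assms(1)] by metis
  obtain h where h: "bij_betw h (elts \<delta>) X"
    using eqpoll_sym[OF \<delta>(2)] unfolding eqpoll_def by blast
  have "\<not> cofinal_map \<mu> \<delta> (g \<circ> h)"
    using cf_cofinal_map(3) assms(1) \<delta>(1) by blast
  moreover have "g \<circ> h \<in> elts \<delta> \<rightarrow> elts \<mu>"
    using h assms(3) by (auto dest: bij_betwE)
  ultimately obtain \<beta> where \<beta>: "\<beta> \<in> elts \<mu>"
    "\<And>\<xi>. \<xi> \<in> elts \<delta> \<Longrightarrow> \<not> (\<beta> \<in> elts (g (h \<xi>)) \<or> \<beta> = g (h \<xi>))"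
    unfolding cofinal_map_def by auto
  have "g x \<in> elts \<beta>" if x: "x \<in> X" for x
  proof -
    obtain \<xi> where "\<xi> \<in> elts \<delta>" "x = h \<xi>"
      using h x unfolding bij_betw_def by blast
    then show ?thesis
      using \<beta> Ord_linear[of \<beta> "g x"] assms(1,3) x Ord_elts by blast
  qed
  then show ?thesis using that \<beta>(1) by blast
qed

text \<open>\<open>ord_least\<close> is meaningful only if some cardinal lies above
  \<open>l\<close>; Cantor's theorem supplies \<theta>, the cardinality of the power set of
  \<open>l\<close>.\<close>

lemma Ord_card_succ:
  fixes l :: "'a::zfc_universe"
  assumes "Ord l"
  shows "Ord (card_succ l)" "\<And>\<beta>. Card \<beta> \<Longrightarrow> \<beta> \<in> elts (card_succ l) \<Longrightarrow> l \<notin> elts \<beta>"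
proof -
  obtain z where z: "elts z = {y. elts y \<subseteq> elts l}" using powerset by blast
  obtain \<theta> :: 'a where \<theta>: "Card \<theta>" "elts z \<approx> elts \<theta>" using small_eqpoll_Card by blast
  have "bij_betw elts (elts z) (Pow (elts l))"
    unfolding bij_betw_def
  proof
    show "inj_on elts (elts z)" by (rule inj_onI) (rule extensionality)
    show "elts ` elts z = Pow (elts l)"
      unfolding z by (auto simp: image_iff) (metis elts_vset_small small_elts small_subset)
  qed
  then have "elts z \<approx> Pow (elts l)" unfolding eqpoll_def by blast
  from eqpoll_trans[OF eqpoll_sym[OF this] \<theta>(2)]
  have less: "elts l \<prec> elts \<theta>"
    by (rule lesspoll_eq_trans[OF lesspoll_Pow_self])
  have "l \<in> elts \<theta>"
  proof (rule ccontr)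
    assume "l \<notin> elts \<theta>"
    then have "elts \<theta> \<lesssim> elts l"
      using Ord_not_in_lepoll[OF assms Card_imp_Ord[OF \<theta>(1)]] by simp
    then show False using lesspoll_imp_not_lepoll[OF less] by simp
  qed
  then have "Card \<theta> \<and> l \<in> elts \<theta>" using \<theta> by blast
  from ord_least[of \<theta> "\<lambda>\<kappa>. Card \<kappa> \<and> l \<in> elts \<kappa>", OF _ this]
  show "Ord (card_succ l)" "\<And>\<beta>. Card \<beta> \<Longrightarrow> \<beta> \<in> elts (card_succ l) \<Longrightarrow> l \<notin> elts \<beta>"
    using \<theta>(1) unfolding card_succ_def Card_def by blast+
qed

lemma lesspoll_card_succ:
  assumes "Ord l" "X \<prec> elts (card_succ l)"
  shows "X \<lesssim> elts l"
proof -
  obtain \<alpha> where \<alpha>: "Card \<alpha>" "\<alpha> \<in> elts (card_succ l)" "X \<approx> elts \<alpha>"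
    using lesspoll_imp_eqpoll_elt assms Ord_card_succ(1) by metis
  then have "elts \<alpha> \<subseteq> elts l"
    using Ord_card_succ(2) Ord_not_in assms(1) unfolding Card_def by blast
  then show ?thesis using lepoll_trans1[OF \<alpha>(3) subset_imp_lepoll] by simp
qed

text \<open>A bijection from \<delta> onto \<open>cf \<mu>\<close>, followed by a cofinal map, would
  be cofinal from \<delta>. Thus \<open>cf \<mu>\<close> is a cardinal, and being a member of it is
  the same as being of smaller size.\<close>

lemma cf_not_lepoll:
  assumes "Ord \<mu>" "\<delta> \<in> elts (cf \<mu>)"
  shows "elts \<delta> \<prec> elts (cf \<mu>)"
proof -
  have oc: "Ord (cf \<mu>)" using cf_cofinal_map(1) assms(1) by blast
  have sub: "elts \<delta> \<subseteq> elts (cf \<mu>)" using oc assms Ord_trans by blast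
  have "\<not> elts \<delta> \<approx> elts (cf \<mu>)"
  proof
    assume "elts \<delta> \<approx> elts (cf \<mu>)"
    then obtain h where h: "bij_betw h (elts \<delta>) (elts (cf \<mu>))" unfolding eqpoll_def by blast
    obtain f where f: "cofinal_map \<mu> (cf \<mu>) f" using cf_cofinal_map assms(1) by blast
    have "cofinal_map \<mu> \<delta> (f \<circ> h)"
      unfolding cofinal_map_def
    proof
      show "f \<circ> h \<in> elts \<delta> \<rightarrow> elts \<mu>"
        using f bij_betw_apply[OF h] unfolding cofinal_map_def by auto
      show "\<forall>\<alpha>\<in>elts \<mu>. \<exists>\<xi>\<in>elts \<delta>. \<alpha> \<in> elts ((f \<circ> h) \<xi>) \<or> \<alpha> = (f \<circ> h) \<xi>"
      proof
        fix \<alpha> assume "\<alpha> \<in> elts \<mu>"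
        then obtain \<xi> where "\<xi> \<in> elts (cf \<mu>)" "\<alpha> \<in> elts (f \<xi>) \<or> \<alpha> = f \<xi>"
          using f unfolding cofinal_map_def by blast
        moreover then obtain \<eta> where "\<eta> \<in> elts \<delta>" "\<xi> = h \<eta>"
          using h unfolding bij_betw_def by blast
        ultimately show "\<exists>\<xi>\<in>elts \<delta>. \<alpha> \<in> elts ((f \<circ> h) \<xi>) \<or> \<alpha> = (f \<circ> h) \<xi>" by auto
      qed
    qed
    then show False using cf_cofinal_map(3) assms by blast
  qed
  then show ?thesis using sub subset_imp_lepoll unfolding lesspoll_def by blast
qed

lemma infinite_UN_lepoll:
  assumes "infinite C" "I \<lesssim> C" "\<And>i. i \<in> I \<Longrightarrow> B i \<lesssim> C"
  shows "(\<Union>i\<in>I. B i) \<lesssim> C"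
proof -
  show ?thesis
    using card_of_UNION_ordLeq_infinite[OF assms(1), of I B] assms(2,3)
    unfolding lepoll_def card_of_ordLeq by blast
qed

text \<open>If \<alpha> were the largest member, \<kappa> would be \<alpha> with one point added,
  and one point does not change an infinite cardinality.\<close>

lemma InfCard_limit:
  assumes "InfCard \<kappa>" "\<alpha> \<in> elts \<kappa>"
  obtains \<beta> where "\<beta> \<in> elts \<kappa>" "\<alpha> \<in> elts \<beta>"
proof -
  have "\<exists>\<beta>\<in>elts \<kappa>. \<alpha> \<in> elts \<beta>"
  proof (rule ccontr)
    assume no: "\<not> (\<exists>\<beta>\<in>elts \<kappa>. \<alpha> \<in> elts \<beta>)"
    have "Ord \<kappa>" using assms unfolding InfCard_def Card_def by blast
    have "elts \<kappa> \<subseteq> insert \<alpha> (elts \<alpha>)"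
      using no Ord_linear assms(2) Ord_elts \<open>Ord \<kappa>\<close> by blast
    moreover then have "infinite (elts \<alpha>)"
      using assms finite_subset unfolding InfCard_def by blast
    ultimately have "elts \<kappa> \<lesssim> elts \<alpha>"
      using lepoll_trans[OF subset_imp_lepoll infinite_insert_lepoll, of "elts \<kappa>" \<alpha> "elts \<alpha>"] by simp
    moreover have "elts \<alpha> \<prec> elts \<kappa>"
      using Card_lesspoll[of \<kappa> \<alpha>] assms unfolding InfCard_def by simp
    ultimately show False
      using lesspoll_imp_not_lepoll by blast
  qed
  then show ?thesis using that by blast
qed

lemma strong_limit_Pow:
  assumes "strong_limit \<mu>" "X \<prec> elts \<mu>"
  shows "Pow X \<prec> elts \<mu>"
proof -
  have o: "Ord \<mu>" using assms unfolding strong_limit_def InfCard_def Card_def by blast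
  obtain \<nu> where \<nu>: "Card \<nu>" "\<nu> \<in> elts \<mu>" "X \<approx> elts \<nu>"
    using lesspoll_imp_eqpoll_elt assms(2) o by metis
  then obtain f where "bij_betw f X (elts \<nu>)" unfolding eqpoll_def by blast
  then have "bij_betw (image f) (Pow X) (Pow (elts \<nu>))" by (rule bij_betw_Pow)
  then have "Pow X \<approx> Pow (elts \<nu>)" unfolding eqpoll_def by blast
  moreover have "Pow (elts \<nu>) \<prec> elts \<mu>" using assms \<nu> unfolding strong_limit_def by blast
  ultimately show ?thesis by (rule eq_lesspoll_trans)
qed

text \<open>If one factor is infinite, comparability of cardinals bounds the product by the larger
  factor, which is then infinite too; a finite product is below \<mu> because \<mu> is
  infinite.\<close>

lemma InfCard_Times_lesspoll:
  assumes "InfCard \<mu>" "X \<prec> elts \<mu>" "Y \<prec> elts \<mu>"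
  shows "X \<times> Y \<prec> elts \<mu>"
proof (cases "finite X \<and> finite Y")
  case True
  then have "finite (X \<times> Y)" by simp
  moreover have "infinite (elts \<mu>)" using assms(1) unfolding InfCard_def by simp
  ultimately show ?thesis by (rule finite_lesspoll_infinite[rotated])
next
  case False
  have *: "A \<times> B \<lesssim> C" if "infinite C" "A \<lesssim> C" "B \<lesssim> C" for A :: "'b set" and B :: "'c set" and C :: "'d set"
  proof -
    have "A \<times> B = (\<Union>a\<in>A. Pair a ` B)" by auto
    moreover have "Pair a ` B \<lesssim> C" for a
      using image_lepoll that(3) by (rule lepoll_trans)
    ultimately show ?thesis
      using infinite_UN_lepoll[OF that(1,2), of "\<lambda>a. Pair a ` B"] by metis
  qed
  have "X \<lesssim> Y \<or> Y \<lesssim> X"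
    unfolding lepoll_def card_of_ordLeq using ordLeq_total[OF card_of_Well_order card_of_Well_order] .
  moreover have "infinite Y" if "X \<lesssim> Y"
    using False that by (metis finite_lepoll_infinite lepoll_def finite_subset finite_image_iff)
  moreover have "infinite X" if "Y \<lesssim> X"
    using False that by (metis finite_lepoll_infinite lepoll_def finite_subset finite_image_iff)
  ultimately have "X \<times> Y \<lesssim> X \<or> X \<times> Y \<lesssim> Y"
    using *[of X X Y] *[of Y X Y] lepoll_refl[of X] lepoll_refl[of Y] by metis
  then show ?thesis using lesspoll_trans1[OF _ assms(2)] lesspoll_trans1[OF _ assms(3)] by blast
qed

section \<open>Forcing atomic formulas\<close>

locale forcing =
  fixes P :: "'v::zfc_universe" and le :: "('v \<times> 'v) set" and one :: 'v
  assumes forcing_notion: "forcing_notion P le one"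
begin

abbreviation below :: "'v \<Rightarrow> 'v \<Rightarrow> bool" (infix "\<sqsubseteq>" 50) where
  "q \<sqsubseteq> p \<equiv> (q, p) \<in> le"

abbreviation feq :: "'v \<Rightarrow> 'v \<Rightarrow> 'v \<Rightarrow> bool" where
  "feq p a b \<equiv> force_eq le p a b"

abbreviation fmem :: "'v \<Rightarrow> 'v \<Rightarrow> 'v \<Rightarrow> bool" where
  "fmem p a b \<equiv> force_mem le p a b"

abbreviation forced :: "'v \<Rightarrow> 'v fm \<Rightarrow> bool" (infix "\<tturnstile>" 51) where
  "p \<tturnstile> \<phi> \<equiv> forces P le p \<phi>"

abbreviation name :: "'v \<Rightarrow> bool" where
  "name x \<equiv> is_name P x"

abbreviation ck :: "'v \<Rightarrow> 'v" where
  "ck x \<equiv> check_name one x"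

lemma below_refl [simp]: "p \<in> elts P \<Longrightarrow> p \<sqsubseteq> p"
  using forcing_notion unfolding forcing_notion_def preorder_on_def refl_on_def by blast

lemma below_trans [trans]: "r \<sqsubseteq> q \<Longrightarrow> q \<sqsubseteq> p \<Longrightarrow> r \<sqsubseteq> p"
  using forcing_notion unfolding forcing_notion_def preorder_on_def by (blast dest: transD)

lemma below_P: "q \<sqsubseteq> p \<Longrightarrow> q \<in> elts P" "q \<sqsubseteq> p \<Longrightarrow> p \<in> elts P"
  using forcing_notion unfolding forcing_notion_def preorder_on_def by blast+

lemma below_self: "q \<sqsubseteq> p \<Longrightarrow> q \<sqsubseteq> q"
  using below_P(1) below_refl by blast

lemma one_P [simp]: "one \<in> elts P"
  using forcing_notion unfolding forcing_notion_def by blast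

lemma below_one [simp]: "p \<in> elts P \<Longrightarrow> p \<sqsubseteq> one"
  using forcing_notion unfolding forcing_notion_def by blast

lemma name_induct [case_names step]:
  assumes "\<And>a. (\<And>\<sigma> s. vpair \<sigma> s \<in> elts a \<Longrightarrow> Q \<sigma>) \<Longrightarrow> Q a"
  shows "Q (a :: 'v)"
  using wf_trancl[OF foundation]
proof (induction a rule: wf_induct_rule)
  case (less a)
  show ?case by (rule assms) (use less fst_vpair_below in blast)
qed

lemma feq_mono: "feq p a b \<Longrightarrow> q \<sqsubseteq> p \<Longrightarrow> feq q a b"
  apply (subst force_eq.simps)
  apply (subst (asm) force_eq.simps)
  using below_trans by blast

lemma feq_dense:
  assumes "\<And>r. r \<sqsubseteq> p \<Longrightarrow> \<exists>q. q \<sqsubseteq> r \<and> feq q a b"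
  shows "feq p a b"
proof (subst force_eq.simps, intro conjI allI impI)
  fix \<sigma> s r assume s: "vpair \<sigma> s \<in> elts a" and "r \<sqsubseteq> p"
  then obtain q where q: "q \<sqsubseteq> r" "feq q a b" using assms by blast
  then obtain q' where "q' \<sqsubseteq> q"
    "q' \<sqsubseteq> s \<longrightarrow> (\<exists>\<tau> t. vpair \<tau> t \<in> elts b \<and> q' \<sqsubseteq> t \<and> feq q' \<sigma> \<tau>)"
    using s below_self force_eq.simps[of le q a b] by meson
  then show "\<exists>q. q \<sqsubseteq> r \<and> (q \<sqsubseteq> s \<longrightarrow> (\<exists>\<tau> t. vpair \<tau> t \<in> elts b \<and> q \<sqsubseteq> t \<and> feq q \<sigma> \<tau>))"
    using q below_trans by blast
next
  fix \<tau> t r assume t: "vpair \<tau> t \<in> elts b" and "r \<sqsubseteq> p"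
  then obtain q where q: "q \<sqsubseteq> r" "feq q a b" using assms by blast
  then obtain q' where "q' \<sqsubseteq> q"
    "q' \<sqsubseteq> t \<longrightarrow> (\<exists>\<sigma> s. vpair \<sigma> s \<in> elts a \<and> q' \<sqsubseteq> s \<and> feq q' \<sigma> \<tau>)"
    using t below_self force_eq.simps[of le q a b] by meson
  then show "\<exists>q. q \<sqsubseteq> r \<and> (q \<sqsubseteq> t \<longrightarrow> (\<exists>\<sigma> s. vpair \<sigma> s \<in> elts a \<and> q \<sqsubseteq> s \<and> feq q \<sigma> \<tau>))"
    using q below_trans by blast
qed

lemma fmem_mono: "fmem p a b \<Longrightarrow> q \<sqsubseteq> p \<Longrightarrow> fmem q a b"
  unfolding force_mem_def using below_trans by blast

lemma fmem_dense:
  assumes "\<And>r. r \<sqsubseteq> p \<Longrightarrow> \<exists>q. q \<sqsubseteq> r \<and> fmem q a b"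
  shows "fmem p a b"
  unfolding force_mem_def
proof (intro allI impI)
  fix r assume "r \<sqsubseteq> p"
  then obtain q where q: "q \<sqsubseteq> r" "fmem q a b" using assms by blast
  then obtain q' \<tau> t where "q' \<sqsubseteq> q" "vpair \<tau> t \<in> elts b \<and> q' \<sqsubseteq> t \<and> feq q' a \<tau>"
    unfolding force_mem_def using below_self by meson
  then show "\<exists>q. q \<sqsubseteq> r \<and> (\<exists>\<tau> t. vpair \<tau> t \<in> elts b \<and> q \<sqsubseteq> t \<and> feq q a \<tau>)"
    using q below_trans by blast
qed

lemma feq_refl [simp]: "feq p a a"
proof (induction a arbitrary: p rule: name_induct)
  case (step a)
  show ?case
    by (subst force_eq.simps) (meson below_self step)
qed

lemma feq_sym: "feq p a b \<Longrightarrow> feq p b a"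
proof (induction a arbitrary: b p rule: name_induct)
  case (step a)
  note ab = step.prems[unfolded force_eq.simps[of le p a b]]
  show ?case
  proof (subst force_eq.simps, intro conjI allI impI)
    fix \<sigma> s r assume "vpair \<sigma> s \<in> elts b" "r \<sqsubseteq> p"
    then show "\<exists>q. q \<sqsubseteq> r \<and> (q \<sqsubseteq> s \<longrightarrow> (\<exists>\<tau> t. vpair \<tau> t \<in> elts a \<and> q \<sqsubseteq> t \<and> feq q \<sigma> \<tau>))"
      using ab step.IH by meson
  next
    fix \<tau> t r assume "vpair \<tau> t \<in> elts a" "r \<sqsubseteq> p"
    then show "\<exists>q. q \<sqsubseteq> r \<and> (q \<sqsubseteq> t \<longrightarrow> (\<exists>\<sigma> s. vpair \<sigma> s \<in> elts b \<and> q \<sqsubseteq> s \<and> feq q \<sigma> \<tau>))"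
      using ab step.IH by meson
  qed
qed

lemma feq_trans: "feq p a b \<Longrightarrow> feq p b c \<Longrightarrow> feq p a c"
proof (induction a arbitrary: b c p rule: name_induct)
  case (step a)
  note ab = step.prems(1)[unfolded force_eq.simps[of le p a b]]
  note bc = step.prems(2)[unfolded force_eq.simps[of le p b c]]
  show ?case
  proof (subst force_eq.simps, intro conjI allI impI)
    fix \<sigma> s r assume s: "vpair \<sigma> s \<in> elts a" and r: "r \<sqsubseteq> p"
    then obtain q where q: "q \<sqsubseteq> r"
      "q \<sqsubseteq> s \<longrightarrow> (\<exists>\<tau> t. vpair \<tau> t \<in> elts b \<and> q \<sqsubseteq> t \<and> feq q \<sigma> \<tau>)"
      using ab by meson
    show "\<exists>q. q \<sqsubseteq> r \<and> (q \<sqsubseteq> s \<longrightarrow> (\<exists>\<tau> t. vpair \<tau> t \<in> elts c \<and> q \<sqsubseteq> t \<and> feq q \<sigma> \<tau>))"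
    proof (cases "q \<sqsubseteq> s")
      case True
      then obtain \<tau> t where t: "vpair \<tau> t \<in> elts b" "q \<sqsubseteq> t" "feq q \<sigma> \<tau>" using q by blast
      have "q \<sqsubseteq> p" using q(1) r below_trans by blast
      then obtain q' where q': "q' \<sqsubseteq> q"
        "q' \<sqsubseteq> t \<longrightarrow> (\<exists>\<upsilon> u. vpair \<upsilon> u \<in> elts c \<and> q' \<sqsubseteq> u \<and> feq q' \<tau> \<upsilon>)"
        using bc t(1) by meson
      then obtain \<upsilon> u where "vpair \<upsilon> u \<in> elts c \<and> q' \<sqsubseteq> u \<and> feq q' \<tau> \<upsilon>"
        using t(2) below_trans by meson
      then show ?thesis
        using q' q(1) step.IH s t feq_mono below_trans by meson
    qed (use q in blast)
  next
    fix \<upsilon> u r assume u: "vpair \<upsilon> u \<in> elts c" and r: "r \<sqsubseteq> p"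
    then obtain q where q: "q \<sqsubseteq> r"
      "q \<sqsubseteq> u \<longrightarrow> (\<exists>\<tau> t. vpair \<tau> t \<in> elts b \<and> q \<sqsubseteq> t \<and> feq q \<tau> \<upsilon>)"
      using bc by meson
    show "\<exists>q. q \<sqsubseteq> r \<and> (q \<sqsubseteq> u \<longrightarrow> (\<exists>\<sigma> s. vpair \<sigma> s \<in> elts a \<and> q \<sqsubseteq> s \<and> feq q \<sigma> \<upsilon>))"
    proof (cases "q \<sqsubseteq> u")
      case True
      then obtain \<tau> t where t: "vpair \<tau> t \<in> elts b" "q \<sqsubseteq> t" "feq q \<tau> \<upsilon>" using q by blast
      have "q \<sqsubseteq> p" using q(1) r below_trans by blast
      then obtain q' where q': "q' \<sqsubseteq> q"
        "q' \<sqsubseteq> t \<longrightarrow> (\<exists>\<sigma> s. vpair \<sigma> s \<in> elts a \<and> q' \<sqsubseteq> s \<and> feq q' \<sigma> \<tau>)"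
        using ab t(1) by meson
      then obtain \<sigma> s where "vpair \<sigma> s \<in> elts a \<and> q' \<sqsubseteq> s \<and> feq q' \<sigma> \<tau>"
        using t(2) below_trans by meson
      then show ?thesis
        using q' q(1) step.IH t feq_mono below_trans by meson
    qed (use q in blast)
  qed
qed

lemma fmemE:
  assumes "fmem p a b" "p \<in> elts P"
  obtains q \<tau> t where "q \<sqsubseteq> p" "vpair \<tau> t \<in> elts b" "q \<sqsubseteq> t" "feq q a \<tau>"
  using assms below_refl unfolding force_mem_def by meson

lemma fmem_elt: "vpair \<sigma> s \<in> elts a \<Longrightarrow> r \<sqsubseteq> s \<Longrightarrow> fmem r \<sigma> a"
  unfolding force_mem_def using below_self below_trans feq_refl by meson

lemma fmem_cong1: "fmem p a b \<Longrightarrow> feq p a a' \<Longrightarrow> fmem p a' b"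
  unfolding force_mem_def by (meson below_trans feq_mono feq_sym feq_trans)

lemma fmem_cong2:
  assumes "fmem p a b" "feq p b b'"
  shows "fmem p a b'"
  unfolding force_mem_def
proof (intro allI impI)
  fix r assume "r \<sqsubseteq> p"
  then obtain q \<tau> t where q: "q \<sqsubseteq> r" "vpair \<tau> t \<in> elts b" "q \<sqsubseteq> t" "feq q a \<tau>"
    using assms(1) unfolding force_mem_def by meson
  have "q \<sqsubseteq> p" using q(1) \<open>r \<sqsubseteq> p\<close> below_trans by blast
  then obtain q' where q': "q' \<sqsubseteq> q"
    "q' \<sqsubseteq> t \<longrightarrow> (\<exists>\<tau>' t'. vpair \<tau>' t' \<in> elts b' \<and> q' \<sqsubseteq> t' \<and> feq q' \<tau> \<tau>')"
    using assms(2)[unfolded force_eq.simps[of le p b b']] q(2) by meson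
  then obtain \<tau>' t' where "vpair \<tau>' t' \<in> elts b' \<and> q' \<sqsubseteq> t' \<and> feq q' \<tau> \<tau>'"
    using q(3) below_trans by meson
  then show "\<exists>q. q \<sqsubseteq> r \<and> (\<exists>\<tau> t. vpair \<tau> t \<in> elts b' \<and> q \<sqsubseteq> t \<and> feq q a \<tau>)"
    using q q' below_trans feq_mono feq_trans by meson
qed

text \<open>Conditions \<open>r\<close> that are not below \<open>s\<close> need no attention: there
  the implication inside \<open>force_eq\<close> holds vacuously at \<open>r\<close> itself.\<close>

lemma feqI:
  assumes "\<And>r \<sigma> s. vpair \<sigma> s \<in> elts a \<Longrightarrow> r \<sqsubseteq> p \<Longrightarrow> r \<sqsubseteq> s \<Longrightarrow> fmem r \<sigma> b"
    and "\<And>r \<sigma> s. vpair \<sigma> s \<in> elts b \<Longrightarrow> r \<sqsubseteq> p \<Longrightarrow> r \<sqsubseteq> s \<Longrightarrow> fmem r \<sigma> a"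
  shows "feq p a b"
proof -
  have *: "\<exists>q. q \<sqsubseteq> r \<and> (q \<sqsubseteq> s \<longrightarrow> (\<exists>\<tau> t. vpair \<tau> t \<in> elts b \<and> q \<sqsubseteq> t \<and> feq q \<sigma> \<tau>))"
    if "\<And>r. r \<sqsubseteq> p \<Longrightarrow> r \<sqsubseteq> s \<Longrightarrow> fmem r \<sigma> b" "r \<sqsubseteq> p" for \<sigma> s r b
  proof (cases "r \<sqsubseteq> s")
    case True
    then have "fmem r \<sigma> b" using that by blast
    then show ?thesis using fmemE below_P that(2) by metis
  next
    case False
    then show ?thesis using below_self that(2) by blast
  qed
  show ?thesis
  proof (subst force_eq.simps, intro conjI allI impI)
    fix \<sigma> s r assume "vpair \<sigma> s \<in> elts a" "r \<sqsubseteq> p"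
    then show "\<exists>q. q \<sqsubseteq> r \<and> (q \<sqsubseteq> s \<longrightarrow> (\<exists>\<tau> t. vpair \<tau> t \<in> elts b \<and> q \<sqsubseteq> t \<and> feq q \<sigma> \<tau>))"
      using *[of s \<sigma> b r] assms(1) by blast
  next
    fix \<sigma> s r assume "vpair \<sigma> s \<in> elts b" "r \<sqsubseteq> p"
    then show "\<exists>q. q \<sqsubseteq> r \<and> (q \<sqsubseteq> s \<longrightarrow> (\<exists>\<tau> t. vpair \<tau> t \<in> elts a \<and> q \<sqsubseteq> t \<and> feq q \<tau> \<sigma>))"
      using *[of s \<sigma> a r] assms(2) feq_sym by blast
  qed
qed

lemma feq_ext:
  assumes "\<And>r \<sigma>. r \<sqsubseteq> p \<Longrightarrow> fmem r \<sigma> a \<longleftrightarrow> fmem r \<sigma> b"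
  shows "feq p a b"
  by (rule feqI) (use assms fmem_elt in blast)+

section \<open>Names\<close>

lemma name_elt: "name x \<Longrightarrow> vpair \<sigma> s \<in> elts x \<Longrightarrow> name \<sigma> \<and> s \<in> elts P"
  by (erule is_name.cases) (metis vpair_inject)

lemma nameI: "(\<And>z. z \<in> elts x \<Longrightarrow> \<exists>\<sigma> p. z = vpair \<sigma> p \<and> p \<in> elts P \<and> name \<sigma>) \<Longrightarrow> name x"
  by (rule is_name.intros) blast

text \<open>\<open>Forall\<close> ranges over names only. Members of a name are names, so testing
  extensionality on names loses nothing.\<close>

lemma feq_ext_name:
  assumes "name a" "name b" "\<And>r \<sigma>. r \<sqsubseteq> p \<Longrightarrow> name \<sigma> \<Longrightarrow> fmem r \<sigma> a \<longleftrightarrow> fmem r \<sigma> b"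
  shows "feq p a b"
  by (rule feqI) (use assms fmem_elt name_elt in blast)+

lemma elts_ck: "elts (ck a) = (\<lambda>y. vpair (ck y) one) ` elts a"
  by (subst check_name.simps) (simp add: small_image)

lemma name_ck [simp]: "name (ck a)"
proof (induction a rule: elts_induct)
  case (step a)
  show ?case by (rule nameI) (use step in \<open>auto simp: elts_ck\<close>)
qed

lemma fmem_ckE:
  assumes "fmem p x (ck a)" "p \<in> elts P"
  obtains q b where "q \<sqsubseteq> p" "b \<in> elts a" "feq q x (ck b)"
proof -
  obtain q \<tau> t where "q \<sqsubseteq> p" "vpair \<tau> t \<in> elts (ck a)" "feq q x \<tau>"
    using fmemE assms by metis
  then show ?thesis using that by (auto simp: elts_ck)
qed

lemma fmem_ckI: "b \<in> elts a \<Longrightarrow> p \<in> elts P \<Longrightarrow> fmem p (ck b) (ck a)"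
  by (rule fmem_elt[of _ one]) (auto simp: elts_ck)

text \<open>A single condition decides equality of check names: a member \<open>c\<close> of
  \<open>a\<close> is forced, below some extension, to equal the check name of a member of
  \<open>b\<close>, and the induction hypothesis identifies the two.\<close>

lemma feq_ck: "p \<in> elts P \<Longrightarrow> feq p (ck a) (ck b) \<Longrightarrow> a = b"
proof (induction a arbitrary: b p rule: elts_induct)
  case (step a)
  have "elts a \<subseteq> elts b"
  proof
    fix c assume c: "c \<in> elts a"
    then have "fmem p (ck c) (ck b)" using step.prems fmem_ckI fmem_cong2 by blast
    then obtain q d where "q \<sqsubseteq> p" "d \<in> elts b" "feq q (ck c) (ck d)"
      using fmem_ckE step.prems by metis
    then show "c \<in> elts b" using step.IH c below_P by metis
  qed
  moreover have "elts b \<subseteq> elts a"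
  proof
    fix c assume c: "c \<in> elts b"
    then have "fmem p (ck c) (ck a)" using step.prems fmem_ckI fmem_cong2 feq_sym by blast
    then obtain q d where "q \<sqsubseteq> p" "d \<in> elts a" "feq q (ck c) (ck d)"
      using fmem_ckE step.prems by metis
    then show "c \<in> elts a" using step.IH feq_sym below_P by metis
  qed
  ultimately show ?case using extensionality by blast
qed

lemma fmem_ck_iff: "p \<in> elts P \<Longrightarrow> fmem p (ck a) (ck b) \<longleftrightarrow> a \<in> elts b"
  using fmem_ckI fmem_ckE feq_ck below_P by metis

section \<open>Compound formulas\<close>

lemma forces_mono: "p \<tturnstile> \<phi> \<Longrightarrow> q \<sqsubseteq> p \<Longrightarrow> q \<tturnstile> \<phi>"
  by (induction \<phi> arbitrary: p q) (auto intro: feq_mono fmem_mono below_trans)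

text \<open>Later witnesses are found only on dense sets, and this turns them into forcing at
  \<open>p\<close>. Persistence is needed for negation alone, where it leads to a condition forcing
  both a formula and its negation.\<close>

lemma forces_dense: "(\<And>r. r \<sqsubseteq> p \<Longrightarrow> \<exists>q. q \<sqsubseteq> r \<and> q \<tturnstile> \<phi>) \<Longrightarrow> p \<tturnstile> \<phi>"
proof (induction \<phi> arbitrary: p)
  case (Mem x1 x2)
  then show ?case using fmem_dense by simp
next
  case (Equal x1 x2)
  then show ?case using feq_dense by simp
next
  case (Neg \<phi>)
  show ?case
    unfolding forces.simps
  proof (intro allI impI notI)
    fix r assume r: "r \<sqsubseteq> p" "r \<tturnstile> \<phi>"
    then obtain q where q: "q \<sqsubseteq> r" "q \<tturnstile> Neg \<phi>" using Neg.prems by blast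
    then have "q \<tturnstile> \<phi>" using forces_mono r by blast
    then show False using q below_self[OF q(1)] by simp
  qed
next
  case (Conj \<phi>1 \<phi>2)
  have "p \<tturnstile> \<phi>1" by (rule Conj.IH(1)) (use Conj.prems in auto)
  moreover have "p \<tturnstile> \<phi>2" by (rule Conj.IH(2)) (use Conj.prems in auto)
  ultimately show ?case by simp
next
  case (Forall \<phi>)
  show ?case
    unfolding forces.simps
  proof (intro allI impI)
    fix \<tau> assume "name \<tau>"
    then show "p \<tturnstile> \<phi> \<tau>" by (intro Forall.IH) (use Forall.prems in auto)
  qed
qed

text \<open>The classical encoding says only that no extension of \<open>q\<close> forces the
  negation of \<psi>; this means that \<psi> is forced on a dense set below \<open>q\<close>, and
  \<open>forces_dense\<close> yields \<psi> at \<open>q\<close>.\<close>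

lemma forces_Imp [simp]: "p \<tturnstile> (\<phi> \<^bold>\<longrightarrow> \<psi>) \<longleftrightarrow> (\<forall>q. q \<sqsubseteq> p \<longrightarrow> q \<tturnstile> \<phi> \<longrightarrow> q \<tturnstile> \<psi>)"
proof
  assume L: "p \<tturnstile> (\<phi> \<^bold>\<longrightarrow> \<psi>)"
  show "\<forall>q. q \<sqsubseteq> p \<longrightarrow> q \<tturnstile> \<phi> \<longrightarrow> q \<tturnstile> \<psi>"
  proof (intro allI impI, rule forces_dense)
    fix q r assume "q \<sqsubseteq> p" "q \<tturnstile> \<phi>" "r \<sqsubseteq> q"
    then have "r \<sqsubseteq> p" "r \<tturnstile> \<phi>" using below_trans forces_mono by blast+
    then have "\<not> (\<forall>q. q \<sqsubseteq> r \<longrightarrow> \<not> q \<tturnstile> \<psi>)"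
      using L unfolding Imp_def by auto
    then show "\<exists>q. q \<sqsubseteq> r \<and> q \<tturnstile> \<psi>" by blast
  qed
next
  assume "\<forall>q. q \<sqsubseteq> p \<longrightarrow> q \<tturnstile> \<phi> \<longrightarrow> q \<tturnstile> \<psi>"
  then show "p \<tturnstile> (\<phi> \<^bold>\<longrightarrow> \<psi>)"
    unfolding Imp_def by (auto dest: below_self)
qed

lemma forces_Iff [simp]:
  "p \<tturnstile> (\<phi> \<^bold>\<longleftrightarrow> \<psi>) \<longleftrightarrow> (\<forall>q. q \<sqsubseteq> p \<longrightarrow> q \<tturnstile> \<phi> \<longleftrightarrow> q \<tturnstile> \<psi>)"
  unfolding Iff_def by auto

lemma forces_Disj [simp]:
  "p \<tturnstile> (\<phi> \<^bold>\<or> \<psi>) \<longleftrightarrow> (\<forall>q. q \<sqsubseteq> p \<longrightarrow> (\<exists>r. r \<sqsubseteq> q \<and> (r \<tturnstile> \<phi> \<or> r \<tturnstile> \<psi>)))"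
  unfolding Disj_def by simp (meson below_trans below_self)

lemma forces_Exists [simp]:
  "p \<tturnstile> (Exists \<phi>) \<longleftrightarrow> (\<forall>q. q \<sqsubseteq> p \<longrightarrow> (\<exists>r \<tau>. r \<sqsubseteq> q \<and> name \<tau> \<and> r \<tturnstile> \<phi> \<tau>))"
  unfolding Exists_def by simp blast

lemma forces_ExistsE:
  assumes "p \<tturnstile> Exists \<phi>" "q \<sqsubseteq> p"
  obtains r \<tau> where "r \<sqsubseteq> q" "name \<tau>" "r \<tturnstile> \<phi> \<tau>"
  using assms unfolding forces_Exists by blast

lemma forces_ExistsI: "name \<tau> \<Longrightarrow> p \<tturnstile> \<phi> \<tau> \<Longrightarrow> p \<tturnstile> Exists \<phi>"
  using forces_mono below_self by (simp, blast)

lemma forces_Forall_ImpI: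
  "(\<And>\<tau> q. name \<tau> \<Longrightarrow> q \<sqsubseteq> p \<Longrightarrow> q \<tturnstile> \<phi> \<tau> \<Longrightarrow> q \<tturnstile> \<psi> \<tau>) \<Longrightarrow> p \<tturnstile> (\<^bold>\<forall>x. \<phi> x \<^bold>\<longrightarrow> \<psi> x)"
  by simp

lemma forces_Forall_ImpD:
  "p \<tturnstile> (\<^bold>\<forall>x. \<phi> x \<^bold>\<longrightarrow> \<psi> x) \<Longrightarrow> name \<tau> \<Longrightarrow> q \<sqsubseteq> p \<Longrightarrow> q \<tturnstile> \<phi> \<tau> \<Longrightarrow> q \<tturnstile> \<psi> \<tau>"
  by simp

lemma forces_sub [simp]:
  "p \<tturnstile> (x \<^bold>\<subseteq> y) \<longleftrightarrow> (\<forall>\<tau> q. name \<tau> \<longrightarrow> q \<sqsubseteq> p \<longrightarrow> fmem q \<tau> x \<longrightarrow> fmem q \<tau> y)"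
  unfolding sub_fm_def by auto

section \<open>Names for pairs and functions\<close>

text \<open>The canonical name of an unordered pair: the condition \<open>one\<close> makes both
  members unconditional. \<open>opn\<close> is the Kuratowski pair built from it, to match
  \<open>pair_fm\<close>.\<close>

definition upn :: "'v \<Rightarrow> 'v \<Rightarrow> 'v" where
  "upn x y = vset {vpair x one, vpair y one}"

definition opn :: "'v \<Rightarrow> 'v \<Rightarrow> 'v" where
  "opn x y = upn (upn x x) (upn x y)"

lemma elts_upn: "elts (upn x y) = {vpair x one, vpair y one}"
  unfolding upn_def by simp

lemma name_upn [simp]: "name x \<Longrightarrow> name y \<Longrightarrow> name (upn x y)"
  by (rule nameI) (auto simp: elts_upn)

lemma name_opn [simp]: "name x \<Longrightarrow> name y \<Longrightarrow> name (opn x y)"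
  unfolding opn_def by simp

lemma fmem_upnI: "p \<in> elts P \<Longrightarrow> fmem p x (upn x y)" "p \<in> elts P \<Longrightarrow> fmem p y (upn x y)"
  by (rule fmem_elt[of _ one]; simp add: elts_upn)+

lemma fmem_upnE:
  assumes "fmem p z (upn x y)" "p \<in> elts P"
  obtains q where "q \<sqsubseteq> p" "feq q z x \<or> feq q z y"
proof -
  obtain q \<tau> t where "q \<sqsubseteq> p" "vpair \<tau> t \<in> elts (upn x y)" "feq q z \<tau>"
    using fmemE assms by metis
  then show ?thesis using that by (auto simp: elts_upn)
qed

lemma fmem_upn_iff:
  "fmem p z (upn x y) \<longleftrightarrow> (\<forall>q. q \<sqsubseteq> p \<longrightarrow> (\<exists>r. r \<sqsubseteq> q \<and> (feq r z x \<or> feq r z y)))"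
proof
  assume "fmem p z (upn x y)"
  then show "\<forall>q. q \<sqsubseteq> p \<longrightarrow> (\<exists>r. r \<sqsubseteq> q \<and> (feq r z x \<or> feq r z y))"
    using fmem_upnE fmem_mono below_P by metis
next
  assume *: "\<forall>q. q \<sqsubseteq> p \<longrightarrow> (\<exists>r. r \<sqsubseteq> q \<and> (feq r z x \<or> feq r z y))"
  show "fmem p z (upn x y)"
    by (rule fmem_dense) (meson * below_P fmem_cong1 fmem_upnI feq_sym)
qed

lemma fmem_upn_same: "p \<in> elts P \<Longrightarrow> fmem p z (upn x x) \<longleftrightarrow> feq p z x"
  unfolding fmem_upn_iff using feq_dense feq_mono below_self by blast

lemma upn_cong: "feq p x x' \<Longrightarrow> feq p y y' \<Longrightarrow> feq p (upn x y) (upn x' y')"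
proof (rule feq_ext)
  fix r \<sigma> assume r: "r \<sqsubseteq> p" and eq: "feq p x x'" "feq p y y'"
  have *: "q \<sqsubseteq> p \<Longrightarrow> feq q \<sigma> x \<longleftrightarrow> feq q \<sigma> x'" "q \<sqsubseteq> p \<Longrightarrow> feq q \<sigma> y \<longleftrightarrow> feq q \<sigma> y'" for q
    using eq feq_mono feq_trans feq_sym by blast+
  show "fmem r \<sigma> (upn x y) \<longleftrightarrow> fmem r \<sigma> (upn x' y')"
    unfolding fmem_upn_iff using * below_trans r by meson
qed

lemma opn_cong: "feq p x x' \<Longrightarrow> feq p y y' \<Longrightarrow> feq p (opn x y) (opn x' y')"
  unfolding opn_def by (intro upn_cong)

lemma opn_inject1:
  assumes "feq p (opn x y) (opn x' y')"
  shows "feq p x x'"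
proof (rule feq_dense)
  fix r assume r: "r \<sqsubseteq> p"
  have "fmem r (upn x x) (opn x' y')"
    using assms fmem_upnI fmem_cong2 feq_mono r below_P unfolding opn_def by blast
  then obtain q where q: "q \<sqsubseteq> r" "feq q (upn x x) (upn x' x') \<or> feq q (upn x x) (upn x' y')"
    unfolding opn_def using fmem_upnE r below_P by metis
  then have "fmem q x' (upn x x)"
    using fmem_upnI(1) below_P feq_sym fmem_cong2 by blast
  then show "\<exists>q. q \<sqsubseteq> r \<and> feq q x x'"
    using q fmem_upn_same below_P feq_sym by blast
qed

lemma opn_inject2:
  assumes eq: "feq p (opn x y) (opn x' y')"
  shows "feq p y y'"
proof (rule feq_dense)
  fix r assume r: "r \<sqsubseteq> p"
  \<comment> \<open>This leaves open that \<open>y\<close> equals \<open>x\<close>. Applied again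
    with the two pairs exchanged, it gives that \<open>y'\<close> equals \<open>y\<close> or
    \<open>x'\<close>; in the remaining case \<open>y = x = x' = y'\<close>.\<close>
  have *: "\<exists>q. q \<sqsubseteq> r \<and> (feq q y y' \<or> feq q y x)"
    if eq: "feq r (opn x y) (opn x' y')" and x: "feq r x x'" and rP: "r \<in> elts P" for r x y x' y'
  proof -
    have "fmem r (upn x y) (opn x' y')"
      using eq rP fmem_upnI fmem_cong2 unfolding opn_def by blast
    then obtain q where q: "q \<sqsubseteq> r" "feq q (upn x y) (upn x' x') \<or> feq q (upn x y) (upn x' y')"
      unfolding opn_def using fmem_upnE rP by metis
    then have "fmem q y (upn x' x') \<or> fmem q y (upn x' y')"
      using fmem_upnI(2) below_P fmem_cong2 by blast
    then obtain q' where "q' \<sqsubseteq> q" "feq q' y x' \<or> feq q' y y'"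
      using fmem_upnE below_P q(1) by metis
    then show ?thesis
      using q(1) x below_trans feq_mono feq_sym feq_trans by meson
  qed
  have rx: "feq r x x'" using opn_inject1 eq feq_mono r by blast
  obtain q where q: "q \<sqsubseteq> r" "feq q y y' \<or> feq q y x"
    using * eq feq_mono r rx below_P by metis
  have "feq q (opn x' y') (opn x y)" "feq q x' x"
    using eq rx q(1) r feq_mono below_trans feq_sym by meson+
  then obtain q' where q': "q' \<sqsubseteq> q" "feq q' y' y \<or> feq q' y' x'"
    using *[of q x' y' x y] q(1) below_P by blast
  then have "feq q' y y'"
    using q feq_mono feq_sym feq_trans rx q(1) below_trans by meson
  then show "\<exists>q. q \<sqsubseteq> r \<and> feq q y y'" using q q' below_trans by blast
qed

lemma forces_upair: "name x \<Longrightarrow> name y \<Longrightarrow> name z \<Longrightarrow> p \<tturnstile> upair_fm z x y \<longleftrightarrow> feq p z (upn x y)"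
proof
  assume n: "name x" "name y" "name z" and "p \<tturnstile> upair_fm z x y"
  then have *: "q \<sqsubseteq> p \<Longrightarrow> name w \<Longrightarrow> fmem q w z \<longleftrightarrow> fmem q w (upn x y)" for q w
    unfolding upair_fm_def fmem_upn_iff by simp
  show "feq p z (upn x y)" by (rule feq_ext_name) (use n * in auto)
next
  assume "feq p z (upn x y)"
  then have "q \<sqsubseteq> p \<Longrightarrow> fmem q w z \<longleftrightarrow> fmem q w (upn x y)" for q w
    using fmem_cong2 feq_sym feq_mono by blast
  then show "p \<tturnstile> upair_fm z x y"
    unfolding upair_fm_def fmem_upn_iff by simp
qed

lemma forces_pair:
  assumes "name x" "name y" "name z"
  shows "p \<tturnstile> pair_fm z x y \<longleftrightarrow> feq p z (opn x y)"
proof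
  assume L: "p \<tturnstile> pair_fm z x y"
  show "feq p z (opn x y)"
  proof (rule feq_dense)
    fix r assume "r \<sqsubseteq> p"
    from L[unfolded pair_fm_def] this obtain q u where q: "q \<sqsubseteq> r" "name u"
      "q \<tturnstile> (\<^bold>\<exists>v. upair_fm u x x \<^bold>\<and> upair_fm v x y \<^bold>\<and> upair_fm z u v)"
      by (rule forces_ExistsE)
    from q(3) below_self[OF q(1)] obtain q' v where q': "q' \<sqsubseteq> q" "name v"
      "q' \<tturnstile> (upair_fm u x x \<^bold>\<and> upair_fm v x y \<^bold>\<and> upair_fm z u v)"
      by (rule forces_ExistsE)
    then have "feq q' u (upn x x)" "feq q' v (upn x y)" "feq q' z (upn u v)"
      using assms q by (simp_all add: forces_upair)
    then have "feq q' z (opn x y)" unfolding opn_def using upn_cong feq_trans by blast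
    then show "\<exists>q. q \<sqsubseteq> r \<and> feq q z (opn x y)" using q q' below_trans by blast
  qed
next
  assume R: "feq p z (opn x y)"
  show "p \<tturnstile> pair_fm z x y"
    unfolding pair_fm_def
    by (rule forces_ExistsI[of "upn x x"], simp add: assms, rule forces_ExistsI[of "upn x y"])
       (use assms R in \<open>simp_all add: forces_upair opn_def\<close>)
qed

lemma forces_app:
  assumes "name x" "name y" "name f"
  shows "p \<tturnstile> app_fm f x y \<longleftrightarrow> fmem p (opn x y) f"
proof
  assume L: "p \<tturnstile> app_fm f x y"
  show "fmem p (opn x y) f"
  proof (rule fmem_dense)
    fix r assume "r \<sqsubseteq> p"
    from L[unfolded app_fm_def] this
    obtain q z where q: "q \<sqsubseteq> r" "name z" "q \<tturnstile> (pair_fm z x y \<^bold>\<and> z \<^bold>\<in> f)"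
      by (rule forces_ExistsE)
    then have "feq q z (opn x y)" "fmem q z f" using assms by (simp_all add: forces_pair)
    then show "\<exists>q. q \<sqsubseteq> r \<and> fmem q (opn x y) f" using q fmem_cong1 by blast
  qed
next
  assume R: "fmem p (opn x y) f"
  show "p \<tturnstile> app_fm f x y"
    unfolding app_fm_def
    by (rule forces_ExistsI[of "opn x y"]) (use assms R in \<open>simp_all add: forces_pair\<close>)
qed

section \<open>Injections and bijections in the forcing language\<close>

definition finj :: "'v \<Rightarrow> 'v \<Rightarrow> 'v \<Rightarrow> 'v \<Rightarrow> bool" where
  "finj p f X Y \<longleftrightarrow>
     (\<forall>q z. q \<sqsubseteq> p \<longrightarrow> name z \<longrightarrow> fmem q z f \<longrightarrow>
        (\<exists>r x y. r \<sqsubseteq> q \<and> name x \<and> name y \<and> fmem r x X \<and> fmem r y Y \<and> feq r z (opn x y))) \<and>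
     (\<forall>q x. q \<sqsubseteq> p \<longrightarrow> name x \<longrightarrow> fmem q x X \<longrightarrow> (\<exists>r y. r \<sqsubseteq> q \<and> name y \<and> fmem r (opn x y) f)) \<and>
     (\<forall>q x y y'. q \<sqsubseteq> p \<longrightarrow> name x \<longrightarrow> name y \<longrightarrow> name y' \<longrightarrow>
        fmem q (opn x y) f \<longrightarrow> fmem q (opn x y') f \<longrightarrow> feq q y y') \<and>
     (\<forall>q x x' y. q \<sqsubseteq> p \<longrightarrow> name x \<longrightarrow> name x' \<longrightarrow> name y \<longrightarrow>
        fmem q (opn x y) f \<longrightarrow> fmem q (opn x' y) f \<longrightarrow> feq q x x')"

definition fbij :: "'v \<Rightarrow> 'v \<Rightarrow> 'v \<Rightarrow> 'v \<Rightarrow> bool" where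
  "fbij p f X Y \<longleftrightarrow> finj p f X Y \<and>
     (\<forall>q y. q \<sqsubseteq> p \<longrightarrow> name y \<longrightarrow> fmem q y Y \<longrightarrow> (\<exists>r x. r \<sqsubseteq> q \<and> name x \<and> fmem r (opn x y) f))"

text \<open>Existential quantifiers are witnessed only below a further condition, whence the extra
  \<open>r\<close> in \<open>finj\<close>. The quantifiers over pairs disappear because
  \<open>forces_pair\<close> and \<open>forces_app\<close> fix a pair by its canonical name
  \<open>opn\<close>.\<close>

lemma forces_injection:
  assumes n: "name f" "name X" "name Y"
  shows "p \<tturnstile> injection_fm f X Y \<longleftrightarrow> finj p f X Y"
proof -
  have 1: "p \<tturnstile> (\<^bold>\<forall>z. z \<^bold>\<in> f \<^bold>\<longrightarrow> (\<^bold>\<exists>x. \<^bold>\<exists>y. x \<^bold>\<in> X \<^bold>\<and> y \<^bold>\<in> Y \<^bold>\<and> pair_fm z x y)) \<longleftrightarrow>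
     (\<forall>q z. q \<sqsubseteq> p \<longrightarrow> name z \<longrightarrow> fmem q z f \<longrightarrow>
        (\<exists>r x y. r \<sqsubseteq> q \<and> name x \<and> name y \<and> fmem r x X \<and> fmem r y Y \<and> feq r z (opn x y)))"
    (is "?L \<longleftrightarrow> ?R")
  proof
    assume L: ?L
    show ?R
    proof (intro allI impI)
      fix q z assume q: "q \<sqsubseteq> p" "name z" "fmem q z f"
      then have "q \<tturnstile> (\<^bold>\<exists>x. \<^bold>\<exists>y. x \<^bold>\<in> X \<^bold>\<and> y \<^bold>\<in> Y \<^bold>\<and> pair_fm z x y)"
        by (intro forces_Forall_ImpD[OF L]) simp_all
      from this below_self[OF q(1)] obtain r x where
        r: "r \<sqsubseteq> q" "name x" "r \<tturnstile> (\<^bold>\<exists>y. x \<^bold>\<in> X \<^bold>\<and> y \<^bold>\<in> Y \<^bold>\<and> pair_fm z x y)"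
        by (rule forces_ExistsE)
      from r(3) below_self[OF r(1)] obtain r' y where
        r': "r' \<sqsubseteq> r" "name y" "r' \<tturnstile> (x \<^bold>\<in> X \<^bold>\<and> y \<^bold>\<in> Y \<^bold>\<and> pair_fm z x y)"
        by (rule forces_ExistsE)
      then have "fmem r' x X" "fmem r' y Y" "feq r' z (opn x y)"
        using q r by (simp_all add: forces_pair)
      then show "\<exists>r x y. r \<sqsubseteq> q \<and> name x \<and> name y \<and> fmem r x X \<and> fmem r y Y \<and> feq r z (opn x y)"
        using r r' below_trans by blast
    qed
  next
    assume R: ?R
    show ?L
    proof (rule forces_Forall_ImpI, rule forces_dense)
      fix z q q' assume z: "name z" "q \<sqsubseteq> p" "q \<tturnstile> (z \<^bold>\<in> f)" "q' \<sqsubseteq> q"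
      then have "fmem q z f" by simp
      with z obtain r x y where r: "r \<sqsubseteq> q'" "name x" "name y" "fmem r x X" "fmem r y Y" "feq r z (opn x y)"
        using R below_trans fmem_mono by meson
      have "r \<tturnstile> (\<^bold>\<exists>x. \<^bold>\<exists>y. x \<^bold>\<in> X \<^bold>\<and> y \<^bold>\<in> Y \<^bold>\<and> pair_fm z x y)"
        by (rule forces_ExistsI[OF r(2)], rule forces_ExistsI[OF r(3)])
           (use r z in \<open>simp add: forces_pair\<close>)
      then show "\<exists>r. r \<sqsubseteq> q' \<and> r \<tturnstile> (\<^bold>\<exists>x. \<^bold>\<exists>y. x \<^bold>\<in> X \<^bold>\<and> y \<^bold>\<in> Y \<^bold>\<and> pair_fm z x y)"
        using r by blast
    qed
  qed
  have 2: "p \<tturnstile> (\<^bold>\<forall>x. x \<^bold>\<in> X \<^bold>\<longrightarrow> (\<^bold>\<exists>y. app_fm f x y)) \<longleftrightarrow>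
     (\<forall>q x. q \<sqsubseteq> p \<longrightarrow> name x \<longrightarrow> fmem q x X \<longrightarrow> (\<exists>r y. r \<sqsubseteq> q \<and> name y \<and> fmem r (opn x y) f))"
    (is "?L \<longleftrightarrow> ?R")
  proof
    assume ?L
    then show ?R
      using n below_self by (simp add: forces_app cong: conj_cong)
  next
    assume R: ?R
    show ?L
    proof (rule forces_Forall_ImpI, unfold forces_Exists forces.simps, intro allI impI)
      fix x q q' assume "name x" "q \<sqsubseteq> p" "fmem q x X" "q' \<sqsubseteq> q"
      then obtain r y where "r \<sqsubseteq> q'" "name y" "fmem r (opn x y) f"
        using R below_trans fmem_mono by meson
      then show "\<exists>r \<tau>. r \<sqsubseteq> q' \<and> name \<tau> \<and> r \<tturnstile> app_fm f x \<tau>"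
        using forces_app \<open>name x\<close> n by blast
    qed
  qed
  have 3: "p \<tturnstile> (\<^bold>\<forall>x. \<^bold>\<forall>y. \<^bold>\<forall>y'. app_fm f x y \<^bold>\<and> app_fm f x y' \<^bold>\<longrightarrow> y \<^bold>= y') \<longleftrightarrow>
     (\<forall>q x y y'. q \<sqsubseteq> p \<longrightarrow> name x \<longrightarrow> name y \<longrightarrow> name y' \<longrightarrow>
        fmem q (opn x y) f \<longrightarrow> fmem q (opn x y') f \<longrightarrow> feq q y y')"
    using n by (auto simp: forces_app)
  have 4: "p \<tturnstile> (\<^bold>\<forall>x. \<^bold>\<forall>x'. \<^bold>\<forall>y. app_fm f x y \<^bold>\<and> app_fm f x' y \<^bold>\<longrightarrow> x \<^bold>= x') \<longleftrightarrow>
     (\<forall>q x x' y. q \<sqsubseteq> p \<longrightarrow> name x \<longrightarrow> name x' \<longrightarrow> name y \<longrightarrow>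
        fmem q (opn x y) f \<longrightarrow> fmem q (opn x' y) f \<longrightarrow> feq q x x')"
    using n by (auto simp: forces_app)
  show ?thesis
    unfolding injection_fm_def function_fm_def finj_def forces.simps(4) 1 2 3 4 by blast
qed

lemma forces_bijection:
  assumes n: "name f" "name X" "name Y"
  shows "p \<tturnstile> bijection_fm f X Y \<longleftrightarrow> fbij p f X Y"
proof -
  have "p \<tturnstile> (\<^bold>\<forall>y. y \<^bold>\<in> Y \<^bold>\<longrightarrow> (\<^bold>\<exists>x. app_fm f x y)) \<longleftrightarrow>
     (\<forall>q y. q \<sqsubseteq> p \<longrightarrow> name y \<longrightarrow> fmem q y Y \<longrightarrow> (\<exists>r x. r \<sqsubseteq> q \<and> name x \<and> fmem r (opn x y) f))"
    (is "?L \<longleftrightarrow> ?R")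
  proof
    assume ?L
    then show ?R
      using n below_self by (simp add: forces_app cong: conj_cong)
  next
    assume R: ?R
    show ?L
    proof (rule forces_Forall_ImpI, unfold forces_Exists forces.simps, intro allI impI)
      fix x q q' assume "name x" "q \<sqsubseteq> p" "fmem q x Y" "q' \<sqsubseteq> q"
      then obtain r y where "r \<sqsubseteq> q'" "name y" "fmem r (opn y x) f"
        using R below_trans fmem_mono by meson
      then show "\<exists>r \<tau>. r \<sqsubseteq> q' \<and> name \<tau> \<and> r \<tturnstile> app_fm f \<tau> x"
        using forces_app \<open>name x\<close> n by blast
    qed
  qed
  then show ?thesis
    unfolding bijection_fm_def fbij_def forces.simps(4) forces_injection[OF n] by blast
qed

lemma forces_eqpollI: "name f \<Longrightarrow> name X \<Longrightarrow> name Y \<Longrightarrow> fbij p f X Y \<Longrightarrow> p \<tturnstile> eqpoll_fm X Y"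
  unfolding eqpoll_fm_def by (rule forces_ExistsI[of f]) (simp_all add: forces_bijection)

lemma forces_eqpollE:
  assumes "p \<tturnstile> eqpoll_fm X Y" "name X" "name Y" "q \<sqsubseteq> p"
  obtains r f where "r \<sqsubseteq> q" "name f" "fbij r f X Y"
proof -
  obtain r f where "r \<sqsubseteq> q" "name f" "r \<tturnstile> bijection_fm f X Y"
    using assms(1)[unfolded eqpoll_fm_def] assms(4) by (rule forces_ExistsE)
  then show ?thesis using that assms forces_bijection by blast
qed

lemma finj_mono: "finj p f X Y \<Longrightarrow> q \<sqsubseteq> p \<Longrightarrow> finj q f X Y"
  unfolding finj_def by (intro conjI; meson below_trans)

lemma fbij_mono: "fbij p f X Y \<Longrightarrow> q \<sqsubseteq> p \<Longrightarrow> fbij q f X Y"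
  unfolding fbij_def by (intro conjI; meson below_trans finj_mono)

lemma finj_total:
  assumes "finj p f X Y" "q \<sqsubseteq> p" "name x" "fmem q x X"
  obtains r y where "r \<sqsubseteq> q" "name y" "fmem r (opn x y) f"
  using assms unfolding finj_def by meson

lemma finj_fun:
  assumes "finj p f X Y" "q \<sqsubseteq> p" "name x" "name y" "name y'"
    "fmem q (opn x y) f" "fmem q (opn x y') f"
  shows "feq q y y'"
  using assms unfolding finj_def by meson

lemma finj_inj:
  assumes "finj p f X Y" "q \<sqsubseteq> p" "name x" "name x'" "name y"
    "fmem q (opn x y) f" "fmem q (opn x' y) f"
  shows "feq q x x'"
  using assms unfolding finj_def by meson

lemma finj_in:
  assumes "finj p f X Y" "q \<sqsubseteq> p" "name x" "name y" "fmem q (opn x y) f"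
  shows "fmem q x X" "fmem q y Y"
proof -
  have *: "\<exists>r. r \<sqsubseteq> q' \<and> fmem r x X \<and> fmem r y Y" if q': "q' \<sqsubseteq> q" for q'
  proof -
    have "q' \<sqsubseteq> p" "fmem q' (opn x y) f" using q' assms below_trans fmem_mono by blast+
    then obtain r x' y' where "r \<sqsubseteq> q'" "fmem r x' X" "fmem r y' Y" "feq r (opn x y) (opn x' y')"
      using assms name_opn unfolding finj_def by meson
    then show ?thesis using opn_inject1 opn_inject2 feq_sym fmem_cong1 by meson
  qed
  show "fmem q x X" "fmem q y Y" by (rule fmem_dense; use * in blast)+
qed

lemma fbij_surj:
  assumes "fbij p f X Y" "q \<sqsubseteq> p" "name y" "fmem q y Y"
  obtains r x where "r \<sqsubseteq> q" "name x" "fmem r (opn x y) f"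
  using assms unfolding fbij_def by meson

lemma fbij_finj: "fbij p f X Y \<Longrightarrow> finj p f X Y"
  unfolding fbij_def by blast

lemma finj_cong2:
  assumes "finj p f X Y" "feq p Y Y'"
  shows "finj p f X Y'"
proof -
  have *: "q \<sqsubseteq> p \<Longrightarrow> fmem q y Y \<longleftrightarrow> fmem q y Y'" for q y
    using assms(2) feq_mono fmem_cong2 feq_sym by meson
  then show ?thesis using assms(1) below_trans unfolding finj_def by meson
qed

lemma fbij_cong2:
  assumes "fbij p f X Y" "feq p Y Y'"
  shows "fbij p f X Y'"
proof -
  have *: "q \<sqsubseteq> p \<Longrightarrow> fmem q y Y \<longleftrightarrow> fmem q y Y'" for q y
    using assms(2) feq_mono fmem_cong2 feq_sym by meson
  then show ?thesis using assms finj_cong2 unfolding fbij_def by meson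
qed

section \<open>Names of functions given by a relation on names and conditions\<close>

definition fun_name :: "'v set \<Rightarrow> 'v set \<Rightarrow> ('v \<Rightarrow> 'v \<Rightarrow> 'v \<Rightarrow> bool) \<Rightarrow> 'v" where
  "fun_name N1 N2 R =
     vset {vpair (opn x y) s | x y s. x \<in> N1 \<and> y \<in> N2 \<and> s \<in> elts P \<and> R x y s}"

lemma elts_fun_name:
  assumes "small N1" "small N2"
  shows "elts (fun_name N1 N2 R) =
    {vpair (opn x y) s | x y s. x \<in> N1 \<and> y \<in> N2 \<and> s \<in> elts P \<and> R x y s}"
proof -
  have "small {vpair (opn x y) s | x y s. x \<in> N1 \<and> y \<in> N2 \<and> s \<in> elts P \<and> R x y s}"
    by (rule small_subset[OF small_triples[OF assms small_elts[of P], of "\<lambda>x y s. vpair (opn x y) s"]]) blast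
  then show ?thesis unfolding fun_name_def by (rule elts_vset_small)
qed

lemma name_fun_name:
  assumes "small N1" "small N2" "\<And>x. x \<in> N1 \<Longrightarrow> name x" "\<And>x. x \<in> N2 \<Longrightarrow> name x"
  shows "name (fun_name N1 N2 R)"
  by (rule nameI) (use assms in \<open>auto simp: elts_fun_name\<close>)

lemma fmem_fun_nameI:
  assumes "small N1" "small N2" "x \<in> N1" "y \<in> N2" "R x y s" "r \<sqsubseteq> s"
  shows "fmem r (opn x y) (fun_name N1 N2 R)"
  by (rule fmem_elt[of _ s]) (use assms below_P in \<open>auto simp: elts_fun_name\<close>)

lemma fmem_fun_nameE:
  assumes "small N1" "small N2" "fmem q z (fun_name N1 N2 R)" "q \<in> elts P"
  obtains r x y s where "r \<sqsubseteq> q" "r \<sqsubseteq> s" "x \<in> N1" "y \<in> N2" "R x y s" "feq r z (opn x y)"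
proof -
  obtain r \<tau> t where "r \<sqsubseteq> q" "vpair \<tau> t \<in> elts (fun_name N1 N2 R)" "r \<sqsubseteq> t" "feq r z \<tau>"
    using fmemE assms by metis
  then show ?thesis using that by (auto simp: elts_fun_name assms)
qed

text \<open>Distinct names in \<open>N1\<close> or \<open>N2\<close> may be forced equal, so
  \<open>func\<close> and \<open>inj\<close> are demanded up to forced equality and not merely for
  identical names.\<close>

lemma finj_fun_name:
  assumes small: "small N1" "small N2"
    and names: "\<And>x. x \<in> N1 \<Longrightarrow> name x" "\<And>x. x \<in> N2 \<Longrightarrow> name x"
    and dom: "\<And>x y s q. x \<in> N1 \<Longrightarrow> y \<in> N2 \<Longrightarrow> R x y s \<Longrightarrow> q \<sqsubseteq> s \<Longrightarrow> q \<sqsubseteq> p \<Longrightarrow> fmem q x X \<and> fmem q y Y"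
    and tot: "\<And>x q. name x \<Longrightarrow> q \<sqsubseteq> p \<Longrightarrow> fmem q x X \<Longrightarrow>
        \<exists>r x' y s. r \<sqsubseteq> q \<and> r \<sqsubseteq> s \<and> x' \<in> N1 \<and> y \<in> N2 \<and> R x' y s \<and> feq r x x'"
    and func: "\<And>x y s x' y' s' q. x \<in> N1 \<Longrightarrow> y \<in> N2 \<Longrightarrow> x' \<in> N1 \<Longrightarrow> y' \<in> N2 \<Longrightarrow> R x y s \<Longrightarrow> R x' y' s' \<Longrightarrow>
        q \<sqsubseteq> p \<Longrightarrow> q \<sqsubseteq> s \<Longrightarrow> q \<sqsubseteq> s' \<Longrightarrow> feq q x x' \<Longrightarrow> feq q y y'"
    and inj: "\<And>x y s x' y' s' q. x \<in> N1 \<Longrightarrow> y \<in> N2 \<Longrightarrow> x' \<in> N1 \<Longrightarrow> y' \<in> N2 \<Longrightarrow> R x y s \<Longrightarrow> R x' y' s' \<Longrightarrow>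
        q \<sqsubseteq> p \<Longrightarrow> q \<sqsubseteq> s \<Longrightarrow> q \<sqsubseteq> s' \<Longrightarrow> feq q y y' \<Longrightarrow> feq q x x'"
  shows "finj p (fun_name N1 N2 R) X Y"
proof -
  let ?F = "fun_name N1 N2 R"
  \<comment> \<open>Two memberships in the named relation are resolved below one common extension,
    so that \<open>func\<close> and \<open>inj\<close> can compare the resulting entries.\<close>
  have two: "\<exists>r x1 y1 s1 x2 y2 s2. r \<sqsubseteq> q \<and> r \<sqsubseteq> s1 \<and> r \<sqsubseteq> s2 \<and> x1 \<in> N1 \<and> y1 \<in> N2 \<and> R x1 y1 s1 \<and>
       x2 \<in> N1 \<and> y2 \<in> N2 \<and> R x2 y2 s2 \<and> feq r x x1 \<and> feq r y y1 \<and> feq r x' x2 \<and> feq r y' y2"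
    if F: "fmem q (opn x y) ?F" "fmem q (opn x' y') ?F" and q: "q \<in> elts P" for q x y x' y'
  proof -
    obtain r1 x1 y1 s1 where 1: "r1 \<sqsubseteq> q" "r1 \<sqsubseteq> s1" "x1 \<in> N1" "y1 \<in> N2" "R x1 y1 s1"
      "feq r1 (opn x y) (opn x1 y1)"
      using fmem_fun_nameE[OF small F(1) q] by metis
    have "fmem r1 (opn x' y') ?F" "r1 \<in> elts P" using F 1(1) fmem_mono below_P by blast+
    then obtain r2 x2 y2 s2 where 2: "r2 \<sqsubseteq> r1" "r2 \<sqsubseteq> s2" "x2 \<in> N1" "y2 \<in> N2" "R x2 y2 s2"
      "feq r2 (opn x' y') (opn x2 y2)"
      using fmem_fun_nameE[OF small] by metis
    have "r2 \<sqsubseteq> q" "r2 \<sqsubseteq> s1" "feq r2 (opn x y) (opn x1 y1)"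
      using 1 2 below_trans feq_mono by blast+
    then show ?thesis using 1 2 opn_inject1 opn_inject2 by meson
  qed
  show ?thesis
    unfolding finj_def
  proof (intro conjI allI impI)
    fix q z assume q: "q \<sqsubseteq> p" "name z" "fmem q z ?F"
    then obtain r x y s where r: "r \<sqsubseteq> q" "r \<sqsubseteq> s" "x \<in> N1" "y \<in> N2" "R x y s" "feq r z (opn x y)"
      using fmem_fun_nameE[OF small] below_P by metis
    then have "fmem r x X \<and> fmem r y Y" using dom q(1) below_trans by blast
    then show "\<exists>r x y. r \<sqsubseteq> q \<and> name x \<and> name y \<and> fmem r x X \<and> fmem r y Y \<and> feq r z (opn x y)"
      using r names by blast
  next
    fix q x assume "q \<sqsubseteq> p" "name x" "fmem q x X"
    then obtain r x' y s where r: "r \<sqsubseteq> q" "r \<sqsubseteq> s" "x' \<in> N1" "y \<in> N2" "R x' y s" "feq r x x'"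
      using tot by blast
    have "fmem r (opn x' y) ?F" using r by (intro fmem_fun_nameI[OF small])
    moreover have "feq r (opn x' y) (opn x y)" using r opn_cong feq_sym feq_refl by blast
    ultimately show "\<exists>r y. r \<sqsubseteq> q \<and> name y \<and> fmem r (opn x y) ?F"
      using r names fmem_cong1 by blast
  next
    fix q x y y' assume q: "q \<sqsubseteq> p" "fmem q (opn x y) ?F" "fmem q (opn x y') ?F"
    show "feq q y y'"
    proof (rule feq_dense)
      fix q' assume q': "q' \<sqsubseteq> q"
      then have "fmem q' (opn x y) ?F" "fmem q' (opn x y') ?F" "q' \<in> elts P"
        using q fmem_mono below_P by blast+
      then obtain r x1 y1 s1 x2 y2 s2 where r: "r \<sqsubseteq> q'" "r \<sqsubseteq> s1" "r \<sqsubseteq> s2" "x1 \<in> N1" "y1 \<in> N2"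
        "R x1 y1 s1" "x2 \<in> N1" "y2 \<in> N2" "R x2 y2 s2" "feq r x x1" "feq r y y1" "feq r x x2" "feq r y' y2"
        using two by meson
      have "feq r x1 x2" using r feq_sym feq_trans by blast
      moreover have "r \<sqsubseteq> p" using r q' q below_trans by blast
      ultimately have "feq r y1 y2"
        using func[OF r(4,5,7,8,6,9)] r by blast
      then show "\<exists>r. r \<sqsubseteq> q' \<and> feq r y y'" using r feq_sym feq_trans by meson
    qed
  next
    fix q x x' y assume q: "q \<sqsubseteq> p" "fmem q (opn x y) ?F" "fmem q (opn x' y) ?F"
    show "feq q x x'"
    proof (rule feq_dense)
      fix q' assume q': "q' \<sqsubseteq> q"
      then have "fmem q' (opn x y) ?F" "fmem q' (opn x' y) ?F" "q' \<in> elts P"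
        using q fmem_mono below_P by blast+
      then obtain r x1 y1 s1 x2 y2 s2 where r: "r \<sqsubseteq> q'" "r \<sqsubseteq> s1" "r \<sqsubseteq> s2" "x1 \<in> N1" "y1 \<in> N2"
        "R x1 y1 s1" "x2 \<in> N1" "y2 \<in> N2" "R x2 y2 s2" "feq r x x1" "feq r y y1" "feq r x' x2" "feq r y y2"
        using two by meson
      have "feq r y1 y2" using r feq_sym feq_trans by blast
      moreover have "r \<sqsubseteq> p" using r q' q below_trans by blast
      ultimately have "feq r x1 x2"
        using inj[OF r(4,5,7,8,6,9)] r by blast
      then show "\<exists>r. r \<sqsubseteq> q' \<and> feq r x x'" using r feq_sym feq_trans by meson
    qed
  qed
qed

lemma fbij_fun_name:
  assumes "finj p (fun_name N1 N2 R) X Y"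
    and small: "small N1" "small N2"
    and names: "\<And>x. x \<in> N1 \<Longrightarrow> name x"
    and surj: "\<And>y q. name y \<Longrightarrow> q \<sqsubseteq> p \<Longrightarrow> fmem q y Y \<Longrightarrow>
        \<exists>r x y' s. r \<sqsubseteq> q \<and> r \<sqsubseteq> s \<and> x \<in> N1 \<and> y' \<in> N2 \<and> R x y' s \<and> feq r y y'"
  shows "fbij p (fun_name N1 N2 R) X Y"
  unfolding fbij_def
proof (intro conjI allI impI)
  fix q y assume "q \<sqsubseteq> p" "name y" "fmem q y Y"
  then obtain r x y' s where r: "r \<sqsubseteq> q" "r \<sqsubseteq> s" "x \<in> N1" "y' \<in> N2" "R x y' s" "feq r y y'"
    using surj by blast
  have "fmem r (opn x y') (fun_name N1 N2 R)" using r by (intro fmem_fun_nameI[OF small])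
  moreover have "feq r (opn x y') (opn x y)" using r opn_cong feq_sym feq_refl by blast
  ultimately show "\<exists>r x. r \<sqsubseteq> q \<and> name x \<and> fmem r (opn x y) (fun_name N1 N2 R)"
    using r names fmem_cong1 by blast
qed (rule assms)

lemma small_dom: "small {\<sigma>. \<exists>s. vpair \<sigma> s \<in> elts x}"
proof -
  have "{\<sigma>. \<exists>s. vpair \<sigma> s \<in> elts x} \<subseteq> (\<lambda>z. SOME \<sigma>. \<exists>s. z = vpair \<sigma> s) ` elts x"
  proof
    fix \<sigma> assume "\<sigma> \<in> {\<sigma>. \<exists>s. vpair \<sigma> s \<in> elts x}"
    then obtain s where s: "vpair \<sigma> s \<in> elts x" by blast
    have "(SOME \<sigma>'. \<exists>s'. vpair \<sigma> s = vpair \<sigma>' s') = \<sigma>" by (rule some_equality) auto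
    then show "\<sigma> \<in> (\<lambda>z. SOME \<sigma>. \<exists>s. z = vpair \<sigma> s) ` elts x" using s by (intro image_eqI) auto
  qed
  then show ?thesis using small_subset small_image small_elts by meson
qed

text \<open>The bijection is \<open>f\<close> followed by the inverse of \<open>g\<close>:
  \<open>R\<close> relates \<open>x\<close> and \<open>y\<close> at \<open>s\<close> when
  \<open>s\<close> forces a common value \<open>z\<close>. Only names occurring in \<open>X\<close>
  and \<open>Y\<close> enter, which keeps the relation a set.\<close>

lemma fbij_compose_converse:
  assumes n: "name X" "name Y" "name f" "name g" and p: "p \<in> elts P"
    and f: "fbij p f X Z" and g: "fbij p g Y Z"
  shows "p \<tturnstile> eqpoll_fm X Y"
proof -
  define N1 where "N1 = {\<sigma>. \<exists>s. vpair \<sigma> s \<in> elts X}"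
  define N2 where "N2 = {\<sigma>. \<exists>s. vpair \<sigma> s \<in> elts Y}"
  define R where "R = (\<lambda>x y s. \<exists>z. name z \<and> fmem s (opn x z) f \<and> fmem s (opn y z) g)"
  have small: "small N1" "small N2" unfolding N1_def N2_def by (rule small_dom)+
  have n1: "x \<in> N1 \<Longrightarrow> name x" for x unfolding N1_def using n name_elt by blast
  have n2: "x \<in> N2 \<Longrightarrow> name x" for x unfolding N2_def using n name_elt by blast
  have fi: "finj p f X Z" and gi: "finj p g Y Z" using f g fbij_finj by blast+
  \<comment> \<open>Arbitrary names with a common value are replaced, below a further condition, by
    related members of \<open>N1\<close> and \<open>N2\<close>; totality and surjectivity both
    reduce to this.\<close>
  have close: "\<exists>r x' y' s. r \<sqsubseteq> q \<and> r \<sqsubseteq> s \<and> x' \<in> N1 \<and> y' \<in> N2 \<and> R x' y' s \<and> feq r x x' \<and> feq r y y'"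
    if a: "q \<sqsubseteq> p" "name x" "name y" "name z" "fmem q (opn x z) f" "fmem q (opn y z) g" for q x y z
  proof -
    have "fmem q x X" "fmem q y Y" using finj_in fi gi a by blast+
    then obtain r x' t where r: "r \<sqsubseteq> q" "vpair x' t \<in> elts X" "feq r x x'"
      using fmemE a(1) below_P by metis
    have "fmem r y Y" "r \<in> elts P" using r \<open>fmem q y Y\<close> fmem_mono below_P by blast+
    then obtain r' y' t' where r': "r' \<sqsubseteq> r" "vpair y' t' \<in> elts Y" "feq r' y y'"
      using fmemE by metis
    have "feq r' (opn x z) (opn x' z)" "feq r' (opn y z) (opn y' z)"
      using r r' opn_cong feq_mono feq_refl by blast+
    moreover have "fmem r' (opn x z) f" "fmem r' (opn y z) g"
      using a r r' fmem_mono by blast+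
    ultimately have "R x' y' r'" unfolding R_def using a fmem_cong1 by blast
    moreover have "x' \<in> N1" "y' \<in> N2" unfolding N1_def N2_def using r r' by blast+
    ultimately show ?thesis using r r' below_trans below_self feq_mono by meson
  qed
  have "finj p (fun_name N1 N2 R) X Y"
  proof (rule finj_fun_name[OF small n1 n2])
    fix x y s q assume "x \<in> N1" "y \<in> N2" "R x y s" "q \<sqsubseteq> s" "q \<sqsubseteq> p"
    then show "fmem q x X \<and> fmem q y Y"
      unfolding R_def using finj_in fi gi n1 n2 fmem_mono by meson
  next
    fix x q assume x: "name x" "q \<sqsubseteq> p" "fmem q x X"
    then obtain r z where r: "r \<sqsubseteq> q" "name z" "fmem r (opn x z) f"
      using finj_total fi by metis
    then have "fmem r z Z" "r \<sqsubseteq> p" using finj_in fi x below_trans by blast+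
    then obtain r' y where r': "r' \<sqsubseteq> r" "name y" "fmem r' (opn y z) g"
      using fbij_surj g r(2) by metis
    have "r' \<sqsubseteq> p" "fmem r' (opn x z) f" using r r' x below_trans fmem_mono by blast+
    then obtain r'' x' y' s where "r'' \<sqsubseteq> r'" "r'' \<sqsubseteq> s" "x' \<in> N1" "y' \<in> N2" "R x' y' s" "feq r'' x x'"
      using close x(1) r' r(2) by meson
    then show "\<exists>r x' y s. r \<sqsubseteq> q \<and> r \<sqsubseteq> s \<and> x' \<in> N1 \<and> y \<in> N2 \<and> R x' y s \<and> feq r x x'"
      using r r' below_trans by meson
  next
    fix x y s x' y' s' q
    assume N: "x \<in> N1" "y \<in> N2" "x' \<in> N1" "y' \<in> N2" and R: "R x y s" "R x' y' s'"
      and q: "q \<sqsubseteq> p" "q \<sqsubseteq> s" "q \<sqsubseteq> s'"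
    obtain z z' where z: "name z" "fmem q (opn x z) f" "fmem q (opn y z) g"
      "name z'" "fmem q (opn x' z') f" "fmem q (opn y' z') g"
      using R q fmem_mono unfolding R_def by meson
    note nm = n1[OF N(1)] n2[OF N(2)] n1[OF N(3)] n2[OF N(4)]
    show "feq q y y'" if "feq q x x'"
    proof -
      have "fmem q (opn x z') f" using z(5) that opn_cong feq_sym feq_refl fmem_cong1 by meson
      then have "feq q z z'" using finj_fun fi q(1) nm z by blast
      then have "fmem q (opn y z') g" using z(3) opn_cong feq_refl fmem_cong1 by meson
      then show ?thesis using finj_inj gi q(1) nm z by blast
    qed
    show "feq q x x'" if "feq q y y'"
    proof -
      have "fmem q (opn y z') g" using z(6) that opn_cong feq_sym feq_refl fmem_cong1 by meson
      then have "feq q z z'" using finj_fun gi q(1) nm z by blast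
      then have "fmem q (opn x z') f" using z(2) opn_cong feq_refl fmem_cong1 by meson
      then show ?thesis using finj_inj fi q(1) nm z by blast
    qed
  qed
  then have "fbij p (fun_name N1 N2 R) X Y"
  proof (rule fbij_fun_name[OF _ small n1])
    fix y q assume x: "name y" "q \<sqsubseteq> p" "fmem q y Y"
    then obtain r z where r: "r \<sqsubseteq> q" "name z" "fmem r (opn y z) g"
      using finj_total gi by metis
    then have "fmem r z Z" "r \<sqsubseteq> p" using finj_in gi x below_trans by blast+
    then obtain r' w where r': "r' \<sqsubseteq> r" "name w" "fmem r' (opn w z) f"
      using fbij_surj f r(2) by metis
    have "r' \<sqsubseteq> p" "fmem r' (opn y z) g" using r r' x below_trans fmem_mono by blast+
    then obtain r'' x' y' s where "r'' \<sqsubseteq> r'" "r'' \<sqsubseteq> s" "x' \<in> N1" "y' \<in> N2" "R x' y' s" "feq r'' y y'"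
      using close x(1) r' r(2) by meson
    then show "\<exists>r x y' s. r \<sqsubseteq> q \<and> r \<sqsubseteq> s \<and> x \<in> N1 \<and> y' \<in> N2 \<and> R x y' s \<and> feq r y y'"
      using r r' below_trans by meson
  qed
  then show ?thesis
    using forces_eqpollI name_fun_name[OF small n1 n2] n by blast
qed

section \<open>Ordinals in the extension\<close>

text \<open>Foundation in the extension: if \<open>a\<close> is forced into itself, some \<tau>
  occurring in \<open>a\<close> is forced equal to \<open>a\<close>, hence is forced into itself as
  well, and \<tau> is of smaller rank as a name.\<close>

lemma fmem_irrefl: "p \<in> elts P \<Longrightarrow> \<not> fmem p a a"
proof (induction a arbitrary: p rule: name_induct)
  case (step a)
  show ?case
  proof
    assume "fmem p a a"
    then obtain q \<tau> t where q: "q \<sqsubseteq> p" "vpair \<tau> t \<in> elts a" "q \<sqsubseteq> t" "feq q a \<tau>"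
      using fmemE step.prems by metis
    then have "fmem q \<tau> \<tau>" using fmem_elt fmem_cong2 by blast
    then show False using step.IH q below_P by blast
  qed
qed

definition ftrans :: "'v \<Rightarrow> 'v \<Rightarrow> bool" where
  "ftrans p x \<longleftrightarrow> (\<forall>q y z. q \<sqsubseteq> p \<longrightarrow> name y \<longrightarrow> name z \<longrightarrow> fmem q y x \<longrightarrow> fmem q z y \<longrightarrow> fmem q z x)"

lemma forces_transset: "p \<tturnstile> transset_fm x \<longleftrightarrow> ftrans p x"
proof -
  have "p \<tturnstile> transset_fm x \<longleftrightarrow> (\<forall>y. name y \<longrightarrow> (\<forall>q. q \<sqsubseteq> p \<longrightarrow> fmem q y x \<longrightarrow>
      (\<forall>z r. name z \<longrightarrow> r \<sqsubseteq> q \<longrightarrow> fmem r z y \<longrightarrow> fmem r z x)))"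
    unfolding transset_fm_def by simp
  also have "\<dots> \<longleftrightarrow> ftrans p x"
    unfolding ftrans_def by (meson below_self below_trans fmem_mono)
  finally show ?thesis .
qed

lemma ftrans_dense:
  assumes "\<And>r. r \<sqsubseteq> p \<Longrightarrow> \<exists>q. q \<sqsubseteq> r \<and> ftrans q x"
  shows "ftrans p x"
  using assms forces_dense[of p "transset_fm x"] unfolding forces_transset by blast

lemma ftrans_cong: "ftrans p x \<Longrightarrow> feq p x x' \<Longrightarrow> ftrans p x'"
  unfolding ftrans_def by (meson feq_mono feq_sym fmem_cong2)

definition ford :: "'v \<Rightarrow> 'v \<Rightarrow> bool" where
  "ford p x \<longleftrightarrow> ftrans p x \<and> (\<forall>q y. q \<sqsubseteq> p \<longrightarrow> name y \<longrightarrow> fmem q y x \<longrightarrow> ftrans q y)"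

lemma forces_ord: "p \<tturnstile> ord_fm x \<longleftrightarrow> ford p x"
  unfolding ord_fm_def ford_def by (auto simp: forces_transset)

lemma ford_mono: "ford p x \<Longrightarrow> q \<sqsubseteq> p \<Longrightarrow> ford q x"
  using forces_mono[of p "ord_fm x"] unfolding forces_ord by blast

lemma ford_elt:
  assumes "ford p x" "name y" "fmem p y x" "p \<in> elts P"
  shows "ford p y"
  unfolding ford_def
proof (intro conjI allI impI)
  show "ftrans p y" using assms below_refl unfolding ford_def by blast
  fix q z assume z: "q \<sqsubseteq> p" "name z" "fmem q z y"
  have "ftrans p x" using assms(1) unfolding ford_def by blast
  moreover have "fmem q y x" using assms(3) z(1) by (rule fmem_mono)
  ultimately have "fmem q z x"
    using z assms(2) unfolding ftrans_def by blast
  then show "ftrans q z" using assms z unfolding ford_def by blast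
qed

lemma ftrans_ck:
  assumes "Ord \<alpha>"
  shows "ftrans p (ck \<alpha>)"
  unfolding ftrans_def
proof (intro allI impI, rule fmem_dense)
  fix q y z r assume *: "q \<sqsubseteq> p" "fmem q y (ck \<alpha>)" "fmem q z y" "r \<sqsubseteq> q"
  then have "fmem r y (ck \<alpha>)" "r \<in> elts P" using fmem_mono below_P by blast+
  then obtain r1 \<beta> where 1: "r1 \<sqsubseteq> r" "\<beta> \<in> elts \<alpha>" "feq r1 y (ck \<beta>)"
    using fmem_ckE by metis
  then have "fmem r1 z (ck \<beta>)" "r1 \<in> elts P" using * fmem_mono fmem_cong2 below_P by meson+
  then obtain r2 \<gamma> where 2: "r2 \<sqsubseteq> r1" "\<gamma> \<in> elts \<beta>" "feq r2 z (ck \<gamma>)"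
    using fmem_ckE by metis
  have "\<gamma> \<in> elts \<alpha>" using Ord_trans assms 1 2 by blast
  then have "fmem r2 z (ck \<alpha>)" using 2 fmem_ckI fmem_cong1 feq_sym below_P by meson
  then show "\<exists>q. q \<sqsubseteq> r \<and> fmem q z (ck \<alpha>)" using 1 2 below_trans by blast
qed

lemma ford_ck:
  assumes "Ord \<alpha>"
  shows "ford p (ck \<alpha>)"
  unfolding ford_def
proof (intro conjI allI impI)
  show "ftrans p (ck \<alpha>)" using ftrans_ck assms by blast
  fix q y assume y: "q \<sqsubseteq> p" "name y" "fmem q y (ck \<alpha>)"
  show "ftrans q y"
  proof (rule ftrans_dense)
    fix r assume "r \<sqsubseteq> q"
    then have "fmem r y (ck \<alpha>)" "r \<in> elts P" using y fmem_mono below_P by blast+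
    then obtain r1 \<beta> where 1: "r1 \<sqsubseteq> r" "\<beta> \<in> elts \<alpha>" "feq r1 y (ck \<beta>)"
      using fmem_ckE by metis
    then show "\<exists>q. q \<sqsubseteq> r \<and> ftrans q y"
      using ftrans_ck Ord_elts assms ftrans_cong feq_sym by meson
  qed
qed

text \<open>A condition and a name occurring in \<sigma> determine at most one ordinal or set
  \<gamma> whose check name is forced equal to that name. All such \<gamma> therefore lie in the
  image of a product of two sets.\<close>

lemma small_check_members: "small {\<gamma>. \<exists>q. fmem q (ck \<gamma>) \<sigma> \<and> q \<in> elts P}"
proof -
  define N where "N = {\<tau>. \<exists>s. vpair \<tau> s \<in> elts \<sigma>}"
  have "{\<gamma>. \<exists>q. fmem q (ck \<gamma>) \<sigma> \<and> q \<in> elts P} \<subseteq>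
      {(THE \<gamma>. feq r (ck \<gamma>) \<tau>) | r \<tau>. r \<in> elts P \<and> \<tau> \<in> N}"
  proof
    fix \<gamma> assume "\<gamma> \<in> {\<gamma>. \<exists>q. fmem q (ck \<gamma>) \<sigma> \<and> q \<in> elts P}"
    then obtain q where "fmem q (ck \<gamma>) \<sigma>" "q \<in> elts P" by blast
    then obtain r \<tau> t where r: "r \<in> elts P" "vpair \<tau> t \<in> elts \<sigma>" "feq r (ck \<gamma>) \<tau>"
      using fmemE below_P by metis
    have "(THE \<gamma>. feq r (ck \<gamma>) \<tau>) = \<gamma>"
      by (rule the_equality) (use r feq_trans feq_sym feq_ck in blast)+
    then show "\<gamma> \<in> {(THE \<gamma>. feq r (ck \<gamma>) \<tau>) | r \<tau>. r \<in> elts P \<and> \<tau> \<in> N}"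
      using r unfolding N_def by blast
  qed
  moreover have "small N" unfolding N_def by (rule small_dom)
  ultimately show ?thesis
    using small_subset[OF small_pairs[OF small_elts[of P], of N "\<lambda>r \<tau>. THE \<gamma>. feq r (ck \<gamma>) \<tau>"]]
    by simp
qed

text \<open>Forcing adds no ordinals. The value of \<sigma> is the least \<gamma> that some
  condition below \<open>p\<close> forces out of \<sigma>: by minimality all smaller ordinals are
  forced in, and transitivity of \<sigma> excludes anything above \<gamma>.\<close>

lemma ford_is_check:
  "name \<sigma> \<Longrightarrow> p \<in> elts P \<Longrightarrow> ford p \<sigma> \<Longrightarrow> \<exists>q \<alpha>. q \<sqsubseteq> p \<and> Ord \<alpha> \<and> feq q \<sigma> (ck \<alpha>)"
proof (induction \<sigma> arbitrary: p rule: name_induct)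
  case (step \<sigma>)
  define Q where "Q = (\<lambda>\<gamma>. \<exists>r. r \<sqsubseteq> p \<and> (\<forall>q. q \<sqsubseteq> r \<longrightarrow> \<not> fmem q (ck \<gamma>) \<sigma>))"
  \<comment> \<open>The ordinals that some condition forces into \<sigma> form a set, so some
    ordinal escapes it; the search for a least \<gamma> has a starting point.\<close>
  obtain \<gamma>0 where "Ord \<gamma>0" "\<not> (\<exists>q. fmem q (ck \<gamma>0) \<sigma> \<and> q \<in> elts P)"
    using not_small_Ord small_subset[OF small_check_members[of \<sigma>], of "{\<gamma>. Ord \<gamma>}"] by blast
  then have "Q \<gamma>0" unfolding Q_def using step.prems(2) below_refl below_P by blast
  then obtain \<gamma> where \<gamma>: "Ord \<gamma>" "Q \<gamma>" "\<And>\<delta>. \<delta> \<in> elts \<gamma> \<Longrightarrow> \<not> Q \<delta>"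
    using Ord_least_exists[of \<gamma>0 Q] \<open>Ord \<gamma>0\<close> by blast
  obtain r where r: "r \<sqsubseteq> p" "\<And>q. q \<sqsubseteq> r \<Longrightarrow> \<not> fmem q (ck \<gamma>) \<sigma>"
    using \<gamma>(2) unfolding Q_def by blast
  have small: "fmem p (ck \<delta>) \<sigma>" if \<delta>: "\<delta> \<in> elts \<gamma>" for \<delta>
    by (rule fmem_dense) (use \<gamma>(3)[OF \<delta>] in \<open>unfold Q_def, blast\<close>)
  have "feq r \<sigma> (ck \<gamma>)"
  proof (rule feqI)
    fix q \<tau> s assume q: "vpair \<tau> s \<in> elts \<sigma>" "q \<sqsubseteq> r" "q \<sqsubseteq> s"
    have n: "name \<tau>" using q step.prems name_elt by blast
    show "fmem q \<tau> (ck \<gamma>)"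
    proof (rule fmem_dense)
      fix q1 assume q1: "q1 \<sqsubseteq> q"
      have m: "fmem q1 \<tau> \<sigma>" using q q1 fmem_elt below_trans by blast
      have q1p: "q1 \<sqsubseteq> p" using q1 q r below_trans by blast
      have "ford q1 \<sigma>" using q1p step.prems(3) ford_mono by blast
      then have "ford q1 \<tau>" using ford_elt n m q1 below_P by blast
      then obtain q2 \<alpha> where q2: "q2 \<sqsubseteq> q1" "Ord \<alpha>" "feq q2 \<tau> (ck \<alpha>)"
        using step.IH[OF q(1) n] q1 below_P by blast
      have q2r: "q2 \<sqsubseteq> r" using q2 q1 q below_trans by blast
      have m2: "fmem q2 (ck \<alpha>) \<sigma>" using m q2 fmem_mono fmem_cong1 by blast
      have P2: "q2 \<in> elts P" using q2 below_P by blast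
      have "\<alpha> \<noteq> \<gamma>" using r(2) q2r m2 by blast
      moreover have "\<gamma> \<notin> elts \<alpha>"
      proof
        assume "\<gamma> \<in> elts \<alpha>"
        then have "fmem q2 (ck \<gamma>) (ck \<alpha>)" using fmem_ckI P2 by blast
        moreover have "ftrans q2 \<sigma>"
          using step.prems(3) ford_mono q2r r(1) below_trans unfolding ford_def by blast
        ultimately have "fmem q2 (ck \<gamma>) \<sigma>"
          using m2 P2 below_refl name_ck unfolding ftrans_def by blast
        then show False using r(2) q2r by blast
      qed
      ultimately have "\<alpha> \<in> elts \<gamma>" using Ord_linear q2(2) \<gamma>(1) by blast
      then have "fmem q2 \<tau> (ck \<gamma>)" using fmem_ckI P2 q2(3) feq_sym fmem_cong1 by blast
      then show "\<exists>q'. q' \<sqsubseteq> q1 \<and> fmem q' \<tau> (ck \<gamma>)" using q2 by blast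
    qed
  next
    fix q \<tau> s assume q: "vpair \<tau> s \<in> elts (ck \<gamma>)" "q \<sqsubseteq> r"
    then obtain \<delta> where "\<delta> \<in> elts \<gamma>" "\<tau> = ck \<delta>" by (auto simp: elts_ck)
    then show "fmem q \<tau> \<sigma>" using small fmem_mono q(2) r(1) below_trans by blast
  qed
  then show ?case using r \<gamma> by blast
qed

end

section \<open>Cardinality of sets with few names\<close>

text \<open>A name for the order type of \<open>{\<beta> < \<alpha>. \<rho> \<beta>}\<close>, where \<open>\<rho> \<beta> s\<close> says that
  \<open>s\<close> forces \<open>\<beta>\<close> into the set.\<close>

function collapse :: "'a::zfc_universe \<Rightarrow> ('a \<Rightarrow> 'a \<Rightarrow> bool) \<Rightarrow> 'a \<Rightarrow> 'a" where
  "collapse P \<rho> \<alpha> = vset (\<Union>\<beta>\<in>elts \<alpha>. (\<lambda>s. vpair (collapse P \<rho> \<beta>) s) ` {s \<in> elts P. \<rho> \<beta> s})"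
  by pat_completeness auto
termination
  by (relation "inv_image {(x, y). x \<in> elts y} (\<lambda>(P, \<rho>, \<alpha>). \<alpha>)")
     (auto simp: foundation intro: wf_inv_image)

declare collapse.simps [simp del]

context forcing
begin

abbreviation coll :: "('v \<Rightarrow> 'v \<Rightarrow> bool) \<Rightarrow> 'v \<Rightarrow> 'v" where
  "coll \<equiv> collapse P"

lemma elts_coll:
  "elts (coll \<rho> \<alpha>) = (\<Union>\<beta>\<in>elts \<alpha>. (\<lambda>s. vpair (coll \<rho> \<beta>) s) ` {s \<in> elts P. \<rho> \<beta> s})"
proof -
  have "small (\<Union>\<beta>\<in>elts \<alpha>. (\<lambda>s. vpair (coll \<rho> \<beta>) s) ` {s \<in> elts P. \<rho> \<beta> s})"
    by (intro small_UN small_image small_elts small_subset[OF small_elts[of P]]) blast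
  then show ?thesis by (subst collapse.simps) simp
qed

lemma name_coll [simp]: "name (coll \<rho> \<alpha>)"
proof (induction \<alpha> rule: elts_induct)
  case (step \<alpha>)
  show ?case by (rule nameI) (use step in \<open>auto simp: elts_coll\<close>)
qed

lemma fmem_collI: "\<beta> \<in> elts \<alpha> \<Longrightarrow> \<rho> \<beta> q \<Longrightarrow> q \<in> elts P \<Longrightarrow> fmem q (coll \<rho> \<beta>) (coll \<rho> \<alpha>)"
  by (rule fmem_elt[of _ q]) (auto simp: elts_coll)

lemma fmem_collE:
  assumes "fmem p x (coll \<rho> \<alpha>)" "p \<in> elts P" "\<And>\<beta> s r. \<rho> \<beta> s \<Longrightarrow> r \<sqsubseteq> s \<Longrightarrow> \<rho> \<beta> r"
  obtains q \<beta> where "q \<sqsubseteq> p" "\<beta> \<in> elts \<alpha>" "\<rho> \<beta> q" "feq q x (coll \<rho> \<beta>)"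
proof -
  obtain q \<tau> t where "q \<sqsubseteq> p" "vpair \<tau> t \<in> elts (coll \<rho> \<alpha>)" "q \<sqsubseteq> t" "feq q x \<tau>"
    using fmemE assms(1,2) by metis
  then show ?thesis using that assms(3) by (auto simp: elts_coll)
qed

lemma ftrans_coll:
  assumes "Ord \<alpha>" and mono: "\<And>\<beta> s r. \<rho> \<beta> s \<Longrightarrow> r \<sqsubseteq> s \<Longrightarrow> \<rho> \<beta> r"
  shows "ftrans p (coll \<rho> \<alpha>)"
  unfolding ftrans_def
proof (intro allI impI, rule fmem_dense)
  fix q y z r assume *: "q \<sqsubseteq> p" "fmem q y (coll \<rho> \<alpha>)" "fmem q z y" "r \<sqsubseteq> q"
  then have "fmem r y (coll \<rho> \<alpha>)" "r \<in> elts P" using fmem_mono below_P by blast+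
  then obtain r1 \<beta> where 1: "r1 \<sqsubseteq> r" "\<beta> \<in> elts \<alpha>" "feq r1 y (coll \<rho> \<beta>)"
    using fmem_collE[where \<rho> = \<rho>] mono by metis
  then have "fmem r1 z (coll \<rho> \<beta>)" "r1 \<in> elts P" using * fmem_mono fmem_cong2 below_P by meson+
  then obtain r2 \<gamma> where 2: "r2 \<sqsubseteq> r1" "\<gamma> \<in> elts \<beta>" "\<rho> \<gamma> r2" "feq r2 z (coll \<rho> \<gamma>)"
    using fmem_collE[where \<rho> = \<rho>] mono by metis
  have "\<gamma> \<in> elts \<alpha>" using Ord_trans assms 1 2 by blast
  then have "fmem r2 z (coll \<rho> \<alpha>)" using 2 fmem_collI[of \<gamma> \<alpha> \<rho> r2] fmem_cong1 feq_sym below_P by meson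
  then show "\<exists>q. q \<sqsubseteq> r \<and> fmem q z (coll \<rho> \<alpha>)" using 1 2 below_trans by blast
qed

lemma ford_coll:
  assumes "Ord \<alpha>" and mono: "\<And>\<beta> s r. \<rho> \<beta> s \<Longrightarrow> r \<sqsubseteq> s \<Longrightarrow> \<rho> \<beta> r"
  shows "ford p (coll \<rho> \<alpha>)"
  unfolding ford_def
proof (intro conjI allI impI)
  show "ftrans p (coll \<rho> \<alpha>)" using ftrans_coll[where \<rho> = \<rho>] assms by blast
  fix q y assume y: "q \<sqsubseteq> p" "name y" "fmem q y (coll \<rho> \<alpha>)"
  show "ftrans q y"
  proof (rule ftrans_dense)
    fix r assume "r \<sqsubseteq> q"
    then have "fmem r y (coll \<rho> \<alpha>)" "r \<in> elts P" using y fmem_mono below_P by blast+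
    then obtain r1 \<beta> where 1: "r1 \<sqsubseteq> r" "\<beta> \<in> elts \<alpha>" "feq r1 y (coll \<rho> \<beta>)"
      using fmem_collE[where \<rho> = \<rho>] mono by metis
    then have "ftrans r1 (coll \<rho> \<beta>)" using ftrans_coll[where \<rho> = \<rho>] Ord_elts assms by blast
    then show "\<exists>q. q \<sqsubseteq> r \<and> ftrans q y"
      using 1 ftrans_cong feq_sym by meson
  qed
qed

text \<open>If one index were a member of the other, its collapse would be forced into the other
  collapse, and equality would force a set to be a member of itself.\<close>

lemma coll_inj:
  assumes "Ord \<alpha>" "Ord \<beta>" "\<rho> \<alpha> r" "\<rho> \<beta> r" "r \<in> elts P" "feq r (coll \<rho> \<alpha>) (coll \<rho> \<beta>)"
  shows "\<alpha> = \<beta>"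
proof -
  have "\<alpha> \<notin> elts \<beta>"
    using fmem_collI[of \<alpha> \<beta> \<rho> r] assms fmem_irrefl fmem_cong2 feq_sym by blast
  moreover have "\<beta> \<notin> elts \<alpha>"
    using fmem_collI[of \<beta> \<alpha> \<rho> r] assms fmem_irrefl fmem_cong2 by blast
  ultimately show ?thesis using Ord_linear assms by blast
qed

text \<open>An order type never exceeds the ordinal it is taken in. Were \<alpha> below \<theta>,
  the check name of \<alpha> would be forced equal to \<open>coll \<rho> \<beta>\<close> for some
  \<beta> in \<alpha>, against the induction hypothesis for \<beta> with \<alpha> in the place of
  \<theta>.\<close>

lemma coll_le:
  assumes mono: "\<And>\<beta> s r. \<rho> \<beta> s \<Longrightarrow> r \<sqsubseteq> s \<Longrightarrow> \<rho> \<beta> r"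
  shows "r \<in> elts P \<Longrightarrow> feq r (coll \<rho> \<alpha>) (ck \<theta>) \<Longrightarrow> \<alpha> \<notin> elts \<theta>"
proof (induction \<alpha> arbitrary: \<theta> r rule: elts_induct)
  case (step \<alpha>)
  show ?case
  proof
    assume "\<alpha> \<in> elts \<theta>"
    then have "fmem r (ck \<alpha>) (coll \<rho> \<alpha>)"
      using step.prems fmem_ckI fmem_cong2 feq_sym by blast
    then obtain q \<beta> where "q \<sqsubseteq> r" "\<beta> \<in> elts \<alpha>" "feq q (ck \<alpha>) (coll \<rho> \<beta>)"
      using fmem_collE[where \<rho> = \<rho>] mono step.prems(1) by metis
    then show False using step.IH feq_sym below_P by blast
  qed
qed

text \<open>Transfers a count of names in the ground model to a cardinality in the extension.
  Sending each member of \<open>X\<close> to the least index of a name for it is injective;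
  collapsing the indices that occur makes it a bijection with an ordinal.\<close>

lemma enumerated_name:
  assumes n: "name X" and small: "small N" and names: "\<And>A. A \<in> N \<Longrightarrow> name A"
    and e: "inj_on e N" "\<And>A. A \<in> N \<Longrightarrow> e A \<in> elts \<nu>" and \<nu>: "Ord \<nu>"
    and p: "p \<in> elts P"
    and cover: "\<And>x q. name x \<Longrightarrow> q \<sqsubseteq> p \<Longrightarrow> fmem q x X \<Longrightarrow> \<exists>r A. r \<sqsubseteq> q \<and> A \<in> N \<and> feq r x A"
  shows "p \<tturnstile> lepoll_fm X (ck \<nu>)"
    and "\<exists>q \<theta>. q \<sqsubseteq> p \<and> Ord \<theta> \<and> (\<theta> \<in> elts \<nu> \<or> \<theta> = \<nu>) \<and> q \<tturnstile> eqpoll_fm X (ck \<theta>)"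
proof -
  \<comment> \<open>\<open>first A s\<close>: \<open>s\<close> forces \<open>A\<close> into
    \<open>X\<close>, and no extension of \<open>s\<close> identifies \<open>A\<close> with a name
    of smaller index.\<close>
  define first where "first = (\<lambda>A s. fmem s A X \<and> (\<forall>B r. B \<in> N \<longrightarrow> e B \<in> elts (e A) \<longrightarrow> r \<sqsubseteq> s \<longrightarrow> \<not> feq r A B))"
  have oe: "A \<in> N \<Longrightarrow> Ord (e A)" for A using e(2) \<nu> Ord_elts by blast
  have first_mono: "first A s \<Longrightarrow> r \<sqsubseteq> s \<Longrightarrow> first A r" for A r s
    unfolding first_def using fmem_mono below_trans by blast
  have first_ex: "\<exists>r A. r \<sqsubseteq> q \<and> A \<in> N \<and> first A r \<and> feq r x A"
    if x: "name x" "q \<sqsubseteq> p" "fmem q x X" for x q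
  proof -
    define Q where "Q = (\<lambda>\<alpha>. \<exists>A r. A \<in> N \<and> e A = \<alpha> \<and> r \<sqsubseteq> q \<and> feq r x A)"
    obtain r A where "r \<sqsubseteq> q" "A \<in> N" "feq r x A" using cover x by blast
    then have "Q (e A)" "Ord (e A)" unfolding Q_def using oe by blast+
    then obtain \<alpha> where \<alpha>: "Q \<alpha>" "\<And>\<gamma>. \<gamma> \<in> elts \<alpha> \<Longrightarrow> \<not> Q \<gamma>"
      using Ord_least_exists[of "e A" Q] by blast
    then obtain B r where B: "B \<in> N" "e B = \<alpha>" "r \<sqsubseteq> q" "feq r x B" unfolding Q_def by blast
    have "first B r"
      unfolding first_def
    proof (intro conjI allI impI notI)
      show "fmem r B X" using x B fmem_mono fmem_cong1 by blast
      fix C r' assume C: "C \<in> N" "e C \<in> elts (e B)" "r' \<sqsubseteq> r" "feq r' B C"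
      then have "Q (e C)" unfolding Q_def using B feq_mono feq_trans below_trans by blast
      then show False using \<alpha> C B by blast
    qed
    then show ?thesis using B by blast
  qed
  have first_unique: "A = B" if "A \<in> N" "B \<in> N" "first A s" "first B s'" "q \<sqsubseteq> s" "q \<sqsubseteq> s'" "feq q A B" for A B s s' q
  proof -
    have "e A \<notin> elts (e B)" using that feq_sym unfolding first_def by blast
    moreover have "e B \<notin> elts (e A)" using that unfolding first_def by blast
    ultimately have "e A = e B" using Ord_linear oe that by blast
    then show ?thesis using e(1) that by (blast dest: inj_onD)
  qed
  \<comment> \<open>The relabelling \<open>k\<close> of indices is left free because it is used
    twice: with check names for the injection into \<nu>, and with collapsed names for the
    bijection.\<close>
  have inj: "finj p (fun_name N (k ` elts \<nu>) (\<lambda>x y s. y = k (e x) \<and> first x s)) X Y"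
    if k: "\<And>\<alpha>. name (k \<alpha>)" and Y: "\<And>A s. A \<in> N \<Longrightarrow> first A s \<Longrightarrow> s \<in> elts P \<Longrightarrow> fmem s (k (e A)) Y"
      and kinj: "\<And>A B s. A \<in> N \<Longrightarrow> B \<in> N \<Longrightarrow> first A s \<Longrightarrow> first B s \<Longrightarrow> s \<in> elts P \<Longrightarrow>
          feq s (k (e A)) (k (e B)) \<Longrightarrow> e A = e B" for k Y
  proof (rule finj_fun_name[OF small small_image[OF small_elts] names])
    show "x \<in> k ` elts \<nu> \<Longrightarrow> name x" for x using k by blast
    fix x y s q assume a: "x \<in> N" "y = k (e x) \<and> first x s" "q \<sqsubseteq> s"
    then have "first x q" "q \<in> elts P" using first_mono below_P by blast+
    then show "fmem q x X \<and> fmem q y Y" using a Y unfolding first_def by blast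
  next
    fix x q assume "name x" "q \<sqsubseteq> p" "fmem q x X"
    then obtain r A where "r \<sqsubseteq> q" "A \<in> N" "first A r" "feq r x A" using first_ex by blast
    then show "\<exists>r x' y s. r \<sqsubseteq> q \<and> r \<sqsubseteq> s \<and> x' \<in> N \<and> y \<in> k ` elts \<nu> \<and> (y = k (e x') \<and> first x' s) \<and> feq r x x'"
      using e(2) below_self by blast
  next
    fix x y s x' y' s' q
    assume a: "x \<in> N" "x' \<in> N" "y = k (e x) \<and> first x s" "y' = k (e x') \<and> first x' s'"
      "q \<sqsubseteq> s" "q \<sqsubseteq> s'"
    show "feq q y y'" if "feq q x x'"
    proof -
      have "x = x'" using first_unique a that by blast
      then show ?thesis using a by simp
    qed
    show "feq q x x'" if "feq q y y'"
    proof -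
      have "first x q" "first x' q" "q \<in> elts P" using a first_mono below_P by blast+
      then have "e x = e x'" using kinj a that by blast
      then have "x = x'" using e(1) a by (blast dest: inj_onD)
      then show ?thesis by simp
    qed
  qed
  have "finj p (fun_name N (ck ` elts \<nu>) (\<lambda>x y s. y = ck (e x) \<and> first x s)) X (ck \<nu>)"
    by (rule inj) (use e(2) fmem_ckI feq_ck in auto)
  moreover have "name (fun_name N (ck ` elts \<nu>) (\<lambda>x y s. y = ck (e x) \<and> first x s))"
    by (rule name_fun_name[OF small small_image[OF small_elts] names]) auto
  ultimately show "p \<tturnstile> lepoll_fm X (ck \<nu>)"
    unfolding lepoll_fm_def using forces_injection n name_ck by (intro forces_ExistsI) blast+
  \<comment> \<open>\<open>\<rho> \<alpha> s\<close>: \<open>s\<close> forces the index \<alpha> to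
    be in use. \<open>coll \<rho> \<nu>\<close> then names the order type of the set of indices in
    use.\<close>
  define \<rho> where "\<rho> = (\<lambda>\<alpha> s. \<exists>A\<in>N. e A = \<alpha> \<and> first A s)"
  have \<rho>_mono: "\<rho> \<beta> s \<Longrightarrow> r \<sqsubseteq> s \<Longrightarrow> \<rho> \<beta> r" for \<beta> s r
    unfolding \<rho>_def using first_mono by blast
  define F where "F = fun_name N (coll \<rho> ` elts \<nu>) (\<lambda>x y s. y = coll \<rho> (e x) \<and> first x s)"
  have "finj p F X (coll \<rho> \<nu>)"
    unfolding F_def
  proof (rule inj)
    show "name (coll \<rho> \<alpha>)" for \<alpha> by simp
    fix A s assume "A \<in> N" "first A s" "s \<in> elts P"
    then show "fmem s (coll \<rho> (e A)) (coll \<rho> \<nu>)"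
      using fmem_collI[of "e A" \<nu> \<rho> s] e(2) unfolding \<rho>_def by blast
  next
    fix A B s
    assume "A \<in> N" "B \<in> N" "first A s" "first B s" "s \<in> elts P" "feq s (coll \<rho> (e A)) (coll \<rho> (e B))"
    then show "e A = e B" using coll_inj[of "e A" "e B" \<rho> s] oe unfolding \<rho>_def by blast
  qed
  then have "fbij p F X (coll \<rho> \<nu>)"
    unfolding F_def
  proof (rule fbij_fun_name[OF _ small small_image[OF small_elts] names])
    fix y q assume y: "name y" "q \<sqsubseteq> p" "fmem q y (coll \<rho> \<nu>)"
    then obtain r \<beta> where r: "r \<sqsubseteq> q" "\<beta> \<in> elts \<nu>" "\<rho> \<beta> r" "feq r y (coll \<rho> \<beta>)"
      using fmem_collE[of q y \<rho> \<nu>] \<rho>_mono below_P by metis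
    then obtain A where "A \<in> N" "e A = \<beta>" "first A r" unfolding \<rho>_def by blast
    then show "\<exists>r x y' s. r \<sqsubseteq> q \<and> r \<sqsubseteq> s \<and> x \<in> N \<and> y' \<in> coll \<rho> ` elts \<nu> \<and>
        (y' = coll \<rho> (e x) \<and> first x s) \<and> feq r y y'"
      using r below_self by blast
  qed
  \<comment> \<open>Which ordinal the order type is depends on the generic filter; \<open>q\<close>
    decides it.\<close>
  moreover obtain q \<theta> where q: "q \<sqsubseteq> p" "Ord \<theta>" "feq q (coll \<rho> \<nu>) (ck \<theta>)"
    using ford_is_check[OF name_coll p ford_coll[of \<nu> \<rho>]] \<nu> \<rho>_mono by blast
  ultimately have "fbij q F X (ck \<theta>)"
    using fbij_mono fbij_cong2 by blast
  moreover have "name F" unfolding F_def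
    by (rule name_fun_name[OF small small_image[OF small_elts] names]) auto
  ultimately have "q \<tturnstile> eqpoll_fm X (ck \<theta>)" using forces_eqpollI n name_ck by blast
  moreover have "\<nu> \<notin> elts \<theta>" using coll_le[of \<rho> q \<nu> \<theta>] \<rho>_mono q below_P by blast
  ultimately show "\<exists>q \<theta>. q \<sqsubseteq> p \<and> Ord \<theta> \<and> (\<theta> \<in> elts \<nu> \<or> \<theta> = \<nu>) \<and> q \<tturnstile> eqpoll_fm X (ck \<theta>)"
    using q Ord_linear \<nu> by blast
qed

section \<open>Antichains\<close>

text \<open>Zorn's lemma for antichains contained in \<open>S\<close>. A member of \<open>S\<close>
  incompatible with all of \<open>W\<close> could be added, so \<open>W\<close> is predense for
  \<open>S\<close>, though not necessarily maximal in \<open>P\<close>.\<close>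

lemma antichain_in_exists:
  assumes "S \<subseteq> elts P"
  obtains W where "W \<subseteq> S" "antichain P le W"
    "\<And>q. q \<in> S \<Longrightarrow> \<exists>s\<in>W. \<exists>r. r \<sqsubseteq> q \<and> r \<sqsubseteq> s"
proof -
  define \<A> where "\<A> = {W. W \<subseteq> S \<and> antichain P le W}"
  have "\<exists>W\<in>\<A>. \<forall>V\<in>\<A>. W \<subseteq> V \<longrightarrow> V = W"
  proof (rule subset_Zorn_nonempty)
    show "\<A> \<noteq> {}" unfolding \<A>_def antichain_def by blast
    fix \<C> assume C: "\<C> \<noteq> {}" "subset.chain \<A> \<C>"
    have inA: "W \<subseteq> S \<and> antichain P le W" if "W \<in> \<C>" for W
      using C(2) that unfolding subset_chain_def \<A>_def by blast
    have inc: "incompatible P le p q" if "p \<in> \<Union>\<C>" "q \<in> \<Union>\<C>" "p \<noteq> q" for p q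
    proof -
      obtain V V' where V: "p \<in> V" "q \<in> V'" "V \<in> \<C>" "V' \<in> \<C>" using \<open>p \<in> \<Union>\<C>\<close> \<open>q \<in> \<Union>\<C>\<close> by blast
      then have "V \<subseteq> V' \<or> V' \<subseteq> V" using C(2) unfolding subset_chain_def by blast
      then obtain W where "p \<in> W" "q \<in> W" "W \<in> \<C>" using V by blast
      then show ?thesis using inA \<open>p \<noteq> q\<close> unfolding antichain_def by blast
    qed
    have "\<Union>\<C> \<subseteq> S" using inA by blast
    then have "antichain P le (\<Union>\<C>)" unfolding antichain_def using inc assms by simp
    then show "\<Union>\<C> \<in> \<A>" using \<open>\<Union>\<C> \<subseteq> S\<close> unfolding \<A>_def by simp
  qed
  then obtain W where "W \<in> \<A>" and max: "\<forall>V\<in>\<A>. W \<subseteq> V \<longrightarrow> V = W" by blast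
  then have W: "W \<subseteq> S" "antichain P le W" unfolding \<A>_def by blast+
  have "\<exists>s\<in>W. \<exists>r. r \<sqsubseteq> q \<and> r \<sqsubseteq> s" if q: "q \<in> S" for q
  proof (rule ccontr)
    assume no: "\<not> (\<exists>s\<in>W. \<exists>r. r \<sqsubseteq> q \<and> r \<sqsubseteq> s)"
    have "antichain P le (insert q W)"
      using W(1,2) no q assms unfolding antichain_def incompatible_def by blast
    then have "insert q W \<in> \<A>" using W q unfolding \<A>_def by simp
    then have "insert q W = W" using max by blast
    then show False using no q assms below_refl by blast
  qed
  then show ?thesis using that W by blast
qed

end

section \<open>Forcing with a fixed filtration\<close>

locale filtered_forcing = forcing P le one for P :: "'v::zfc_universe" and le one +
  fixes l \<kappa> \<mu> D :: 'v and Ps :: "'v \<Rightarrow> 'v"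
  assumes l: "InfCard l" and regular: "regular \<kappa>"
    and l_cf: "l \<in> elts (cf \<mu>)" and cf_\<kappa>: "cf \<mu> \<in> elts \<kappa>" and \<kappa>_\<mu>: "\<kappa> \<in> elts \<mu>"
    and strong_limit: "strong_limit \<mu>"
    and D_filter: "filter_on \<kappa> D" and D_uniform: "uniform \<kappa> D"
    and D_indecomposable: "indecomposable (cf \<mu>) \<kappa> D"
    and cc: "chain_condition (card_succ l) P le"
    and Ps_cover: "\<And>p. p \<in> elts P \<Longrightarrow> \<exists>\<alpha>\<in>elts \<mu>. p \<in> elts (Ps \<alpha>)"
    and Ps_mono: "\<And>\<alpha> \<xi>. \<alpha> \<in> elts \<mu> \<Longrightarrow> \<xi> \<in> elts \<alpha> \<Longrightarrow> elts (Ps \<xi>) \<subseteq> elts (Ps \<alpha>)"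
    and Ps_sub: "\<And>\<alpha>. \<alpha> \<in> elts \<mu> \<Longrightarrow> elts (Ps \<alpha>) \<subseteq> elts P"
    and Ps_card: "\<And>\<alpha>. \<alpha> \<in> elts \<mu> \<Longrightarrow> elts (Ps \<alpha>) \<prec> elts \<mu>"
begin

lemma InfCard_\<mu>: "InfCard \<mu>" and Ord_\<mu>: "Ord \<mu>"
  using strong_limit unfolding strong_limit_def InfCard_def Card_def by blast+

lemma InfCard_\<kappa>: "InfCard \<kappa>" and Ord_\<kappa>: "Ord \<kappa>" and cf_eq: "cf \<kappa> = \<kappa>"
  using regular unfolding regular_def InfCard_def Card_def by blast+

lemma antichain_lepoll: "antichain P le W \<Longrightarrow> W \<lesssim> elts l"
  using lesspoll_card_succ[of l W] InfCard_imp_Ord[OF l] cc unfolding chain_condition_def by blast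

lemma l_\<kappa>: "l \<in> elts \<kappa>"
  using Ord_trans Ord_\<kappa> cf_\<kappa> l_cf by blast

text \<open>This bound keeps an antichain inside one stage of the filtration; the analogous bound by
  \<open>cf \<kappa>\<close> serves to show that unbounded subsets of \<kappa> have size
  \<kappa>.\<close>

lemma antichain_lesspoll_cf: "antichain P le W \<Longrightarrow> W \<prec> elts (cf \<mu>)"
  using lesspoll_trans1[OF antichain_lepoll cf_not_lepoll[OF Ord_\<mu> l_cf]] .

lemma antichain_lesspoll_\<kappa>: "antichain P le W \<Longrightarrow> W \<prec> elts (cf \<kappa>)"
  using lesspoll_trans1[OF antichain_lepoll cf_not_lepoll[OF Ord_\<kappa>, unfolded cf_eq, OF l_\<kappa>]]
  unfolding cf_eq .

section \<open>Names for subsets of \<open>\<kappa>\<close>\<close>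

definition cells :: "'v \<Rightarrow> 'v set" where
  "cells Q = {vpair (ck i) s | i s. i \<in> elts \<kappa> \<and> s \<in> elts Q}"

lemma small_cells: "small (cells Q)"
  unfolding cells_def by (rule small_pairs[of _ _ "\<lambda>i s. vpair (ck i) s"]) auto

definition small_names :: "'v set" where
  "small_names = (\<Union>\<beta>\<in>elts \<mu>. {x. elts x \<subseteq> cells (Ps \<beta>)})"

text \<open>A stage has fewer than \<mu> cells, since \<kappa> and \<open>Ps \<beta>\<close> are
  both smaller than \<mu>, and fewer than \<mu> sets of cells, since \<mu> is a strong limit. There
  are \<mu> stages.\<close>

lemma small_names_lepoll: "small_names \<lesssim> elts \<mu>"
  unfolding small_names_def
proof (rule infinite_UN_lepoll)
  show "infinite (elts \<mu>)" using InfCard_\<mu> unfolding InfCard_def by blast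
  fix \<beta> assume \<beta>: "\<beta> \<in> elts \<mu>"
  have "cells (Ps \<beta>) = (\<lambda>(i, s). vpair (ck i) s) ` (elts \<kappa> \<times> elts (Ps \<beta>))"
    unfolding cells_def by auto
  then have "cells (Ps \<beta>) \<lesssim> elts \<kappa> \<times> elts (Ps \<beta>)" using image_lepoll by metis
  moreover have "elts \<kappa> \<prec> elts \<mu>"
    using Card_lesspoll \<kappa>_\<mu> InfCard_\<mu> unfolding InfCard_def by blast
  then have "elts \<kappa> \<times> elts (Ps \<beta>) \<prec> elts \<mu>"
    by (rule InfCard_Times_lesspoll[OF InfCard_\<mu> _ Ps_card[OF \<beta>]])
  ultimately have "cells (Ps \<beta>) \<prec> elts \<mu>" by (rule lesspoll_trans1)
  then have "Pow (cells (Ps \<beta>)) \<prec> elts \<mu>" by (rule strong_limit_Pow[OF strong_limit])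
  moreover have "{x. elts x \<subseteq> cells (Ps \<beta>)} \<lesssim> Pow (cells (Ps \<beta>))"
    unfolding lepoll_def by (rule exI[of _ elts]) (auto intro: inj_onI extensionality)
  ultimately show "{x. elts x \<subseteq> cells (Ps \<beta>)} \<lesssim> elts \<mu>"
    using lepoll_trans lesspoll_imp_lepoll by blast
qed (rule lepoll_refl)

lemma name_cells: "elts x \<subseteq> cells P \<Longrightarrow> name x"
  by (rule nameI) (auto simp: cells_def)

lemma cells_Ps: "\<beta> \<in> elts \<mu> \<Longrightarrow> cells (Ps \<beta>) \<subseteq> cells P"
  unfolding cells_def using Ps_sub by blast

lemma fmem_cellsE:
  assumes "fmem p y x" "elts x \<subseteq> cells P" "p \<in> elts P"
  obtains q i where "q \<sqsubseteq> p" "i \<in> elts \<kappa>" "feq q y (ck i)" "fmem q (ck i) x"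
proof -
  obtain q \<tau> t where q: "q \<sqsubseteq> p" "vpair \<tau> t \<in> elts x" "q \<sqsubseteq> t" "feq q y \<tau>"
    using fmemE assms(1,3) by metis
  then obtain i where "i \<in> elts \<kappa>" "\<tau> = ck i"
    using assms(2) unfolding cells_def by (blast dest: vpair_inject[THEN iffD1])
  then show ?thesis using that q fmem_elt by blast
qed

lemma forces_sub_\<kappa>E:
  assumes "p \<tturnstile> (A \<^bold>\<subseteq> ck \<kappa>)" "name x" "q \<sqsubseteq> p" "fmem q x A"
  obtains r i where "r \<sqsubseteq> q" "i \<in> elts \<kappa>" "feq r x (ck i)" "fmem r (ck i) A"
proof -
  have "fmem q x (ck \<kappa>)" using assms by simp
  then obtain r i where "r \<sqsubseteq> q" "i \<in> elts \<kappa>" "feq r x (ck i)"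
    using fmem_ckE assms(3) below_P by metis
  then show ?thesis using that assms(4) fmem_mono fmem_cong1 by blast
qed

lemma cells_sub_\<kappa>:
  assumes "elts x \<subseteq> cells P"
  shows "p \<tturnstile> (x \<^bold>\<subseteq> ck \<kappa>)"
  unfolding forces_sub
proof (intro allI impI, rule fmem_dense)
  fix y q r assume "q \<sqsubseteq> p" "fmem q y x" "r \<sqsubseteq> q"
  then obtain r' i where "r' \<sqsubseteq> r" "i \<in> elts \<kappa>" "feq r' y (ck i)"
    using fmem_cellsE[OF fmem_mono assms] below_P by metis
  then show "\<exists>q. q \<sqsubseteq> r \<and> fmem q y (ck \<kappa>)"
    using fmem_ckI fmem_cong1 feq_sym below_P by meson
qed

text \<open>A member of a subset of \<kappa> is, densely, a check name, so inclusion can be tested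
  on check names alone. All later work with subsets of \<kappa> uses this reduction.\<close>

lemma forces_sub_checks:
  assumes "p \<tturnstile> (A \<^bold>\<subseteq> ck \<kappa>)"
    and "\<And>q i. q \<sqsubseteq> p \<Longrightarrow> i \<in> elts \<kappa> \<Longrightarrow> fmem q (ck i) A \<Longrightarrow> fmem q (ck i) B"
  shows "p \<tturnstile> (A \<^bold>\<subseteq> B)"
  unfolding forces_sub
proof (intro allI impI, rule fmem_dense)
  fix y q r assume a: "name y" "q \<sqsubseteq> p" "fmem q y A" "r \<sqsubseteq> q"
  then have "r \<sqsubseteq> p" "fmem r y A" using below_trans fmem_mono by blast+
  then obtain r' i where r': "r' \<sqsubseteq> r" "i \<in> elts \<kappa>" "feq r' y (ck i)" "fmem r' (ck i) A"
    using forces_sub_\<kappa>E assms(1) a(1) by metis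
  then have "fmem r' (ck i) B" using assms(2) \<open>r \<sqsubseteq> p\<close> below_trans by blast
  then show "\<exists>q. q \<sqsubseteq> r \<and> fmem q y B" using r' fmem_cong1 feq_sym by blast
qed

lemma forces_sub_antisym:
  "name A \<Longrightarrow> name B \<Longrightarrow> p \<tturnstile> (A \<^bold>\<subseteq> B) \<Longrightarrow> p \<tturnstile> (B \<^bold>\<subseteq> A) \<Longrightarrow> feq p A B"
  by (rule feq_ext_name) auto

text \<open>Indecomposability of \<open>D\<close> puts the antichains deciding membership in \<open>A\<close>, for almost all
  \<open>i < \<kappa>\<close>, into a single \<open>Ps \<beta>\<close>.\<close>

lemma small_name_approx:
  "\<exists>B\<in>elts D. \<exists>A'\<in>small_names. \<forall>q i. q \<in> elts P \<longrightarrow>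
     (fmem q (ck i) A' \<longleftrightarrow> i \<in> elts B \<and> fmem q (ck i) A)"
proof -
  define S where "S = (\<lambda>i. {s \<in> elts P. fmem s (ck i) A})"
  have "\<exists>W. W \<subseteq> S i \<and> antichain P le W \<and> (\<forall>q\<in>S i. \<exists>s\<in>W. \<exists>r. r \<sqsubseteq> q \<and> r \<sqsubseteq> s)" for i
  proof -
    have "S i \<subseteq> elts P" unfolding S_def by blast
    then show ?thesis using antichain_in_exists[of "S i"] by metis
  qed
  then obtain W where W0: "\<And>i. W i \<subseteq> S i \<and> antichain P le (W i) \<and>
      (\<forall>q\<in>S i. \<exists>s\<in>W i. \<exists>r. r \<sqsubseteq> q \<and> r \<sqsubseteq> s)"
    by metis
  then have W: "\<And>i. W i \<subseteq> {s \<in> elts P. fmem s (ck i) A}" "\<And>i. antichain P le (W i)"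
    "\<And>i q. q \<in> elts P \<Longrightarrow> fmem q (ck i) A \<Longrightarrow> \<exists>s\<in>W i. \<exists>r. r \<sqsubseteq> q \<and> r \<sqsubseteq> s"
    unfolding S_def by blast+
  obtain g where g: "\<And>p. p \<in> elts P \<Longrightarrow> g p \<in> elts \<mu> \<and> p \<in> elts (Ps (g p))"
    using Ps_cover by metis
  \<comment> \<open>The stages \<open>g s\<close> for \<open>s\<close> in \<open>W i\<close> are
    fewer than \<open>cf \<mu>\<close>, hence bounded, and the stages increase.\<close>
  have "\<exists>\<beta>\<in>elts \<mu>. W i \<subseteq> elts (Ps \<beta>)" for i
  proof -
    have "\<And>x. x \<in> W i \<Longrightarrow> g x \<in> elts \<mu>" using g W(1) by blast
    then obtain \<beta> where "\<beta> \<in> elts \<mu>" "\<And>x. x \<in> W i \<Longrightarrow> g x \<in> elts \<beta>"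
      using bounded_below_cf[OF Ord_\<mu> antichain_lesspoll_cf[OF W(2)[of i]], of g] by metis
    then have "W i \<subseteq> elts (Ps \<beta>)" using g W(1) Ps_mono by blast
    then show ?thesis using \<open>\<beta> \<in> elts \<mu>\<close> by blast
  qed
  then obtain b where b: "\<And>i. b i \<in> elts \<mu>" "\<And>i. W i \<subseteq> elts (Ps (b i))" by metis
  obtain f where f: "cofinal_map \<mu> (cf \<mu>) f" using cf_cofinal_map(2) Ord_\<mu> by blast
  then have "\<exists>\<xi>\<in>elts (cf \<mu>). b i \<in> elts (f \<xi>) \<or> b i = f \<xi>" for i
    using b(1) unfolding cofinal_map_def by blast
  then obtain x where x: "\<And>i. x i \<in> elts (cf \<mu>)" "\<And>i. b i \<in> elts (f (x i)) \<or> b i = f (x i)"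
    by metis
  \<comment> \<open>The point \<open>i\<close> is filed under a place of the cofinal sequence at or
    beyond the stage \<open>b i\<close>; some blocks may be empty.\<close>
  define Y where "Y = (\<lambda>\<xi>. {i \<in> elts \<kappa>. x i = \<xi>})"
  have "disjoint_family_on Y (elts (cf \<mu>))" unfolding Y_def disjoint_family_on_def by blast
  moreover have "(\<Union>\<xi>\<in>elts (cf \<mu>). Y \<xi>) = elts \<kappa>" unfolding Y_def using x(1) by blast
  ultimately obtain T B where T: "T \<subseteq> elts (cf \<mu>)" "T \<prec> elts (cf \<mu>)"
    and B: "B \<in> elts D" "elts B = (\<Union>\<xi>\<in>T. Y \<xi>)"
    using D_indecomposable[unfolded indecomposable_def, rule_format, of Y] by blast
  \<comment> \<open>As \<open>T\<close> has fewer than \<open>cf \<mu>\<close> members, the values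
    of the cofinal map on \<open>T\<close> are bounded by one \<beta>, which serves every
    \<open>i\<close> in \<open>B\<close>.\<close>
  have "\<And>\<xi>. \<xi> \<in> T \<Longrightarrow> f \<xi> \<in> elts \<mu>" using f T(1) unfolding cofinal_map_def by blast
  then obtain \<beta> where \<beta>: "\<beta> \<in> elts \<mu>" "\<And>\<xi>. \<xi> \<in> T \<Longrightarrow> f \<xi> \<in> elts \<beta>"
    using bounded_below_cf[OF Ord_\<mu> T(2), of f] by metis
  have WB: "W i \<subseteq> elts (Ps \<beta>)" if "i \<in> elts B" for i
  proof -
    have "f (x i) \<in> elts \<beta>" using that B(2) \<beta>(2) unfolding Y_def by blast
    then have "b i \<in> elts \<beta>" using x(2)[of i] Ord_trans Ord_elts[OF Ord_\<mu> \<beta>(1)] by metis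
    then show ?thesis using b(2) Ps_mono \<beta>(1) by blast
  qed
  have B\<kappa>: "elts B \<subseteq> elts \<kappa>" using B(1) D_filter unfolding filter_on_def by blast
  \<comment> \<open>A name for the intersection of \<open>A\<close> and \<open>B\<close>: each
    \<open>s\<close> in \<open>W i\<close> forces \<open>i\<close> into \<open>A\<close>, and every
    condition forcing \<open>i\<close> into \<open>A\<close> is compatible with some member of
    \<open>W i\<close>.\<close>
  define Z where "Z = {vpair (ck i) s | i s. i \<in> elts B \<and> s \<in> W i}"
  have Z: "Z \<subseteq> cells (Ps \<beta>)" unfolding Z_def cells_def using WB B\<kappa> by blast
  have eZ: "elts (vset Z) = Z"
    using small_subset[OF small_cells Z] by (rule elts_vset_small)
  have "vset Z \<in> small_names" unfolding small_names_def using eZ Z \<beta>(1) by blast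
  moreover have "fmem q (ck i) (vset Z) \<longleftrightarrow> i \<in> elts B \<and> fmem q (ck i) A" if q: "q \<in> elts P" for q i
  proof
    assume L: "fmem q (ck i) (vset Z)"
    have *: "\<exists>r'. r' \<sqsubseteq> r \<and> i \<in> elts B \<and> fmem r' (ck i) A" if r: "r \<sqsubseteq> q" for r
    proof -
      have "fmem r (ck i) (vset Z)" "r \<in> elts P" using L r fmem_mono below_P by blast+
      then obtain r' \<tau> t where r': "r' \<sqsubseteq> r" "vpair \<tau> t \<in> Z" "r' \<sqsubseteq> t" "feq r' (ck i) \<tau>"
        using fmemE[of r "ck i" "vset Z"] eZ by metis
      then obtain j where j: "\<tau> = ck j" "j \<in> elts B" "t \<in> W j" unfolding Z_def by auto
      then have "i = j" using r' feq_ck below_P by blast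
      then show ?thesis using j r' W(1) fmem_mono by blast
    qed
    then show "i \<in> elts B \<and> fmem q (ck i) A"
      using fmem_dense[of q "ck i" A] below_refl[OF q] by blast
  next
    assume R: "i \<in> elts B \<and> fmem q (ck i) A"
    show "fmem q (ck i) (vset Z)"
    proof (rule fmem_dense)
      fix r assume "r \<sqsubseteq> q"
      then have "fmem r (ck i) A" "r \<in> elts P" using R fmem_mono below_P by blast+
      then obtain s r' where s: "s \<in> W i" "r' \<sqsubseteq> r" "r' \<sqsubseteq> s" using W(3) by blast
      then have "vpair (ck i) s \<in> Z" unfolding Z_def using R by blast
      then have "vpair (ck i) s \<in> elts (vset Z)" unfolding eZ .
      then show "\<exists>r'. r' \<sqsubseteq> r \<and> fmem r' (ck i) (vset Z)" using s fmem_elt by blast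
    qed
  qed
  ultimately show ?thesis using B(1) by blast
qed

end

section \<open>Generating ultrafilters\<close>

context forcing
begin

lemma forces_filterD:
  assumes "p \<tturnstile> filter_fm K U"
  shows "\<And>A q. name A \<Longrightarrow> q \<sqsubseteq> p \<Longrightarrow> fmem q A U \<Longrightarrow> q \<tturnstile> (A \<^bold>\<subseteq> K)"
    and "\<And>A B C q. name A \<Longrightarrow> name B \<Longrightarrow> name C \<Longrightarrow> q \<sqsubseteq> p \<Longrightarrow> fmem q A U \<Longrightarrow> fmem q B U \<Longrightarrow>
      q \<tturnstile> inter_fm C A B \<Longrightarrow> fmem q C U"
    and "\<And>A B q. name A \<Longrightarrow> name B \<Longrightarrow> q \<sqsubseteq> p \<Longrightarrow> fmem q A U \<Longrightarrow> q \<tturnstile> (A \<^bold>\<subseteq> B) \<Longrightarrow>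
      q \<tturnstile> (B \<^bold>\<subseteq> K) \<Longrightarrow> fmem q B U"
  using assms unfolding filter_fm_def forces.simps(1,4,5) forces_Imp by (blast, blast, blast)

lemma forces_interI:
  assumes "\<And>w q. name w \<Longrightarrow> q \<sqsubseteq> p \<Longrightarrow> fmem q w C \<longleftrightarrow> fmem q w A \<and> fmem q w B"
  shows "p \<tturnstile> inter_fm C A B"
  unfolding inter_fm_def using assms by simp

lemma forces_interD:
  assumes "p \<tturnstile> inter_fm C A B" "name w" "q \<sqsubseteq> p"
  shows "fmem q w C \<longleftrightarrow> fmem q w A \<and> fmem q w B"
  using assms unfolding inter_fm_def by simp

lemma forces_generates:
  assumes "\<And>A q. name A \<Longrightarrow> q \<sqsubseteq> p \<Longrightarrow> fmem q A X \<Longrightarrow> fmem q A U"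
    and "\<And>A q. name A \<Longrightarrow> q \<sqsubseteq> p \<Longrightarrow> fmem q A U \<Longrightarrow> q \<tturnstile> (A \<^bold>\<subseteq> K)"
    and "\<And>A q. name A \<Longrightarrow> q \<sqsubseteq> p \<Longrightarrow> fmem q A U \<Longrightarrow> \<exists>B. name B \<and> fmem q B X \<and> q \<tturnstile> (B \<^bold>\<subseteq> A)"
    and "\<And>A B q. name A \<Longrightarrow> name B \<Longrightarrow> q \<sqsubseteq> p \<Longrightarrow> fmem q B U \<Longrightarrow> q \<tturnstile> (B \<^bold>\<subseteq> A) \<Longrightarrow>
      q \<tturnstile> (A \<^bold>\<subseteq> K) \<Longrightarrow> fmem q A U"
  shows "p \<tturnstile> generates_fm K X U"
proof -
  have "q \<tturnstile> (A \<^bold>\<in> U) \<longleftrightarrow> q \<tturnstile> (A \<^bold>\<subseteq> K \<^bold>\<and> (\<^bold>\<exists>B. B \<^bold>\<in> X \<^bold>\<and> B \<^bold>\<subseteq> A))"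
    if A: "name A" "q \<sqsubseteq> p" for A q
  proof
    assume "q \<tturnstile> (A \<^bold>\<in> U)"
    then have U: "fmem q A U" by simp
    then obtain B where B: "name B" "fmem q B X" "q \<tturnstile> (B \<^bold>\<subseteq> A)" using assms(3) A by blast
    have "q \<tturnstile> (\<^bold>\<exists>B. B \<^bold>\<in> X \<^bold>\<and> B \<^bold>\<subseteq> A)"
      by (rule forces_ExistsI[OF B(1)]) (use B in simp)
    then show "q \<tturnstile> (A \<^bold>\<subseteq> K \<^bold>\<and> (\<^bold>\<exists>B. B \<^bold>\<in> X \<^bold>\<and> B \<^bold>\<subseteq> A))"
      using assms(2)[OF A U] by (simp only: forces.simps simp_thms)
  next
    assume "q \<tturnstile> (A \<^bold>\<subseteq> K \<^bold>\<and> (\<^bold>\<exists>B. B \<^bold>\<in> X \<^bold>\<and> B \<^bold>\<subseteq> A))"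
    then have K: "q \<tturnstile> (A \<^bold>\<subseteq> K)" and ex: "q \<tturnstile> (\<^bold>\<exists>B. B \<^bold>\<in> X \<^bold>\<and> B \<^bold>\<subseteq> A)"
      by (simp_all only: forces.simps)
    have "fmem q A U"
    proof (rule fmem_dense)
      fix r assume r: "r \<sqsubseteq> q"
      from ex r obtain r' B where r': "r' \<sqsubseteq> r" "name B" "r' \<tturnstile> (B \<^bold>\<in> X \<^bold>\<and> B \<^bold>\<subseteq> A)"
        by (rule forces_ExistsE)
      then have "fmem r' B X" and sub: "r' \<tturnstile> (B \<^bold>\<subseteq> A)" by (simp_all only: forces.simps)
      moreover have "r' \<sqsubseteq> q" "r' \<sqsubseteq> p" using r' r A below_trans by blast+
      ultimately have "fmem r' A U"
        using assms(1,4) r'(2) A(1) forces_mono[OF K] by blast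
      then show "\<exists>r'. r' \<sqsubseteq> r \<and> fmem r' A U" using r' by blast
    qed
    then show "q \<tturnstile> (A \<^bold>\<in> U)" by simp
  qed
  moreover have "p \<tturnstile> (X \<^bold>\<subseteq> U)" using assms(1) by simp
  ultimately show ?thesis
    unfolding generates_fm_def by (simp only: forces.simps forces_Iff) blast
qed

end

context filtered_forcing
begin

lemma ck_D: "B \<in> elts D \<Longrightarrow> p \<tturnstile> (ck D \<^bold>\<subseteq> U) \<Longrightarrow> q \<sqsubseteq> p \<Longrightarrow> fmem q (ck B) U"
  using fmem_ckI below_P by simp

text \<open>\<open>X\<close> attaches to each small name the conditions forcing it into
  \<open>U\<close>. It generates because the approximation of a member of \<open>U\<close> is its
  intersection with a set in \<open>D\<close>, hence again in \<open>U\<close>. The final clause,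
  sharper than the injection into \<mu>, is what a bound on the ultrafilter number requires.\<close>

lemma few_generators:
  assumes U: "name U" and p: "p \<in> elts P"
    and filt: "p \<tturnstile> filter_fm (ck \<kappa>) U" and D: "p \<tturnstile> (ck D \<^bold>\<subseteq> U)"
  obtains X where "name X" "p \<tturnstile> generates_fm (ck \<kappa>) X U" "p \<tturnstile> lepoll_fm X (ck \<mu>)"
    "\<exists>q \<theta>. q \<sqsubseteq> p \<and> Ord \<theta> \<and> (\<theta> \<in> elts \<mu> \<or> \<theta> = \<mu>) \<and> q \<tturnstile> eqpoll_fm X (ck \<theta>)"
proof -
  define X where "X = vset {vpair A s | A s. A \<in> small_names \<and> s \<in> elts P \<and> fmem s A U}"
  have small: "small small_names" using small_lepoll[OF small_names_lepoll small_elts] .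
  have cells: "A \<in> small_names \<Longrightarrow> elts A \<subseteq> cells P" for A
    unfolding small_names_def using cells_Ps by blast
  have names: "A \<in> small_names \<Longrightarrow> name A" for A using cells name_cells by blast
  have "small {vpair A s | A s. A \<in> small_names \<and> s \<in> elts P \<and> fmem s A U}"
    by (rule small_subset[OF small_pairs[OF small small_elts[of P], of vpair]]) blast
  then have eX: "elts X = {vpair A s | A s. A \<in> small_names \<and> s \<in> elts P \<and> fmem s A U}"
    unfolding X_def by simp
  have X: "name X" by (rule nameI) (use eX names in auto)
  have X_E: "\<exists>r A. r \<sqsubseteq> q \<and> A \<in> small_names \<and> feq r x A \<and> fmem r A U"
    if q: "q \<in> elts P" "fmem q x X" for q x
  proof -
    obtain r A s where r: "r \<sqsubseteq> q" "vpair A s \<in> elts X" "r \<sqsubseteq> s" "feq r x A"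
      using fmemE q by metis
    then have "A \<in> small_names" "fmem s A U" by (auto simp: eX)
    then show ?thesis using r fmem_mono by blast
  qed
  have gen: "p \<tturnstile> generates_fm (ck \<kappa>) X U"
  proof (rule forces_generates)
    fix A q assume A: "name A" "q \<sqsubseteq> p" "fmem q A X"
    show "fmem q A U"
    proof (rule fmem_dense)
      fix r assume "r \<sqsubseteq> q"
      then obtain r' A' where "r' \<sqsubseteq> r" "feq r' A A'" "fmem r' A' U"
        using X_E A fmem_mono below_P by meson
      then show "\<exists>r'. r' \<sqsubseteq> r \<and> fmem r' A U" using fmem_cong1 feq_sym by blast
    qed
  next
    fix A q assume "name A" "q \<sqsubseteq> p" "fmem q A U"
    then show "q \<tturnstile> (A \<^bold>\<subseteq> ck \<kappa>)" using forces_filterD(1) filt by blast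
  next
    fix A B q assume "name A" "name B" "q \<sqsubseteq> p" "fmem q B U" "q \<tturnstile> (B \<^bold>\<subseteq> A)" "q \<tturnstile> (A \<^bold>\<subseteq> ck \<kappa>)"
    then show "fmem q A U" using forces_filterD(3) filt by blast
  next
    fix A q assume A: "name A" "q \<sqsubseteq> p" "fmem q A U"
    obtain B A' where B: "B \<in> elts D" and A': "A' \<in> small_names"
      "\<And>q i. q \<in> elts P \<Longrightarrow> fmem q (ck i) A' \<longleftrightarrow> i \<in> elts B \<and> fmem q (ck i) A"
      using small_name_approx[of A] by blast
    \<comment> \<open>\<open>small_name_approx\<close> speaks of check names only; both directions
      first refine the condition until \<open>w\<close> is decided to be some check name.\<close>
    have "q \<tturnstile> inter_fm A' A (ck B)"
    proof (rule forces_interI)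
      fix w r assume w: "name w" "r \<sqsubseteq> q"
      show "fmem r w A' \<longleftrightarrow> fmem r w A \<and> fmem r w (ck B)"
      proof
        assume L: "fmem r w A'"
        have "\<exists>t. t \<sqsubseteq> s \<and> fmem t w A \<and> fmem t w (ck B)" if "s \<sqsubseteq> r" for s
        proof -
          have "fmem s w A'" "s \<in> elts P" using L \<open>s \<sqsubseteq> r\<close> fmem_mono below_P by blast+
          then obtain t i where t: "t \<sqsubseteq> s" "feq t w (ck i)" "fmem t (ck i) A'"
            using fmem_cellsE[OF _ cells[OF A'(1)]] by metis
          then have "i \<in> elts B" "fmem t (ck i) A" using A'(2) below_P by blast+
          then show ?thesis using t fmem_cong1 feq_sym fmem_ckI below_P by meson
        qed
        then show "fmem r w A \<and> fmem r w (ck B)"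
          using fmem_dense[of r w A] fmem_dense[of r w "ck B"] by blast
      next
        assume R: "fmem r w A \<and> fmem r w (ck B)"
        show "fmem r w A'"
        proof (rule fmem_dense)
          fix s assume s: "s \<sqsubseteq> r"
          then have "fmem s w A" "fmem s w (ck B)" "s \<in> elts P" using R fmem_mono below_P by blast+
          then obtain t i where t: "t \<sqsubseteq> s" "i \<in> elts B" "feq t w (ck i)" using fmem_ckE by metis
          then have "fmem t (ck i) A'"
            using A'(2) \<open>fmem s w A\<close> fmem_mono fmem_cong1 below_P by meson
          then show "\<exists>t. t \<sqsubseteq> s \<and> fmem t w A'" using t fmem_cong1 feq_sym by blast
        qed
      qed
    qed
    then have inU: "fmem q A' U"
      using forces_filterD(2)[OF filt A(1) name_ck names[OF A'(1)] A(2,3) ck_D[OF B D A(2)]] by blast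
    have "fmem q A' X"
      by (rule fmem_elt[of _ q]) (use A' inU A(2) below_P below_self in \<open>auto simp: eX\<close>)
    moreover have "q \<tturnstile> (A' \<^bold>\<subseteq> A)"
      by (rule forces_sub_checks[OF cells_sub_\<kappa>[OF cells[OF A'(1)]]]) (use A'(2) below_P in blast)
    ultimately show "\<exists>B. name B \<and> fmem q B X \<and> q \<tturnstile> (B \<^bold>\<subseteq> A)" using names A'(1) by blast
  qed
  obtain e where e: "inj_on e small_names" "e ` small_names \<subseteq> elts \<mu>"
    using small_names_lepoll unfolding lepoll_def by blast
  have "\<And>x q. name x \<Longrightarrow> q \<sqsubseteq> p \<Longrightarrow> fmem q x X \<Longrightarrow> \<exists>r A. r \<sqsubseteq> q \<and> A \<in> small_names \<and> feq r x A"
    using X_E below_P by meson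
  note enum = enumerated_name[OF X small names e(1) _ Ord_\<mu> p this]
  show ?thesis
  proof (rule that[OF X gen])
    show "p \<tturnstile> lepoll_fm X (ck \<mu>)" by (rule enum(1)) (use e(2) in auto)
    show "\<exists>q \<theta>. q \<sqsubseteq> p \<and> Ord \<theta> \<and> (\<theta> \<in> elts \<mu> \<or> \<theta> = \<mu>) \<and> q \<tturnstile> eqpoll_fm X (ck \<theta>)"
      by (rule enum(2)) (use e(2) in auto)
  qed
qed

section \<open>A uniform ultrafilter extending \<open>D\<close>\<close>

definition nice :: "('v \<Rightarrow> 'v \<Rightarrow> bool) \<Rightarrow> 'v" where
  "nice \<phi> = vset {vpair (ck i) s | i s. i \<in> elts \<kappa> \<and> s \<in> elts P \<and> \<phi> i s}"

lemma elts_nice: "elts (nice \<phi>) = {vpair (ck i) s | i s. i \<in> elts \<kappa> \<and> s \<in> elts P \<and> \<phi> i s}"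
  unfolding nice_def
  by (rule elts_vset_small, rule small_subset[OF small_cells[of P]]) (auto simp: cells_def)

lemma nice_cells: "elts (nice \<phi>) \<subseteq> cells P"
  unfolding elts_nice cells_def by blast

text \<open>The two hypotheses, persistence and closure under density, are those that any forced
  statement satisfies; together they make \<phi> exactly the forced membership relation of the
  name.\<close>

lemma fmem_nice:
  assumes "\<And>i s r. \<phi> i s \<Longrightarrow> r \<sqsubseteq> s \<Longrightarrow> \<phi> i r"
    and "\<And>i s. s \<in> elts P \<Longrightarrow> (\<And>r. r \<sqsubseteq> s \<Longrightarrow> \<exists>q. q \<sqsubseteq> r \<and> \<phi> i q) \<Longrightarrow> \<phi> i s"
    and q: "q \<in> elts P"
  shows "fmem q (ck i) (nice \<phi>) \<longleftrightarrow> i \<in> elts \<kappa> \<and> \<phi> i q"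
proof
  assume L: "fmem q (ck i) (nice \<phi>)"
  have *: "\<exists>t. t \<sqsubseteq> r \<and> i \<in> elts \<kappa> \<and> \<phi> i t" if "r \<sqsubseteq> q" for r
  proof -
    have "fmem r (ck i) (nice \<phi>)" "r \<in> elts P" using L \<open>r \<sqsubseteq> q\<close> fmem_mono below_P by blast+
    then obtain t \<tau> s where t: "t \<sqsubseteq> r" "vpair \<tau> s \<in> elts (nice \<phi>)" "t \<sqsubseteq> s" "feq t (ck i) \<tau>"
      using fmemE by metis
    then obtain j where j: "\<tau> = ck j" "j \<in> elts \<kappa>" "\<phi> j s" by (auto simp: elts_nice)
    then have "i = j" using t feq_ck below_P by blast
    then show ?thesis using j t assms(1) by blast
  qed
  then show "i \<in> elts \<kappa> \<and> \<phi> i q" using assms(2)[OF q] below_refl[OF q] by blast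
next
  assume "i \<in> elts \<kappa> \<and> \<phi> i q"
  then show "fmem q (ck i) (nice \<phi>)"
    by (intro fmem_elt[of _ q]) (use q in \<open>auto simp: elts_nice\<close>)
qed

abbreviation nice_of :: "'v \<Rightarrow> 'v" where
  "nice_of A \<equiv> nice (\<lambda>i s. fmem s (ck i) A)"

lemma fmem_nice_of: "q \<in> elts P \<Longrightarrow> fmem q (ck i) (nice_of A) \<longleftrightarrow> i \<in> elts \<kappa> \<and> fmem q (ck i) A"
  by (rule fmem_nice) (use fmem_mono fmem_dense in blast)+

text \<open>Names for subsets of \<kappa> form a proper class. With nice representatives, a name for
  an ultrafilter can be assembled from a set of names.\<close>

lemma feq_nice_of:
  assumes "name A" "p \<tturnstile> (A \<^bold>\<subseteq> ck \<kappa>)"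
  shows "feq p A (nice_of A)"
proof (rule forces_sub_antisym)
  show "p \<tturnstile> (A \<^bold>\<subseteq> nice_of A)"
    by (rule forces_sub_checks[OF assms(2)]) (use fmem_nice_of below_P in blast)
  show "p \<tturnstile> (nice_of A \<^bold>\<subseteq> A)"
    by (rule forces_sub_checks[OF cells_sub_\<kappa>[OF nice_cells]]) (use fmem_nice_of below_P in blast)
qed (use assms name_cells nice_cells in auto)

definition tail :: "'v \<Rightarrow> 'v \<Rightarrow> 'v" where
  "tail B j = vset {i \<in> elts B. j \<in> elts i}"

lemma elts_tail: "elts (tail B j) = {i \<in> elts B. j \<in> elts i}"
  unfolding tail_def by (rule elts_vset_small, rule small_subset[OF small_elts[of B]]) blast

lemma D_sub: "B \<in> elts D \<Longrightarrow> elts B \<subseteq> elts \<kappa>"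
  using D_filter unfolding filter_on_def by blast

lemma \<kappa>_D: "\<kappa> \<in> elts D"
  using D_filter unfolding filter_on_def by blast

text \<open>A bounded subset of \<kappa> lies inside some \<open>k\<close> in \<kappa> and is
  smaller than \<kappa>, contrary to the uniformity of \<open>D\<close>.\<close>

lemma D_unbounded:
  assumes "B \<in> elts D" "j \<in> elts \<kappa>"
  obtains i where "i \<in> elts B" "j \<in> elts i"
proof -
  have "\<exists>i\<in>elts B. j \<in> elts i"
  proof (rule ccontr)
    assume no: "\<not> (\<exists>i\<in>elts B. j \<in> elts i)"
    \<comment> \<open>\<open>B\<close> may contain \<open>j\<close> itself, so the bounding ordinal
      must lie strictly above \<open>j\<close>.\<close>
    obtain k where k: "k \<in> elts \<kappa>" "j \<in> elts k" using InfCard_limit InfCard_\<kappa> assms(2) by metis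
    have "elts B \<subseteq> elts k"
    proof
      fix i assume i: "i \<in> elts B"
      then have "i \<in> elts \<kappa>" using D_sub assms(1) by blast
      then have "i \<in> elts j \<or> i = j" using Ord_linear Ord_elts Ord_\<kappa> assms(2) no i by blast
      then show "i \<in> elts k" using k Ord_trans Ord_elts Ord_\<kappa> by blast
    qed
    then have "elts B \<lesssim> elts k" by (rule subset_imp_lepoll)
    moreover have "elts k \<prec> elts \<kappa>" using Card_lesspoll k(1) InfCard_\<kappa> unfolding InfCard_def by blast
    ultimately have "elts B \<prec> elts \<kappa>" by (rule lesspoll_trans1)
    then show False using D_uniform assms(1) unfolding uniform_def lesspoll_def by blast
  qed
  then show ?thesis using that by blast
qed

lemma ck_cells: "elts B \<subseteq> elts \<kappa> \<Longrightarrow> elts (ck B) \<subseteq> cells P"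
  unfolding cells_def elts_ck using one_P by blast

text \<open>For subsets of \<kappa>, \<open>p\<close> forces the intersection of \<open>A\<close>
  and \<open>B\<close> into \<open>C\<close>. Taking \<open>B = A\<close> gives plain inclusion, so
  one closure condition on filters covers both intersections and supersets.\<close>

definition forced_inter :: "'v \<Rightarrow> 'v \<Rightarrow> 'v \<Rightarrow> 'v \<Rightarrow> bool" where
  "forced_inter p A B C \<longleftrightarrow> (\<forall>q i. q \<sqsubseteq> p \<longrightarrow> i \<in> elts \<kappa> \<longrightarrow> fmem q (ck i) A \<longrightarrow> fmem q (ck i) B \<longrightarrow> fmem q (ck i) C)"

text \<open>A family \<open>F\<close> of pairs \<open>(A, p)\<close> stands for the name of a filter containing \<open>A\<close> as soon as
  \<open>p\<close> is generic. The requirement that tails of members of \<open>D\<close> belong to it makes it uniform.\<close>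

definition filter_family :: "('v \<times> 'v) set \<Rightarrow> bool" where
  "filter_family F \<longleftrightarrow>
     F \<subseteq> {A. elts A \<subseteq> cells P} \<times> elts P \<and>
     (\<forall>A p q. (A, p) \<in> F \<longrightarrow> q \<sqsubseteq> p \<longrightarrow> (A, q) \<in> F) \<and>
     (\<forall>A B C p. (A, p) \<in> F \<longrightarrow> (B, p) \<in> F \<longrightarrow> elts C \<subseteq> cells P \<longrightarrow> forced_inter p A B C \<longrightarrow> (C, p) \<in> F) \<and>
     (\<forall>A p. (A, p) \<in> F \<longrightarrow> (\<exists>q i. q \<sqsubseteq> p \<and> i \<in> elts \<kappa> \<and> fmem q (ck i) A)) \<and>
     (\<forall>B j p. B \<in> elts D \<longrightarrow> j \<in> elts \<kappa> \<longrightarrow> p \<in> elts P \<longrightarrow> (ck (tail B j), p) \<in> F)"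

lemma filter_familyD:
  assumes "filter_family F"
  shows "\<And>A p. (A, p) \<in> F \<Longrightarrow> elts A \<subseteq> cells P" "\<And>A p. (A, p) \<in> F \<Longrightarrow> p \<in> elts P"
    and "\<And>A p q. (A, p) \<in> F \<Longrightarrow> q \<sqsubseteq> p \<Longrightarrow> (A, q) \<in> F"
    and "\<And>A B C p. (A, p) \<in> F \<Longrightarrow> (B, p) \<in> F \<Longrightarrow> elts C \<subseteq> cells P \<Longrightarrow> forced_inter p A B C \<Longrightarrow> (C, p) \<in> F"
    and "\<And>A p. (A, p) \<in> F \<Longrightarrow> \<exists>q i. q \<sqsubseteq> p \<and> i \<in> elts \<kappa> \<and> fmem q (ck i) A"
    and "\<And>B j p. B \<in> elts D \<Longrightarrow> j \<in> elts \<kappa> \<Longrightarrow> p \<in> elts P \<Longrightarrow> (ck (tail B j), p) \<in> F"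
  using assms unfolding filter_family_def by (blast, blast, blast, blast, blast, blast)

lemma filter_familyI:
  assumes "\<And>A p. (A, p) \<in> F \<Longrightarrow> elts A \<subseteq> cells P" "\<And>A p. (A, p) \<in> F \<Longrightarrow> p \<in> elts P"
    and "\<And>A p q. (A, p) \<in> F \<Longrightarrow> q \<sqsubseteq> p \<Longrightarrow> (A, q) \<in> F"
    and "\<And>A B C p. (A, p) \<in> F \<Longrightarrow> (B, p) \<in> F \<Longrightarrow> elts C \<subseteq> cells P \<Longrightarrow> forced_inter p A B C \<Longrightarrow> (C, p) \<in> F"
    and "\<And>A p. (A, p) \<in> F \<Longrightarrow> \<exists>q i. q \<sqsubseteq> p \<and> i \<in> elts \<kappa> \<and> fmem q (ck i) A"
    and "\<And>B j p. B \<in> elts D \<Longrightarrow> j \<in> elts \<kappa> \<Longrightarrow> p \<in> elts P \<Longrightarrow> (ck (tail B j), p) \<in> F"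
  shows "filter_family F"
  unfolding filter_family_def
proof (intro conjI allI impI)
  show "F \<subseteq> {A. elts A \<subseteq> cells P} \<times> elts P" using assms(1,2) by auto
qed (fact assms(3-6))+

lemma forced_interD:
  "forced_inter p A B C \<Longrightarrow> q \<sqsubseteq> p \<Longrightarrow> i \<in> elts \<kappa> \<Longrightarrow> fmem q (ck i) A \<Longrightarrow> fmem q (ck i) B \<Longrightarrow> fmem q (ck i) C"
  unfolding forced_inter_def by blast

lemma forced_inter_mono: "forced_inter p A B C \<Longrightarrow> q \<sqsubseteq> p \<Longrightarrow> forced_inter q A B C"
  unfolding forced_inter_def using below_trans by blast

text \<open>The starting point for Zorn's lemma: all names forced to include a tail of some member
  of \<open>D\<close>. Tails are closed under intersection by intersecting the sets and taking the
  larger bound; they are nonempty by \<open>D_unbounded\<close>.\<close>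

lemma filter_family_exists: "\<exists>F. filter_family F"
proof
  let ?R = "\<lambda>C p B j. B \<in> elts D \<and> j \<in> elts \<kappa> \<and> forced_inter p (ck (tail B j)) (ck (tail B j)) C"
  let ?F = "{(C, p). elts C \<subseteq> cells P \<and> p \<in> elts P \<and> (\<exists>B j. ?R C p B j)}"
  show "filter_family ?F"
  proof (rule filter_familyI)
    fix A p q assume "(A, p) \<in> ?F" "q \<sqsubseteq> p"
    then show "(A, q) \<in> ?F" using forced_inter_mono below_P by blast
  next
    fix A A' C p assume "(A, p) \<in> ?F" "(A', p) \<in> ?F" and C: "elts C \<subseteq> cells P" "forced_inter p A A' C"
    then obtain B j B' j' where 1: "?R A p B j" and 2: "?R A' p B' j'" and p: "p \<in> elts P" by blast
    obtain B'' where B'': "B'' \<in> elts D" "elts B'' = elts B \<inter> elts B'"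
      using D_filter 1 2 unfolding filter_on_def by blast
    \<comment> \<open>The larger of \<open>j\<close> and \<open>j'\<close>.\<close>
    obtain j'' where j'': "j'' \<in> elts \<kappa>" "elts j \<subseteq> elts j''" "elts j' \<subseteq> elts j''" "j'' = j \<or> j'' = j'"
      using Ord_linear[of j j'] Ord_subset_iff[of j j'] Ord_subset_iff[of j' j] Ord_elts Ord_\<kappa> 1 2 by blast
    have tails: "elts (tail B'' j'') \<subseteq> elts (tail B j) \<inter> elts (tail B' j')"
    proof
      fix i assume "i \<in> elts (tail B'' j'')"
      then have i: "i \<in> elts B" "i \<in> elts B'" "j'' \<in> elts i" unfolding elts_tail B''(2) by blast+
      have "Ord i" using i D_sub 1 Ord_elts Ord_\<kappa> by blast
      have "j \<in> elts j'' \<or> j = j''" "j' \<in> elts j'' \<or> j' = j''"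
        using j'' 1 2 Ord_subset_iff Ord_elts Ord_\<kappa> by blast+
      then have "j \<in> elts i" "j' \<in> elts i" using i(3) Ord_trans \<open>Ord i\<close> by blast+
      then show "i \<in> elts (tail B j) \<inter> elts (tail B' j')" using i unfolding elts_tail by blast
    qed
    have "forced_inter p (ck (tail B'' j'')) (ck (tail B'' j'')) C"
      unfolding forced_inter_def
    proof (intro allI impI)
      fix q i assume q: "q \<sqsubseteq> p" "i \<in> elts \<kappa>" "fmem q (ck i) (ck (tail B'' j''))"
      then have qP: "q \<in> elts P" using below_P by blast
      then have "i \<in> elts (tail B j)" "i \<in> elts (tail B' j')" using q tails fmem_ck_iff by blast+
      then have "fmem q (ck i) (ck (tail B j))" "fmem q (ck i) (ck (tail B' j'))" using fmem_ckI qP by blast+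
      then have "fmem q (ck i) A" "fmem q (ck i) A'" using forced_interD 1 2 q by blast+
      then show "fmem q (ck i) C" using forced_interD C(2) q by blast
    qed
    then show "(C, p) \<in> ?F" using C(1) p B''(1) j''(1) by blast
  next
    fix A p assume "(A, p) \<in> ?F"
    then obtain B j where 1: "?R A p B j" and p: "p \<in> elts P" by blast
    obtain i where i: "i \<in> elts B" "j \<in> elts i" using D_unbounded 1 by blast
    then have "i \<in> elts \<kappa>" using D_sub 1 by blast
    moreover have "fmem p (ck i) (ck (tail B j))" using i p by (simp add: fmem_ck_iff elts_tail)
    ultimately show "\<exists>q i. q \<sqsubseteq> p \<and> i \<in> elts \<kappa> \<and> fmem q (ck i) A"
      using forced_interD 1 below_refl[OF p] by blast
  next
    fix B j p assume "B \<in> elts D" "j \<in> elts \<kappa>" "p \<in> elts P"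
    moreover then have "elts (ck (tail B j)) \<subseteq> cells P"
      using D_sub by (intro ck_cells) (auto simp: elts_tail)
    ultimately show "(ck (tail B j), p) \<in> ?F" unfolding forced_inter_def by blast
  qed auto
qed

lemma filter_family_Union:
  assumes "\<C> \<noteq> {}" "subset.chain {F. filter_family F} \<C>"
  shows "filter_family (\<Union>\<C>)"
proof -
  have ff: "F \<in> \<C> \<Longrightarrow> filter_family F" for F
    using assms(2) unfolding subset_chain_def by blast
  note D = filter_familyD[OF ff]
  show ?thesis
  proof (rule filter_familyI)
    fix A p assume "(A, p) \<in> \<Union>\<C>"
    then obtain F where F: "F \<in> \<C>" "(A, p) \<in> F" by blast
    show "elts A \<subseteq> cells P" using D(1)[OF F] .
    show "p \<in> elts P" using D(2)[OF F] .
    show "\<exists>q i. q \<sqsubseteq> p \<and> i \<in> elts \<kappa> \<and> fmem q (ck i) A" using D(5)[OF F] .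
    show "(A, q) \<in> \<Union>\<C>" if "q \<sqsubseteq> p" for q using D(3)[OF F that] F(1) by blast
  next
    fix A B C p assume "(A, p) \<in> \<Union>\<C>" "(B, p) \<in> \<Union>\<C>" and C: "elts C \<subseteq> cells P" "forced_inter p A B C"
    then obtain F F' where F: "F \<in> \<C>" "F' \<in> \<C>" "(A, p) \<in> F" "(B, p) \<in> F'" by blast
    then have "F \<subseteq> F' \<or> F' \<subseteq> F" using assms(2) unfolding subset_chain_def by blast
    then obtain G where G: "G \<in> \<C>" "(A, p) \<in> G" "(B, p) \<in> G" using F by blast
    show "(C, p) \<in> \<Union>\<C>" using D(4)[OF G C] G(1) by blast
  next
    fix B j p assume "B \<in> elts D" "j \<in> elts \<kappa>" "p \<in> elts P"
    then show "(ck (tail B j), p) \<in> \<Union>\<C>" using D(6) assms(1) by blast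
  qed
qed

text \<open>The premise on \<open>B\<close> says that it includes the complement of
  \<open>A\<close>. If neither enters a maximal \<open>F\<close> below \<open>p\<close>, adjoining
  \<open>A\<close> below \<open>p\<close> must destroy properness. So some \<open>E\<close> in
  \<open>F\<close> is forced disjoint from \<open>A\<close>, hence forced into \<open>B\<close>, and
  closure upwards puts \<open>B\<close> into \<open>F\<close> after all.\<close>

lemma ultrafilter_family_exists:
  obtains F where "filter_family F"
    "\<And>A B p. elts A \<subseteq> cells P \<Longrightarrow> elts B \<subseteq> cells P \<Longrightarrow> p \<in> elts P \<Longrightarrow>
      (\<And>q i. q \<sqsubseteq> p \<Longrightarrow> i \<in> elts \<kappa> \<Longrightarrow> (\<And>r. r \<sqsubseteq> q \<Longrightarrow> \<not> fmem r (ck i) A) \<Longrightarrow> fmem q (ck i) B) \<Longrightarrow>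
      \<exists>q. q \<sqsubseteq> p \<and> ((A, q) \<in> F \<or> (B, q) \<in> F)"
proof -
  have "\<exists>F\<in>{F. filter_family F}. \<forall>G\<in>{F. filter_family F}. F \<subseteq> G \<longrightarrow> G = F"
    by (rule subset_Zorn_nonempty) (use filter_family_exists filter_family_Union in auto)
  then obtain F where F: "filter_family F" and max: "\<And>G. filter_family G \<Longrightarrow> F \<subseteq> G \<Longrightarrow> G = F" by blast
  note D = filter_familyD[OF F]
  have "\<exists>q. q \<sqsubseteq> p \<and> ((A, q) \<in> F \<or> (B, q) \<in> F)"
    if A: "elts A \<subseteq> cells P" and B: "elts B \<subseteq> cells P" and p: "p \<in> elts P"
      and compl: "\<And>q i. q \<sqsubseteq> p \<Longrightarrow> i \<in> elts \<kappa> \<Longrightarrow> (\<And>r. r \<sqsubseteq> q \<Longrightarrow> \<not> fmem r (ck i) A) \<Longrightarrow> fmem q (ck i) B"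
    for A B p
  proof (rule ccontr)
    assume no: "\<not> (\<exists>q. q \<sqsubseteq> p \<and> ((A, q) \<in> F \<or> (B, q) \<in> F))"
    let ?R = "\<lambda>C r E. (E, r) \<in> F \<and> forced_inter r A E C"
    \<comment> \<open>The filter generated by \<open>F\<close> and \<open>A\<close>, taken only
      below \<open>p\<close>; elsewhere it stays \<open>F\<close>.\<close>
    define G where "G = F \<union> {(C, r). elts C \<subseteq> cells P \<and> r \<sqsubseteq> p \<and> (\<exists>E. ?R C r E)}"
    have G: "(C, r) \<in> G \<longleftrightarrow> (C, r) \<in> F \<or> elts C \<subseteq> cells P \<and> r \<sqsubseteq> p \<and> (\<exists>E. ?R C r E)" for C r
      unfolding G_def by simp
    \<comment> \<open>Old members also have the new form: \<open>C\<close> itself serves as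
      \<open>E\<close>.\<close>
    have inG: "\<exists>E. ?R C r E" if C: "(C, r) \<in> G" and "r \<sqsubseteq> p" for C r
    proof (cases "(C, r) \<in> F")
      case True
      then show ?thesis unfolding forced_inter_def by blast
    next
      case False
      then show ?thesis using C G by blast
    qed
    \<comment> \<open>Any member of \<open>F\<close> at \<open>p\<close> can play \<open>E\<close>
      here; \<open>cf \<mu>\<close> is just an available element of \<kappa>.\<close>
    have "(ck (tail \<kappa> (cf \<mu>)), p) \<in> F" using D(6) \<kappa>_D cf_\<kappa> p by blast
    moreover have "forced_inter p A (ck (tail \<kappa> (cf \<mu>))) A" unfolding forced_inter_def by blast
    ultimately have "(A, p) \<in> G" unfolding G using A below_refl[OF p] by blast
    moreover have "(A, p) \<notin> F" using no below_refl[OF p] by blast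
    ultimately have "G \<noteq> F" by blast
    moreover have "F \<subseteq> G" unfolding G_def by blast
    ultimately have "\<not> filter_family G" using max by blast
    \<comment> \<open>Only properness can fail for \<open>G\<close>, and \<open>ne\<close> is
      exactly what it takes. As \<open>G\<close> is not a filter family by maximality,
      \<open>ne\<close> fails, which produces \<open>E\<close>.\<close>
    moreover have "filter_family G" if ne: "\<And>r E. r \<sqsubseteq> p \<Longrightarrow> (E, r) \<in> F \<Longrightarrow>
        \<exists>q i. q \<sqsubseteq> r \<and> i \<in> elts \<kappa> \<and> fmem q (ck i) A \<and> fmem q (ck i) E"
    proof (rule filter_familyI)
      fix C r assume Cr: "(C, r) \<in> G"
      show "elts C \<subseteq> cells P" using Cr D(1) G by blast
      show "r \<in> elts P" using Cr D(2) below_P G by blast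
      show "\<exists>q i. q \<sqsubseteq> r \<and> i \<in> elts \<kappa> \<and> fmem q (ck i) C"
      proof (cases "(C, r) \<in> F")
        case True
        then show ?thesis using D(5) by blast
      next
        case False
        then obtain E where E: "r \<sqsubseteq> p" "?R C r E" using Cr G by blast
        then obtain q i where "q \<sqsubseteq> r" "i \<in> elts \<kappa>" "fmem q (ck i) A" "fmem q (ck i) E" using ne by blast
        then show ?thesis using E forced_interD by blast
      qed
      show "(C, q) \<in> G" if q: "q \<sqsubseteq> r" for q
      proof (cases "(C, r) \<in> F")
        case True
        then show ?thesis using D(3) q G by blast
      next
        case False
        then obtain E where E: "r \<sqsubseteq> p" "?R C r E" "elts C \<subseteq> cells P" using Cr G by blast
        then have "?R C q E" "q \<sqsubseteq> p" using D(3) q forced_inter_mono below_trans by blast+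
        then show ?thesis unfolding G using E by blast
      qed
    next
      fix C C' C'' r assume C: "(C, r) \<in> G" "(C', r) \<in> G" "elts C'' \<subseteq> cells P" "forced_inter r C C' C''"
      show "(C'', r) \<in> G"
      proof (cases "r \<sqsubseteq> p")
        case True
        obtain E E' where E: "?R C r E" "?R C' r E'" using inG[OF C(1) True] inG[OF C(2) True] by blast
        \<comment> \<open>A nice name for the intersection of \<open>E\<close> and
          \<open>E'\<close>, needed as a single witness for \<open>C''\<close>.\<close>
        define E'' where "E'' = nice (\<lambda>i s. fmem s (ck i) E \<and> fmem s (ck i) E')"
        have E'': "q \<in> elts P \<Longrightarrow> fmem q (ck i) E'' \<longleftrightarrow> i \<in> elts \<kappa> \<and> fmem q (ck i) E \<and> fmem q (ck i) E'" for q i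
          unfolding E''_def
        proof (rule fmem_nice)
          fix i s assume "\<And>r. r \<sqsubseteq> s \<Longrightarrow> \<exists>q. q \<sqsubseteq> r \<and> fmem q (ck i) E \<and> fmem q (ck i) E'"
          then show "fmem s (ck i) E \<and> fmem s (ck i) E'"
            using fmem_dense[of s "ck i" E] fmem_dense[of s "ck i" E'] by blast
        qed (use fmem_mono in blast)+
        have "forced_inter r E E' E''" unfolding forced_inter_def using E'' below_P by blast
        then have "(E'', r) \<in> F" using D(4) E nice_cells unfolding E''_def by blast
        moreover have "forced_inter r A E'' C''"
          unfolding forced_inter_def
        proof (intro allI impI)
          fix q i assume q: "q \<sqsubseteq> r" "i \<in> elts \<kappa>" "fmem q (ck i) A" "fmem q (ck i) E''"
          then have "fmem q (ck i) E" "fmem q (ck i) E'" using E'' below_P by blast+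
          then have "fmem q (ck i) C" "fmem q (ck i) C'" using E forced_interD q by blast+
          then show "fmem q (ck i) C''" using forced_interD C(4) q by blast
        qed
        ultimately show ?thesis unfolding G using True C(3) by blast
      next
        case False
        then have "(C, r) \<in> F" "(C', r) \<in> F" using C G by blast+
        then show ?thesis unfolding G using D(4) C(3,4) by blast
      qed
    next
      fix B j p assume "B \<in> elts D" "j \<in> elts \<kappa>" "p \<in> elts P"
      then show "(ck (tail B j), p) \<in> G" using D(6) G by blast
    qed
    ultimately obtain r E where r: "r \<sqsubseteq> p" "(E, r) \<in> F"
      and empty: "\<And>q i. q \<sqsubseteq> r \<Longrightarrow> i \<in> elts \<kappa> \<Longrightarrow> fmem q (ck i) A \<Longrightarrow> fmem q (ck i) E \<Longrightarrow> False"
      by blast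
    have "forced_inter r E E B"
      unfolding forced_inter_def
    proof (intro allI impI)
      fix q i assume q: "q \<sqsubseteq> r" "i \<in> elts \<kappa>" "fmem q (ck i) E"
      have "\<not> fmem s (ck i) A" if s: "s \<sqsubseteq> q" for s
        using empty[of s i] q s fmem_mono below_trans by blast
      then show "fmem q (ck i) B" using compl q r(1) below_trans by blast
    qed
    then have "(B, r) \<in> F" using D(4) r B by blast
    then show False using no r by blast
  qed
  then show ?thesis using that F by blast
qed

section \<open>Unbounded sets have size \<open>\<kappa>\<close>\<close>

text \<open>Below some condition \<open>A\<close> has the size of an ordinal \<theta> \<le>
  \<kappa>. If \<theta> < \<kappa>, each \<xi> < \<theta> has fewer than \<kappa> possible preimages
  under a bijection of \<open>A\<close> with \<theta>, so regularity of \<kappa> in the ground model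
  bounds all of them, and with them \<open>A\<close>.\<close>

lemma unbounded_eqpoll:
  assumes A: "name A" "p \<tturnstile> (A \<^bold>\<subseteq> ck \<kappa>)"
    and unb: "\<And>j q. j \<in> elts \<kappa> \<Longrightarrow> q \<sqsubseteq> p \<Longrightarrow> \<exists>r i. r \<sqsubseteq> q \<and> i \<in> elts \<kappa> \<and> j \<in> elts i \<and> fmem r (ck i) A"
  shows "p \<tturnstile> eqpoll_fm A (ck \<kappa>)"
proof (rule forces_dense)
  fix p' assume p': "p' \<sqsubseteq> p"
  have ckinj: "inj ck" by (rule injI) (use feq_ck[OF one_P] in \<open>metis feq_refl\<close>)
  have cover: "\<And>x q. name x \<Longrightarrow> q \<sqsubseteq> p' \<Longrightarrow> fmem q x A \<Longrightarrow> \<exists>r B. r \<sqsubseteq> q \<and> B \<in> ck ` elts \<kappa> \<and> feq r x B"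
    using forces_sub_\<kappa>E[OF A(2)] p' below_trans by (metis imageI)
  have "\<exists>q \<theta>. q \<sqsubseteq> p' \<and> Ord \<theta> \<and> (\<theta> \<in> elts \<kappa> \<or> \<theta> = \<kappa>) \<and> q \<tturnstile> eqpoll_fm A (ck \<theta>)"
  proof (rule enumerated_name(2))
    show "small (ck ` elts \<kappa>)" by (rule small_image) simp
    show "inj_on (inv ck) (ck ` elts \<kappa>)" by (rule inj_on_inv_into) blast
    show "inv ck B \<in> elts \<kappa>" if "B \<in> ck ` elts \<kappa>" for B using that ckinj by auto
  qed (use A(1) Ord_\<kappa> below_P(1)[OF p'] cover name_ck in blast)+
  then obtain q \<theta> where q: "q \<sqsubseteq> p'" "Ord \<theta>" "\<theta> \<in> elts \<kappa> \<or> \<theta> = \<kappa>" "q \<tturnstile> eqpoll_fm A (ck \<theta>)"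
    by blast
  have "\<theta> \<notin> elts \<kappa>"
  proof
    assume \<theta>: "\<theta> \<in> elts \<kappa>"
    from q(4) A(1) name_ck below_self[OF q(1)]
    obtain q' f where q': "q' \<sqsubseteq> q" "name f" "fbij q' f A (ck \<theta>)" by (rule forces_eqpollE)
    have fi: "finj q' f A (ck \<theta>)" using q'(3) by (rule fbij_finj)
    \<comment> \<open>The candidates for the preimage of \<xi>, over all conditions below
      \<open>q'\<close>.\<close>
    define S where "S = (\<lambda>\<xi>. {j \<in> elts \<kappa>. \<exists>s. s \<sqsubseteq> q' \<and> fmem s (opn (ck j) (ck \<xi>)) f})"
    have "\<exists>b\<in>elts \<kappa>. \<forall>j\<in>S \<xi>. j \<in> elts b" for \<xi>
    proof -
      have "\<forall>j\<in>S \<xi>. \<exists>s. s \<sqsubseteq> q' \<and> fmem s (opn (ck j) (ck \<xi>)) f" unfolding S_def by blast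
      then obtain s where s: "\<And>j. j \<in> S \<xi> \<Longrightarrow> s j \<sqsubseteq> q' \<and> fmem (s j) (opn (ck j) (ck \<xi>)) f" by metis
      have same: "j = j'" if "j \<in> S \<xi>" "j' \<in> S \<xi>" "r \<sqsubseteq> s j" "r \<sqsubseteq> s j'" for j j' r
      proof -
        have "fmem r (opn (ck j) (ck \<xi>)) f" "fmem r (opn (ck j') (ck \<xi>)) f" "r \<sqsubseteq> q'"
          using s that fmem_mono below_trans by blast+
        then have "feq r (ck j) (ck j')" using finj_inj[OF fi] name_ck by blast
        then show ?thesis using feq_ck that below_P by blast
      qed
      have "inj_on s (S \<xi>)" by (rule inj_onI) (metis same s below_self)
      moreover have "antichain P le (s ` S \<xi>)"
        unfolding antichain_def incompatible_def using s same below_P by blast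
      then have "s ` S \<xi> \<prec> elts (cf \<kappa>)" by (rule antichain_lesspoll_\<kappa>)
      ultimately have "S \<xi> \<prec> elts (cf \<kappa>)" by simp
      moreover have "\<And>j. j \<in> S \<xi> \<Longrightarrow> j \<in> elts \<kappa>" unfolding S_def by blast
      ultimately show ?thesis using bounded_below_cf[OF Ord_\<kappa>, of "S \<xi>" "\<lambda>j. j"] by metis
    qed
    then obtain b where b: "\<And>\<xi>. b \<xi> \<in> elts \<kappa>" "\<And>\<xi> j. j \<in> S \<xi> \<Longrightarrow> j \<in> elts (b \<xi>)" by metis
    \<comment> \<open>Regularity is used a second time: fewer than \<kappa> bounds
      \<open>b \<xi>\<close> have a common bound \<open>c\<close>.\<close>
    have "elts \<theta> \<prec> elts (cf \<kappa>)" using cf_not_lepoll[OF Ord_\<kappa>] \<theta> unfolding cf_eq by blast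
    then obtain c where c: "c \<in> elts \<kappa>" "\<And>\<xi>. \<xi> \<in> elts \<theta> \<Longrightarrow> b \<xi> \<in> elts c"
      using bounded_below_cf[OF Ord_\<kappa>, of "elts \<theta>" b] b(1) by metis
    have "q' \<sqsubseteq> p" using q' q p' below_trans by blast
    then obtain r i where r: "r \<sqsubseteq> q'" "i \<in> elts \<kappa>" "c \<in> elts i" "fmem r (ck i) A"
      using unb c(1) by blast
    then obtain r1 y where r1: "r1 \<sqsubseteq> r" "name y" "fmem r1 (opn (ck i) y) f"
      using finj_total[OF fi _ name_ck] by metis
    have r1q: "r1 \<sqsubseteq> q'" using r1 r below_trans by blast
    have "fmem r1 y (ck \<theta>)" using finj_in(2)[OF fi r1q name_ck r1(2,3)] .
    then obtain r2 \<xi> where r2: "r2 \<sqsubseteq> r1" "\<xi> \<in> elts \<theta>" "feq r2 y (ck \<xi>)"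
      using fmem_ckE r1 below_P by metis
    have "fmem r2 (opn (ck i) (ck \<xi>)) f"
      using r1(3) r2 fmem_mono fmem_cong1 opn_cong feq_refl by meson
    then have "i \<in> S \<xi>" unfolding S_def using r(2) r2(1) r1q below_trans by blast
    then have "i \<in> elts (b \<xi>)" "b \<xi> \<in> elts c" using b c r2 by blast+
    then have "i \<in> elts c" using Ord_trans Ord_elts Ord_\<kappa> c(1) by blast
    then show False using r(3) elts_asym by blast
  qed
  then show "\<exists>q. q \<sqsubseteq> p' \<and> q \<tturnstile> eqpoll_fm A (ck \<kappa>)" using q by blast
qed

end

section \<open>Forcing statements about uniform ultrafilters and the ultrafilter number\<close>

context forcing
begin

lemma forces_uniform_ultrafilterI:
  assumes sub: "\<And>A q. name A \<Longrightarrow> q \<sqsubseteq> p \<Longrightarrow> fmem q A U \<Longrightarrow> q \<tturnstile> (A \<^bold>\<subseteq> K)"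
    and top: "fmem p K U"
    and ne: "\<And>A q. name A \<Longrightarrow> q \<sqsubseteq> p \<Longrightarrow> fmem q A U \<Longrightarrow> \<exists>r x. r \<sqsubseteq> q \<and> name x \<and> fmem r x A"
    and inter: "\<And>A B C q. name A \<Longrightarrow> name B \<Longrightarrow> name C \<Longrightarrow> q \<sqsubseteq> p \<Longrightarrow> fmem q A U \<Longrightarrow> fmem q B U \<Longrightarrow>
      q \<tturnstile> inter_fm C A B \<Longrightarrow> fmem q C U"
    and up: "\<And>A B q. name A \<Longrightarrow> name B \<Longrightarrow> q \<sqsubseteq> p \<Longrightarrow> fmem q A U \<Longrightarrow> q \<tturnstile> (A \<^bold>\<subseteq> B) \<Longrightarrow>
      q \<tturnstile> (B \<^bold>\<subseteq> K) \<Longrightarrow> fmem q B U"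
    and ultra: "\<And>A B q. name A \<Longrightarrow> name B \<Longrightarrow> q \<sqsubseteq> p \<Longrightarrow> q \<tturnstile> (A \<^bold>\<subseteq> K) \<Longrightarrow> q \<tturnstile> diff_fm B K A \<Longrightarrow>
      \<exists>r. r \<sqsubseteq> q \<and> (fmem r A U \<or> fmem r B U)"
    and unif: "\<And>A q. name A \<Longrightarrow> q \<sqsubseteq> p \<Longrightarrow> fmem q A U \<Longrightarrow> q \<tturnstile> eqpoll_fm A K"
  shows "p \<tturnstile> uniform_ultrafilter_fm K U"
proof -
  have 1: "p \<tturnstile> (\<^bold>\<forall>A. A \<^bold>\<in> U \<^bold>\<longrightarrow> A \<^bold>\<subseteq> K)"
    unfolding forces.simps(1,5) forces_Imp using sub by blast
  have 2: "p \<tturnstile> (\<^bold>\<forall>A. A \<^bold>\<in> U \<^bold>\<longrightarrow> \<^bold>\<not> empty_fm A)"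
    unfolding forces.simps(1,3,5) forces_Imp empty_fm_def
  proof (intro allI impI notI)
    fix A q r assume A: "name A" "q \<sqsubseteq> p" "fmem q A U" "r \<sqsubseteq> q"
      and e: "\<forall>\<tau>. name \<tau> \<longrightarrow> (\<forall>q. q \<sqsubseteq> r \<longrightarrow> \<not> fmem q \<tau> A)"
    have "r \<sqsubseteq> p" "fmem r A U" using A below_trans fmem_mono by blast+
    then show False using ne[OF A(1)] e by blast
  qed
  have 3: "p \<tturnstile> (\<^bold>\<forall>A. \<^bold>\<forall>B. \<^bold>\<forall>C. A \<^bold>\<in> U \<^bold>\<and> B \<^bold>\<in> U \<^bold>\<and> inter_fm C A B \<^bold>\<longrightarrow> C \<^bold>\<in> U)"
    unfolding forces.simps(1,4,5) forces_Imp using inter by blast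
  have 4: "p \<tturnstile> (\<^bold>\<forall>A. \<^bold>\<forall>B. A \<^bold>\<in> U \<^bold>\<and> A \<^bold>\<subseteq> B \<^bold>\<and> B \<^bold>\<subseteq> K \<^bold>\<longrightarrow> B \<^bold>\<in> U)"
    unfolding forces.simps(1,4,5) forces_Imp using up by blast
  have 5: "p \<tturnstile> (\<^bold>\<forall>A. \<^bold>\<forall>B. A \<^bold>\<subseteq> K \<^bold>\<and> diff_fm B K A \<^bold>\<longrightarrow> A \<^bold>\<in> U \<^bold>\<or> B \<^bold>\<in> U)"
    unfolding forces.simps(1,4,5) forces_Imp forces_Disj
  proof (intro allI impI)
    fix A B q r assume a: "name A" "name B" "q \<sqsubseteq> p" "q \<tturnstile> (A \<^bold>\<subseteq> K) \<and> q \<tturnstile> diff_fm B K A" "r \<sqsubseteq> q"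
    then have "r \<sqsubseteq> p" "r \<tturnstile> (A \<^bold>\<subseteq> K)" "r \<tturnstile> diff_fm B K A" using below_trans forces_mono by blast+
    then show "\<exists>s. s \<sqsubseteq> r \<and> (fmem s A U \<or> fmem s B U)" using ultra a(1,2) by blast
  qed
  have 6: "p \<tturnstile> (\<^bold>\<forall>A. A \<^bold>\<in> U \<^bold>\<longrightarrow> eqpoll_fm A K)"
    unfolding forces.simps(1,5) forces_Imp using unif by blast
  show ?thesis
    unfolding uniform_ultrafilter_fm_def ultrafilter_fm_def filter_fm_def
    using 1 2 3 4 5 6 top by (simp only: forces.simps(1,4))
qed

lemma forces_eqpoll_cong2:
  assumes n: "name X" "name Y" "name Y'" and eq: "p \<tturnstile> eqpoll_fm X Y" "feq p Y Y'"
  shows "p \<tturnstile> eqpoll_fm X Y'"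
proof (rule forces_dense)
  fix r assume r: "r \<sqsubseteq> p"
  from eq(1) n(1,2) r obtain q f where q: "q \<sqsubseteq> r" "name f" "fbij q f X Y" by (rule forces_eqpollE)
  have "feq q Y Y'" using eq(2) r q(1) feq_mono by blast
  then have "fbij q f X Y'" using fbij_cong2 q(3) by blast
  then show "\<exists>q. q \<sqsubseteq> r \<and> q \<tturnstile> eqpoll_fm X Y'" using forces_eqpollI n q by blast
qed

lemma forces_eqpoll_trans_sym:
  assumes n: "name X" "name Y" "name Z" and eq: "p \<tturnstile> eqpoll_fm X Z" "p \<tturnstile> eqpoll_fm Y Z"
  shows "p \<tturnstile> eqpoll_fm X Y"
proof (rule forces_dense)
  fix r assume r: "r \<sqsubseteq> p"
  from eq(1) n(1,3) r obtain q f where q: "q \<sqsubseteq> r" "name f" "fbij q f X Z" by (rule forces_eqpollE)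
  have "q \<sqsubseteq> p" using q r below_trans by blast
  with eq(2) n(2,3) obtain q' g where q': "q' \<sqsubseteq> q" "name g" "fbij q' g Y Z" by (rule forces_eqpollE)
  have "q' \<tturnstile> eqpoll_fm X Y"
    using fbij_compose_converse[OF n(1,2) q(2) q'(2) _ fbij_mono[OF q(3) q'(1)] q'(3)] q'(1) below_P by blast
  then show "\<exists>q. q \<sqsubseteq> r \<and> q \<tturnstile> eqpoll_fm X Y" using q q' below_trans by blast
qed

text \<open>Ordinals of the extension are ordinals of the ground model, so the ultrafilter number is, below
  some condition, the least \<open>\<nu>\<close> that any condition below \<open>p\<close> forces to be the size of a generating
  family.\<close>

lemma forces_ultrafilter_number:
  assumes K: "name K" and U: "name U" "name X" "p \<tturnstile> uniform_ultrafilter_fm K U" "p \<tturnstile> generates_fm K X U"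
    "p \<tturnstile> eqpoll_fm X (ck \<theta>)" and \<theta>: "Ord \<theta>" and p: "p \<in> elts P"
  shows "\<exists>q \<nu>. q \<sqsubseteq> p \<and> Ord \<nu> \<and> (\<nu> \<in> elts \<theta> \<or> \<nu> = \<theta>) \<and> q \<tturnstile> ultrafilter_number_fm K (ck \<nu>)"
proof -
  define gen where "gen = (\<lambda>q \<nu>. \<exists>U X. name U \<and> name X \<and> q \<tturnstile> uniform_ultrafilter_fm K U \<and>
      q \<tturnstile> generates_fm K X U \<and> q \<tturnstile> eqpoll_fm X \<nu>)"
  have gen_mono: "gen q \<nu> \<Longrightarrow> r \<sqsubseteq> q \<Longrightarrow> gen r \<nu>" for q \<nu> r
    unfolding gen_def using forces_mono by blast
  define \<psi> where "\<psi> = (\<lambda>\<nu>. \<^bold>\<exists>U. \<^bold>\<exists>X. uniform_ultrafilter_fm K U \<^bold>\<and> generates_fm K X U \<^bold>\<and> eqpoll_fm X \<nu>)"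
  have gen_I: "q \<tturnstile> \<psi> \<nu>" if g: "gen q \<nu>" for q \<nu>
  proof -
    obtain U X where "name U" "name X" "q \<tturnstile> uniform_ultrafilter_fm K U"
      "q \<tturnstile> generates_fm K X U" "q \<tturnstile> eqpoll_fm X \<nu>" using g unfolding gen_def by blast
    then show ?thesis
      unfolding \<psi>_def
      by (intro forces_ExistsI[where \<tau> = U] forces_ExistsI[where \<tau> = X]) (simp_all only: forces.simps(4))
  qed
  have gen_E: "\<exists>r. r \<sqsubseteq> q \<and> gen r \<nu>" if g: "q \<tturnstile> \<psi> \<nu>" and q: "q \<in> elts P" for q \<nu>
  proof -
    from g[unfolded \<psi>_def] below_refl[OF q] obtain r U where r: "r \<sqsubseteq> q" "name U"
      "r \<tturnstile> (\<^bold>\<exists>X. uniform_ultrafilter_fm K U \<^bold>\<and> generates_fm K X U \<^bold>\<and> eqpoll_fm X \<nu>)"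
      by (rule forces_ExistsE)
    from r(3) below_self[OF r(1)] obtain s X where s: "s \<sqsubseteq> r" "name X"
      "s \<tturnstile> (uniform_ultrafilter_fm K U \<^bold>\<and> generates_fm K X U \<^bold>\<and> eqpoll_fm X \<nu>)"
      by (rule forces_ExistsE)
    have "gen s \<nu>" unfolding gen_def using r(2) s(2,3) unfolding forces.simps(4) by blast
    then show ?thesis using r s below_trans by blast
  qed
  define Q where "Q = (\<lambda>\<nu>. \<exists>q. q \<sqsubseteq> p \<and> gen q (ck \<nu>))"
  have "Q \<theta>" unfolding Q_def gen_def using U below_refl[OF p] by blast
  then obtain \<nu> where \<nu>: "Ord \<nu>" "Q \<nu>" "\<And>\<gamma>. \<gamma> \<in> elts \<nu> \<Longrightarrow> \<not> Q \<gamma>"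
    using Ord_least_exists[of \<theta> Q] \<theta> by blast
  have "\<theta> \<notin> elts \<nu>" using \<nu>(3) \<open>Q \<theta>\<close> by blast
  then have le: "\<nu> \<in> elts \<theta> \<or> \<nu> = \<theta>" using Ord_linear \<theta> \<nu>(1) by blast
  obtain q where q: "q \<sqsubseteq> p" "gen q (ck \<nu>)" using \<nu>(2) unfolding Q_def by blast
  \<comment> \<open>A smaller ordinal of the same size as \<nu> would, below some condition, be the
    check name of some \<xi> in \<nu> and the size of a generating family, against the choice of
    \<nu>.\<close>
  have "q \<tturnstile> card_fm (ck \<nu>)"
    unfolding card_fm_def forces.simps(1,3,4,5) forces_Imp forces_ord
  proof (intro conjI allI impI notI)
    show "ford q (ck \<nu>)" using ford_ck \<nu>(1) by blast
    fix \<alpha> r s assume a: "name \<alpha>" "r \<sqsubseteq> q" "fmem r \<alpha> (ck \<nu>)" "s \<sqsubseteq> r" "s \<tturnstile> eqpoll_fm \<alpha> (ck \<nu>)"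
    have "fmem s \<alpha> (ck \<nu>)" "s \<in> elts P" using a fmem_mono below_P by blast+
    then obtain t \<xi> where t: "t \<sqsubseteq> s" "\<xi> \<in> elts \<nu>" "feq t \<alpha> (ck \<xi>)" using fmem_ckE by metis
    have tq: "t \<sqsubseteq> q" using t a below_trans by blast
    obtain U X where UX: "name U" "name X" "t \<tturnstile> uniform_ultrafilter_fm K U" "t \<tturnstile> generates_fm K X U"
      "t \<tturnstile> eqpoll_fm X (ck \<nu>)" using gen_mono[OF q(2) tq] unfolding gen_def by blast
    have "t \<tturnstile> eqpoll_fm \<alpha> (ck \<nu>)" using a(5) t(1) by (rule forces_mono)
    then have "t \<tturnstile> eqpoll_fm X \<alpha>" using forces_eqpoll_trans_sym UX a(1) name_ck by blast
    then have "t \<tturnstile> eqpoll_fm X (ck \<xi>)" using forces_eqpoll_cong2 UX a(1) name_ck t(3) by blast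
    then have "Q \<xi>" unfolding Q_def gen_def using UX tq q(1) below_trans by blast
    then show False using \<nu>(3) t(2) by blast
  qed
  then have gc: "q \<tturnstile> generating_card_fm K (ck \<nu>)"
    unfolding generating_card_fm_def using gen_I[OF q(2)] unfolding \<psi>_def by (simp only: forces.simps(4))
  \<comment> \<open>A competitor becomes a check name only below a further condition. This is why
    \<nu> was chosen minimal over all conditions below \<open>p\<close> and not just for
    \<open>q\<close>.\<close>
  have "q \<tturnstile> (\<^bold>\<forall>\<nu>'. generating_card_fm K \<nu>' \<^bold>\<longrightarrow> ord_le_fm (ck \<nu>) \<nu>')"
  proof (rule forces_Forall_ImpI, rule forces_dense)
    fix \<nu>' r s assume a: "name \<nu>'" "r \<sqsubseteq> q" "r \<tturnstile> generating_card_fm K \<nu>'" "s \<sqsubseteq> r"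
    have sP: "s \<in> elts P" using a(4) below_P by blast
    have "s \<tturnstile> generating_card_fm K \<nu>'" using a(3,4) by (rule forces_mono)
    then have o: "ford s \<nu>'" and g: "s \<tturnstile> \<psi> \<nu>'"
      unfolding generating_card_fm_def card_fm_def \<psi>_def forces_ord[symmetric]
      by (simp_all only: forces.simps(4))
    obtain t \<alpha> where t: "t \<sqsubseteq> s" "Ord \<alpha>" "feq t \<nu>' (ck \<alpha>)" using ford_is_check[OF a(1) sP o] by blast
    have "t \<tturnstile> \<psi> \<nu>'" "t \<in> elts P" using g t(1) forces_mono below_P by blast+
    then obtain u where u: "u \<sqsubseteq> t" "gen u \<nu>'" using gen_E by blast
    have ueq: "feq u \<nu>' (ck \<alpha>)" using t(3) u(1) by (rule feq_mono)
    obtain U X where UX: "name U" "name X" "u \<tturnstile> uniform_ultrafilter_fm K U" "u \<tturnstile> generates_fm K X U"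
      "u \<tturnstile> eqpoll_fm X \<nu>'" using u(2) unfolding gen_def by blast
    then have "u \<tturnstile> eqpoll_fm X (ck \<alpha>)" using forces_eqpoll_cong2 a(1) name_ck ueq by blast
    then have "gen u (ck \<alpha>)" unfolding gen_def using UX by blast
    moreover have "u \<sqsubseteq> p" "u \<sqsubseteq> s" using u t a q(1) below_trans by blast+
    ultimately have "Q \<alpha>" unfolding Q_def by blast
    then have "\<nu> \<in> elts \<alpha> \<or> \<nu> = \<alpha>" using \<nu> Ord_linear t(2) by blast
    moreover have uP: "u \<in> elts P" using u below_P by blast
    ultimately have "fmem u (ck \<nu>) \<nu>' \<or> feq u (ck \<nu>) \<nu>'"
      using fmem_ckI[OF _ uP] fmem_cong2 feq_sym[OF ueq] by blast
    then have "u \<tturnstile> ord_le_fm (ck \<nu>) \<nu>'"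
      unfolding ord_le_fm_def forces_Disj forces.simps(1,2) using fmem_mono feq_mono below_self by blast
    then show "\<exists>t. t \<sqsubseteq> s \<and> t \<tturnstile> ord_le_fm (ck \<nu>) \<nu>'" using \<open>u \<sqsubseteq> s\<close> by blast
  qed
  then have "q \<tturnstile> ultrafilter_number_fm K (ck \<nu>)"
    unfolding ultrafilter_number_fm_def using gc by (simp only: forces.simps(4))
  then show ?thesis using q(1) \<nu>(1) le by blast
qed

end

section \<open>The ultrafilter name and the two conclusions\<close>

context filtered_forcing
begin

text \<open>\<open>U\<close> is the maximal family read as a name. Each filter axiom for arbitrary
  names reduces to the family by passing to an extension where members of \<open>U\<close> equal
  names in \<open>F\<close>, and by using nice names for the sets to be put in.\<close>

lemma uniform_ultrafilter_exists:
  "\<exists>U. name U \<and> one \<tturnstile> uniform_ultrafilter_fm (ck \<kappa>) U \<and> one \<tturnstile> (ck D \<^bold>\<subseteq> U)"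
proof -
  obtain F where F: "filter_family F" and ultra: "\<And>A B p. elts A \<subseteq> cells P \<Longrightarrow> elts B \<subseteq> cells P \<Longrightarrow> p \<in> elts P \<Longrightarrow>
      (\<And>q i. q \<sqsubseteq> p \<Longrightarrow> i \<in> elts \<kappa> \<Longrightarrow> (\<And>r. r \<sqsubseteq> q \<Longrightarrow> \<not> fmem r (ck i) A) \<Longrightarrow> fmem q (ck i) B) \<Longrightarrow>
      \<exists>q. q \<sqsubseteq> p \<and> ((A, q) \<in> F \<or> (B, q) \<in> F)"
    using ultrafilter_family_exists by blast
  note FD = filter_familyD[OF F]
  define U where "U = vset {vpair A p | A p. (A, p) \<in> F}"
  have "small {vpair A p | A p. (A, p) \<in> F}"
    by (rule small_subset[OF small_pairs[OF small_Pow[OF small_cells[of P]] small_elts[of P], of vpair]])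
       (use FD(1,2) in blast)
  then have eU: "elts U = {vpair A p | A p. (A, p) \<in> F}" unfolding U_def by simp
  have U: "name U" by (rule nameI) (use eU FD(1,2) name_cells in auto)
  have U_I: "(A, p) \<in> F \<Longrightarrow> fmem p A U" for A p
    by (rule fmem_elt[of _ p]) (use eU FD(2) in auto)
  have U_E: "\<exists>r A'. r \<sqsubseteq> q \<and> (A', r) \<in> F \<and> feq r A A'" if q: "q \<in> elts P" "fmem q A U" for q A
  proof -
    obtain r A' s where r: "r \<sqsubseteq> q" "vpair A' s \<in> elts U" "r \<sqsubseteq> s" "feq r A A'" using fmemE q by metis
    then have "(A', s) \<in> F" by (auto simp: eU)
    then show ?thesis using r FD(3) by blast
  qed
  have U_nice: "fmem p A U" if "(nice_of A, p) \<in> F" "name A" "p \<tturnstile> (A \<^bold>\<subseteq> ck \<kappa>)" for A p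
    using U_I[OF that(1)] feq_nice_of[OF that(2,3)] fmem_cong1 feq_sym by blast
  \<comment> \<open>\<open>B\<close> includes each of its tails; the bound \<open>cf \<mu>\<close>
    is again just some element of \<kappa>.\<close>
  have D_F: "(ck B, p) \<in> F" if B: "B \<in> elts D" and p: "p \<in> elts P" for B p
  proof -
    have "(ck (tail B (cf \<mu>)), p) \<in> F" using FD(6) B p cf_\<kappa> by blast
    moreover have "forced_inter p (ck (tail B (cf \<mu>))) (ck (tail B (cf \<mu>))) (ck B)"
      unfolding forced_inter_def by (auto simp: fmem_ck_iff elts_tail below_P(1))
    ultimately show ?thesis using FD(4) ck_cells[OF D_sub[OF B]] by blast
  qed
  have sub: "q \<tturnstile> (A \<^bold>\<subseteq> ck \<kappa>)" if A: "name A" "fmem q A U" for A q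
  proof (rule forces_dense)
    fix r assume "r \<sqsubseteq> q"
    then have "fmem r A U" "r \<in> elts P" using A fmem_mono below_P by blast+
    then obtain s A' where s: "s \<sqsubseteq> r" "(A', s) \<in> F" "feq s A A'" using U_E by blast
    have "s \<tturnstile> (A' \<^bold>\<subseteq> ck \<kappa>)" using cells_sub_\<kappa> FD(1) s by blast
    then have "s \<tturnstile> (A \<^bold>\<subseteq> ck \<kappa>)" unfolding forces_sub using s(3) feq_mono fmem_cong2 by blast
    then show "\<exists>q. q \<sqsubseteq> r \<and> q \<tturnstile> (A \<^bold>\<subseteq> ck \<kappa>)" using s by blast
  qed
  have "one \<tturnstile> uniform_ultrafilter_fm (ck \<kappa>) U"
  proof (rule forces_uniform_ultrafilterI)
    show "fmem one (ck \<kappa>) U" using U_I D_F \<kappa>_D one_P by blast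
    show "q \<tturnstile> (A \<^bold>\<subseteq> ck \<kappa>)" if "name A" "fmem q A U" for A q using sub that by blast
  next
    fix A q assume A: "name A" "q \<sqsubseteq> one" "fmem q A U"
    then obtain r A' where r: "r \<sqsubseteq> q" "(A', r) \<in> F" "feq r A A'" using U_E below_P by blast
    then obtain s i where "s \<sqsubseteq> r" "fmem s (ck i) A'" using FD(5) by blast
    then have "s \<sqsubseteq> q" "fmem s (ck i) A" using r below_trans feq_mono feq_sym fmem_cong2 by blast+
    then show "\<exists>r x. r \<sqsubseteq> q \<and> name x \<and> fmem r x A" using name_ck by blast
  next
    fix A B C q assume n: "name A" "name B" "name C" and q: "q \<sqsubseteq> one" "fmem q A U" "fmem q B U"
      and C: "q \<tturnstile> inter_fm C A B"
    have C\<kappa>: "q \<tturnstile> (C \<^bold>\<subseteq> ck \<kappa>)"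
      using sub[OF n(1) q(2)] forces_interD[OF C] unfolding forces_sub by blast
    show "fmem q C U"
    proof (rule fmem_dense)
      fix q1 assume q1: "q1 \<sqsubseteq> q"
      then obtain r A' where r: "r \<sqsubseteq> q1" "(A', r) \<in> F" "feq r A A'"
        using U_E q(2) fmem_mono below_P by metis
      have "fmem r B U" "r \<in> elts P" using q(3) q1 r(1) fmem_mono below_P by blast+
      then obtain s B' where s: "s \<sqsubseteq> r" "(B', s) \<in> F" "feq s B B'" using U_E by blast
      have sq: "s \<sqsubseteq> q" using s r q1 below_trans by blast
      have "forced_inter s A' B' (nice_of C)"
        unfolding forced_inter_def
      proof (intro allI impI)
        fix t i assume t: "t \<sqsubseteq> s" "i \<in> elts \<kappa>" "fmem t (ck i) A'" "fmem t (ck i) B'"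
        have "feq t A' A" "feq t B' B" using r s t(1) feq_mono feq_sym below_trans by meson+
        then have "fmem t (ck i) A" "fmem t (ck i) B" using t fmem_cong2 by blast+
        moreover have "t \<sqsubseteq> q" using t sq below_trans by blast
        ultimately have "fmem t (ck i) C" using forces_interD[OF C name_ck] by blast
        then show "fmem t (ck i) (nice_of C)" using fmem_nice_of t below_P by blast
      qed
      then have "(nice_of C, s) \<in> F" using FD(3,4) r s nice_cells by blast
      then have "fmem s C U" using U_nice n(3) forces_mono[OF C\<kappa> sq] by blast
      then show "\<exists>s. s \<sqsubseteq> q1 \<and> fmem s C U" using s r below_trans by blast
    qed
  next
    fix A B q assume n: "name A" "name B" and q: "q \<sqsubseteq> one" "fmem q A U"
      and AB: "q \<tturnstile> (A \<^bold>\<subseteq> B)" and B\<kappa>: "q \<tturnstile> (B \<^bold>\<subseteq> ck \<kappa>)"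
    show "fmem q B U"
    proof (rule fmem_dense)
      fix q1 assume q1: "q1 \<sqsubseteq> q"
      then obtain r A' where r: "r \<sqsubseteq> q1" "(A', r) \<in> F" "feq r A A'"
        using U_E q(2) fmem_mono below_P by metis
      have rq: "r \<sqsubseteq> q" using r q1 below_trans by blast
      have "forced_inter r A' A' (nice_of B)"
        unfolding forced_inter_def
      proof (intro allI impI)
        fix t i assume t: "t \<sqsubseteq> r" "i \<in> elts \<kappa>" "fmem t (ck i) A'"
        have "fmem t (ck i) A" using r t feq_mono feq_sym fmem_cong2 by meson
        moreover have "t \<sqsubseteq> q" using t rq below_trans by blast
        ultimately have "fmem t (ck i) B" using AB name_ck unfolding forces_sub by blast
        then show "fmem t (ck i) (nice_of B)" using fmem_nice_of t below_P by blast
      qed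
      then have "(nice_of B, r) \<in> F" using FD(4) r nice_cells by blast
      then have "fmem r B U" using U_nice n(2) forces_mono[OF B\<kappa> rq] by blast
      then show "\<exists>s. s \<sqsubseteq> q1 \<and> fmem s B U" using r by blast
    qed
  next
    fix A B q assume n: "name A" "name B" and q: "q \<sqsubseteq> one" and A\<kappa>: "q \<tturnstile> (A \<^bold>\<subseteq> ck \<kappa>)"
      and B: "q \<tturnstile> diff_fm B (ck \<kappa>) A"
    \<comment> \<open>Since \<open>B\<close> names the complement of \<open>A\<close>, a condition
      all of whose extensions fail to force \<open>i\<close> into \<open>A\<close> forces it into
      \<open>B\<close>, as \<open>ultra\<close> requires.\<close>
    have diff: "fmem r w B \<longleftrightarrow> fmem r w (ck \<kappa>) \<and> (\<forall>s. s \<sqsubseteq> r \<longrightarrow> \<not> fmem s w A)"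
      if "r \<sqsubseteq> q" "name w" for r w
      using B that unfolding diff_fm_def by simp
    have B\<kappa>: "q \<tturnstile> (B \<^bold>\<subseteq> ck \<kappa>)" unfolding forces_sub using diff by blast
    have "\<exists>r. r \<sqsubseteq> q \<and> ((nice_of A, r) \<in> F \<or> (nice_of B, r) \<in> F)"
    proof (rule ultra[OF nice_cells nice_cells])
      show "q \<in> elts P" using q below_P by blast
      fix r i assume r: "r \<sqsubseteq> q" "i \<in> elts \<kappa>" "\<And>s. s \<sqsubseteq> r \<Longrightarrow> \<not> fmem s (ck i) (nice_of A)"
      have "\<forall>s. s \<sqsubseteq> r \<longrightarrow> \<not> fmem s (ck i) A" using r(2,3) fmem_nice_of below_P by blast
      then have "fmem r (ck i) B" using diff[OF r(1) name_ck] fmem_ckI r(1,2) below_P by blast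
      then show "fmem r (ck i) (nice_of B)" using fmem_nice_of r below_P by blast
    qed
    then obtain r where r: "r \<sqsubseteq> q" "(nice_of A, r) \<in> F \<or> (nice_of B, r) \<in> F" by blast
    then show "\<exists>r. r \<sqsubseteq> q \<and> (fmem r A U \<or> fmem r B U)"
      using U_nice n forces_mono[OF A\<kappa> r(1)] forces_mono[OF B\<kappa> r(1)] by blast
  next
    fix A q assume A: "name A" "q \<sqsubseteq> one" "fmem q A U"
    show "q \<tturnstile> eqpoll_fm A (ck \<kappa>)"
    proof (rule unbounded_eqpoll[OF A(1) sub[OF A(1,3)]])
      fix j q1 assume j: "j \<in> elts \<kappa>" and q1: "q1 \<sqsubseteq> q"
      then obtain r A' where r: "r \<sqsubseteq> q1" "(A', r) \<in> F" "feq r A A'"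
        using U_E A(3) fmem_mono below_P by metis
      \<comment> \<open>The part of \<open>A'\<close> strictly above \<open>j\<close>. It belongs to
        \<open>F\<close> because the tail of \<kappa> beyond \<open>j\<close> does, and members of
        \<open>F\<close> are forced nonempty densely; this yields the unboundedness of
        \<open>A\<close>.\<close>
      define C where "C = nice (\<lambda>i s. j \<in> elts i \<and> fmem s (ck i) A')"
      have C: "fmem s (ck i) C \<longleftrightarrow> i \<in> elts \<kappa> \<and> j \<in> elts i \<and> fmem s (ck i) A'" if "s \<in> elts P" for s i
        unfolding C_def
      proof (rule fmem_nice)
        fix i s assume s: "s \<in> elts P" and d: "\<And>r. r \<sqsubseteq> s \<Longrightarrow> \<exists>q. q \<sqsubseteq> r \<and> j \<in> elts i \<and> fmem q (ck i) A'"
        show "j \<in> elts i \<and> fmem s (ck i) A'"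
          using d[OF below_refl[OF s]] d fmem_dense[of s "ck i" A'] by blast
      qed (use that fmem_mono in blast)+
      have "(ck (tail \<kappa> j), r) \<in> F" using FD(6) \<kappa>_D j r(1) below_P by blast
      moreover have "forced_inter r A' (ck (tail \<kappa> j)) C"
        unfolding forced_inter_def using C by (auto simp: fmem_ck_iff elts_tail below_P(1))
      ultimately have "(C, r) \<in> F" using FD(4) r(2) nice_cells unfolding C_def by blast
      then obtain s i where s: "s \<sqsubseteq> r" "i \<in> elts \<kappa>" "fmem s (ck i) C" using FD(5) by blast
      then have "j \<in> elts i" "fmem s (ck i) A'" using C below_P by blast+
      moreover have "feq s A' A" using r(3) s(1) feq_mono feq_sym by blast
      ultimately show "\<exists>r i. r \<sqsubseteq> q1 \<and> i \<in> elts \<kappa> \<and> j \<in> elts i \<and> fmem r (ck i) A"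
        using s r(1) fmem_cong2 below_trans by blast
    qed
  qed
  moreover have "one \<tturnstile> (ck D \<^bold>\<subseteq> U)"
    unfolding forces_sub
  proof (intro allI impI, rule fmem_dense)
    fix x q r assume "fmem q x (ck D)" "r \<sqsubseteq> q"
    then have "fmem r x (ck D)" "r \<in> elts P" using fmem_mono below_P by blast+
    then obtain s B where s: "s \<sqsubseteq> r" "B \<in> elts D" "feq s x (ck B)" using fmem_ckE by metis
    then have "fmem s (ck B) U" using U_I D_F below_P by blast
    then show "\<exists>s. s \<sqsubseteq> r \<and> fmem s x U" using s fmem_cong1 feq_sym by blast
  qed
  ultimately show ?thesis using U by blast
qed

lemma forces_few_generators:
  "one \<tturnstile> (\<^bold>\<forall>U. uniform_ultrafilter_fm (ck \<kappa>) U \<^bold>\<and> ck D \<^bold>\<subseteq> U \<^bold>\<longrightarrow>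
      (\<^bold>\<exists>X. generates_fm (ck \<kappa>) X U \<^bold>\<and> lepoll_fm X (ck \<mu>)))"
proof (rule forces_Forall_ImpI)
  fix U q assume U: "name U" "q \<sqsubseteq> one" "q \<tturnstile> (uniform_ultrafilter_fm (ck \<kappa>) U \<^bold>\<and> ck D \<^bold>\<subseteq> U)"
  have filt: "q \<tturnstile> filter_fm (ck \<kappa>) U" and D: "q \<tturnstile> (ck D \<^bold>\<subseteq> U)"
    using U(3) unfolding uniform_ultrafilter_fm_def ultrafilter_fm_def by (simp_all only: forces.simps(4))
  obtain X where X: "name X" "q \<tturnstile> generates_fm (ck \<kappa>) X U" "q \<tturnstile> lepoll_fm X (ck \<mu>)"
    using few_generators[OF U(1) below_P(1)[OF U(2)] filt D] by blast
  show "q \<tturnstile> (\<^bold>\<exists>X. generates_fm (ck \<kappa>) X U \<^bold>\<and> lepoll_fm X (ck \<mu>))"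
    by (rule forces_ExistsI[OF X(1)]) (use X in \<open>simp only: forces.simps(4)\<close>)
qed

text \<open>One ultrafilter suffices: below a suitable condition, a generating family of the
  ultrafilter constructed above has the size of some \<theta> \<le> \<mu>, and the least such size
  does not exceed \<theta>.\<close>

lemma forces_ultrafilter_number_le:
  "one \<tturnstile> (\<^bold>\<exists>\<nu>. ultrafilter_number_fm (ck \<kappa>) \<nu> \<^bold>\<and> ord_le_fm \<nu> (ck \<mu>))"
proof (rule forces_dense)
  fix p assume "p \<sqsubseteq> one"
  then have p: "p \<in> elts P" using below_P by blast
  obtain U where U: "name U" "p \<tturnstile> uniform_ultrafilter_fm (ck \<kappa>) U" "p \<tturnstile> (ck D \<^bold>\<subseteq> U)"
    using uniform_ultrafilter_exists forces_mono below_one[OF p] by blast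
  have "p \<tturnstile> filter_fm (ck \<kappa>) U"
    using U(2) unfolding uniform_ultrafilter_fm_def ultrafilter_fm_def by (simp only: forces.simps(4))
  then obtain X q \<theta> where X: "name X" "p \<tturnstile> generates_fm (ck \<kappa>) X U"
    and q: "q \<sqsubseteq> p" "Ord \<theta>" "\<theta> \<in> elts \<mu> \<or> \<theta> = \<mu>" "q \<tturnstile> eqpoll_fm X (ck \<theta>)"
    using few_generators[OF U(1) p _ U(3)] by blast
  then obtain r \<nu> where r: "r \<sqsubseteq> q" "Ord \<nu>" "\<nu> \<in> elts \<theta> \<or> \<nu> = \<theta>" "r \<tturnstile> ultrafilter_number_fm (ck \<kappa>) (ck \<nu>)"
    using forces_ultrafilter_number[OF name_ck U(1) X(1) forces_mono[OF U(2) q(1)] forces_mono[OF X(2) q(1)]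
        q(4,2) below_P(1)[OF q(1)]] by blast
  have "\<nu> \<in> elts \<mu> \<or> \<nu> = \<mu>" using r(3) q(3) Ord_trans Ord_\<mu> by blast
  then have "r \<tturnstile> ord_le_fm (ck \<nu>) (ck \<mu>)"
    unfolding ord_le_fm_def forces_Disj forces.simps(1,2)
    using fmem_ckI feq_refl below_self below_P by blast
  then have "r \<tturnstile> (\<^bold>\<exists>\<nu>. ultrafilter_number_fm (ck \<kappa>) \<nu> \<^bold>\<and> ord_le_fm \<nu> (ck \<mu>))"
    by (intro forces_ExistsI[OF name_ck]) (use r in \<open>simp only: forces.simps(4)\<close>)
  then show "\<exists>q. q \<sqsubseteq> p \<and> q \<tturnstile> (\<^bold>\<exists>\<nu>. ultrafilter_number_fm (ck \<kappa>) \<nu> \<^bold>\<and> ord_le_fm \<nu> (ck \<mu>))"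
    using r q below_trans by blast
qed

end

theorem theorem2p6:
  fixes P one l \<kappa> \<mu> D :: "'v::zfc_universe" and le :: "('v \<times> 'v) set"
  assumes "forcing_notion P le one"
    and "InfCard l" and "InfCard \<kappa>" and "InfCard \<mu>"
    and "filter_on \<kappa> D"
    and "has_filtration l \<kappa> \<mu> D P le one"
    and "regular \<kappa>"
  shows "forces P le one
           (\<^bold>\<forall>U. uniform_ultrafilter_fm (check_name one \<kappa>) U \<^bold>\<and> check_name one D \<^bold>\<subseteq> U \<^bold>\<longrightarrow>
              (\<^bold>\<exists>X. generates_fm (check_name one \<kappa>) X U \<^bold>\<and> lepoll_fm X (check_name one \<mu>)))
       \<and> forces P le one
           (\<^bold>\<exists>\<nu>. ultrafilter_number_fm (check_name one \<kappa>) \<nu> \<^bold>\<and> ord_le_fm \<nu> (check_name one \<mu>))"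
proof -
  obtain Ps les ones where filt: "l \<in> elts (cf \<mu>)" "cf \<mu> \<in> elts \<kappa>" "\<kappa> \<in> elts \<mu>" "strong_limit \<mu>"
    "uniform \<kappa> D" "indecomposable (cf \<mu>) \<kappa> D" "chain_condition (card_succ l) P le"
    "\<forall>p\<in>elts P. \<exists>\<alpha>\<in>elts \<mu>. p \<in> elts (Ps \<alpha>)"
    "\<forall>\<alpha>\<in>elts \<mu>. complete_suborder (Ps \<alpha>) (les \<alpha>) (ones \<alpha>) P le one \<and>
                     (\<forall>\<xi>\<in>elts \<alpha>. elts (Ps \<xi>) \<subseteq> elts (Ps \<alpha>))"
    "\<forall>\<alpha>\<in>elts \<mu>. elts (Ps \<alpha>) \<prec> elts \<mu>"
    using assms(6) unfolding has_filtration_def by (elim exE conjE)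
  interpret filtered_forcing P le one l \<kappa> \<mu> D Ps
  proof unfold_locales
    show "elts (Ps \<alpha>) \<subseteq> elts P" if "\<alpha> \<in> elts \<mu>" for \<alpha>
      using filt(9) that unfolding complete_suborder_def by blast
  qed (use assms filt in blast)+
  show ?thesis using forces_few_generators forces_ultrafilter_number_le by blast
qed

end
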